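(* Let $\mathcal{S}=\sum_{i\in\Omega}\mathcal{S}_i$, where $\Omega$ is a set and each $\mathcal{S}_i$ is a commensurable subsemigroup of $\mathbb{R}_+$ containing $0$. Let $T=\{T_s\}_{s\in\mathcal{S}}$ be a semigroup of contractions on a Hilbert space $H$. Then $T$ has a regular unitary dilation if and only if for every finite set $v\subseteq\Omega$ and every $s\in\mathcal{S}$, $$\sum_{u\subseteq v}(-1)^{|u|}\,T_{s[u]}^*T_{s[u]}\ge 0 .$$ The minimal regular unitary dilation of $T$ is unique up to unitary equivalence. If $\mathcal{S}$ has a topology on it, and if $T$ is weakly continuous, then the (minimal regular) unitary dilation is strongly continuous.
   Context: $\mathbb{R}_+=[0,\infty)$ and $\mathbb{N}=\{0,1,2,\dots\}$. A commensurable semigroup is a semigroup $\Sigma$ such that for every $N$ elements $s_1,\dots,s_N\in\Sigma$ there exist $s_0\in\Sigma$ and $a_1,\dots,a_N\in\mathbb{N}$ with $s_i=a_is_0$ for all $i=1,\dots,N$. $\mathcal{S}=\sum_{i\in\Omega}\mathcal{S}_i$ is the additive semigroup of finitely supported functions $s:\Omega\to\mathbb{R}_+$ with $s(j)\in\mathcal{S}_j$ for all $j\in\Omega$; $\mathcal{S}-\mathcal{S}$ is the subgroup of $\mathbb{R}^\Omega$ it generates. For $s\in\mathcal{S}-\mathcal{S}$, $s_+$ is the function $j\mapsto\max\{0,s(j)\}$ and $s_-:=s_+-s$; both belong to $\mathcal{S}$. For a finite set $u\subseteq\Omega$, $|u|$ is its cardinality, and for $s\in\mathcal{S}$, $s[u]\in\mathcal{S}$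 is the function equal to $s(j)$ for $j\in u$ and $0$ for $j\notin u$. A semigroup of operators indexed by $\mathcal{S}$ is a family $T=\{T_s\}_{s\in\mathcal{S}}$ of bounded operators with $T_0=I$ and $T_{s+t}=T_sT_t$. A regular unitary dilation of $T$ is a semigroup of unitaries $U=\{U_s\}_{s\in\mathcal{S}}$ on a Hilbert space $K\supseteq H$ such that $P_HU_{s_-}^*U_{s_+}\big|_H=T_{s_-}^*T_{s_+}$ for all $s\in\mathcal{S}-\mathcal{S}$, where $P_H$ is the orthogonal projection onto $H$. It is minimal if $K=\bigvee_{s\in\mathcal{S}-\mathcal{S}}U_{s_-}^*U_{s_+}H$ (closed linear span). Two such dilations on $K$ and $K'$ are unitarily equivalent if there is a unitary $W:K\to K'$ with $W|_H=I_H$ intertwining them. Weak (strong) continuity means continuity of $s\mapsto T_s$ in the weak (strong) operator topology.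
   Formalization: The continuity claim fails for an arbitrary topology on S (e.g. a coarse one on ℕ), so the topology is required to make the maps s↦(s−t)_+ and s↦(s−t)_- continuous from S to S for every t in S; this holds for the discrete and pointwise topologies. *)

theory Defs
  imports "HOL-Analysis.Analysis" "HOL-Library.Function_Algebras" "HOL-Library.Nonpos_Ints"
begin

section \<open>Complex Hilbert spaces\<close>

class scaleC =
  fixes scaleC :: "complex \<Rightarrow> 'a \<Rightarrow> 'a"  (infixr \<open>*\<^sub>C\<close> 75)

class complex_vector = scaleC + ab_group_add +
  assumes scaleC_add_right: "a *\<^sub>C (x + y) = a *\<^sub>C x + a *\<^sub>C y"
    and scaleC_add_left: "(a + b) *\<^sub>C x = a *\<^sub>C x + b *\<^sub>C x"
    and scaleC_scaleC: "a *\<^sub>C (b *\<^sub>C x) = (a * b) *\<^sub>C x"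
    and scaleC_one: "1 *\<^sub>C x = x"

global_interpretation complex_vector:
  vector_space "scaleC :: complex \<Rightarrow> 'a \<Rightarrow> 'a :: complex_vector"
  defines csubspace = complex_vector.subspace
    and cspan = complex_vector.span
  by unfold_locales
    (simp_all add: scaleC_add_right scaleC_add_left scaleC_scaleC scaleC_one)

instantiation complex :: complex_vector
begin

definition scaleC_complex_def: "c *\<^sub>C (z::complex) = c * z"

instance
  by standard (simp_all add: scaleC_complex_def algebra_simps)

end

instantiation "fun" :: (type, complex_vector) complex_vector
begin

definition scaleC_fun_def: "c *\<^sub>C f = (\<lambda>x. c *\<^sub>C f x)"

instance
  by standard
    (simp_all add: scaleC_fun_def fun_eq_iff scaleC_add_right scaleC_add_left
      scaleC_scaleC scaleC_one)

end

text \<open>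
  HOL has no quantifier over types, and the dilation space is existentially quantified.  A Hilbert
  space is therefore a carrier inside an ambient complex vector space, with an inner product that is
  only meaningful on the carrier.
\<close>

record 'a hilbert =
  hcarrier :: "'a set"
  hinner :: "'a \<Rightarrow> 'a \<Rightarrow> complex"

definition hnorm :: "'a hilbert \<Rightarrow> 'a \<Rightarrow> real" where
  "hnorm H x = sqrt (Re (hinner H x x))"

text \<open>The value off the carrier is immaterial; it is fixed because \<^locale>\<open>Metric_space\<close> requires a
  function that is symmetric and nonnegative everywhere.\<close>

definition hdist :: "'a::complex_vector hilbert \<Rightarrow> 'a \<Rightarrow> 'a \<Rightarrow> real" where
  "hdist H x y = (if x \<in> hcarrier H \<and> y \<in> hcarrier H then hnorm H (x - y) else 0)"

abbreviation htopology :: "'a::complex_vector hilbert \<Rightarrow> 'a topology" where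
  "htopology H \<equiv> Metric_space.mtopology (hcarrier H) (hdist H)"

definition hilbert_space :: "'a::complex_vector hilbert \<Rightarrow> bool" where
  "hilbert_space H \<longleftrightarrow>
     csubspace (hcarrier H) \<and>
     (\<forall>x\<in>hcarrier H. \<forall>y\<in>hcarrier H. \<forall>z\<in>hcarrier H.
        hinner H (x + y) z = hinner H x z + hinner H y z) \<and>
     (\<forall>c. \<forall>x\<in>hcarrier H. \<forall>y\<in>hcarrier H. hinner H (c *\<^sub>C x) y = c * hinner H x y) \<and>
     (\<forall>x\<in>hcarrier H. \<forall>y\<in>hcarrier H. hinner H y x = cnj (hinner H x y)) \<and>
     (\<forall>x\<in>hcarrier H. hinner H x x \<in> \<real>\<^sub>\<ge>\<^sub>0) \<and>
     (\<forall>x\<in>hcarrier H. hinner H x x = 0 \<longrightarrow> x = 0) \<and>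
     Metric_space.mcomplete (hcarrier H) (hdist H)"

section \<open>Operators\<close>

definition linear_op ::
    "'a::complex_vector hilbert \<Rightarrow> 'b::complex_vector hilbert \<Rightarrow> ('a \<Rightarrow> 'b) \<Rightarrow> bool" where
  "linear_op H K A \<longleftrightarrow>
     A \<in> hcarrier H \<rightarrow> hcarrier K \<and>
     (\<forall>x\<in>hcarrier H. \<forall>y\<in>hcarrier H. A (x + y) = A x + A y) \<and>
     (\<forall>c. \<forall>x\<in>hcarrier H. A (c *\<^sub>C x) = c *\<^sub>C A x)"

definition bounded_op ::
    "'a::complex_vector hilbert \<Rightarrow> 'b::complex_vector hilbert \<Rightarrow> ('a \<Rightarrow> 'b) \<Rightarrow> bool" where
  "bounded_op H K A \<longleftrightarrow>
     linear_op H K A \<and> (\<exists>C. \<forall>x\<in>hcarrier H. hnorm K (A x) \<le> C * hnorm H x)"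

definition contraction_op ::
    "'a::complex_vector hilbert \<Rightarrow> 'b::complex_vector hilbert \<Rightarrow> ('a \<Rightarrow> 'b) \<Rightarrow> bool" where
  "contraction_op H K A \<longleftrightarrow>
     linear_op H K A \<and> (\<forall>x\<in>hcarrier H. hnorm K (A x) \<le> hnorm H x)"

definition isometric_op ::
    "'a::complex_vector hilbert \<Rightarrow> 'b::complex_vector hilbert \<Rightarrow> ('a \<Rightarrow> 'b) \<Rightarrow> bool" where
  "isometric_op H K V \<longleftrightarrow>
     linear_op H K V \<and>
     (\<forall>x\<in>hcarrier H. \<forall>y\<in>hcarrier H. hinner K (V x) (V y) = hinner H x y)"

definition unitary_op ::
    "'a::complex_vector hilbert \<Rightarrow> 'b::complex_vector hilbert \<Rightarrow> ('a \<Rightarrow> 'b) \<Rightarrow> bool" where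
  "unitary_op H K U \<longleftrightarrow> isometric_op H K U \<and> U ` hcarrier H = hcarrier K"

definition adjoint_op ::
    "'a::complex_vector hilbert \<Rightarrow> 'b::complex_vector hilbert \<Rightarrow> ('a \<Rightarrow> 'b) \<Rightarrow> 'b \<Rightarrow> 'a" where
  "adjoint_op H K A y =
     (THE z. z \<in> hcarrier H \<and> (\<forall>x\<in>hcarrier H. hinner K (A x) y = hinner H x z))"

definition orth_proj :: "'a::complex_vector hilbert \<Rightarrow> 'a set \<Rightarrow> 'a \<Rightarrow> 'a" where
  "orth_proj K M x = (THE y. y \<in> M \<and> (\<forall>z\<in>M. hinner K (x - y) z = 0))"

definition positive_op :: "'a hilbert \<Rightarrow> ('a \<Rightarrow> 'a) \<Rightarrow> bool" where
  "positive_op H A \<longleftrightarrow> (\<forall>x\<in>hcarrier H. hinner H (A x) x \<in> \<real>\<^sub>\<ge>\<^sub>0)"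

section \<open>The index semigroup\<close>

definition commensurable :: "real set \<Rightarrow> bool" where
  "commensurable A \<longleftrightarrow>
     (\<forall>(N::nat) s. (\<forall>i\<in>{1..N}. s i \<in> A) \<longrightarrow>
        (\<exists>s0\<in>A. \<exists>a::nat \<Rightarrow> nat. \<forall>i\<in>{1..N}. s i = real (a i) * s0))"

definition commensurable_subsemigroup :: "real set \<Rightarrow> bool" where
  "commensurable_subsemigroup A \<longleftrightarrow>
     A \<subseteq> {0..} \<and> 0 \<in> A \<and> (\<forall>a\<in>A. \<forall>b\<in>A. a + b \<in> A) \<and> commensurable A"

text \<open>Functions on \<open>\<Omega>\<close> are represented by functions on the whole type that vanish off \<open>\<Omega>\<close>.\<close>

definition index_semigroup :: "'i set \<Rightarrow> ('i \<Rightarrow> real set) \<Rightarrow> ('i \<Rightarrow> real) set" where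
  "index_semigroup \<Omega> \<S> =
     {s. (\<forall>j\<in>\<Omega>. s j \<in> \<S> j) \<and> (\<forall>j. j \<notin> \<Omega> \<longrightarrow> s j = 0) \<and> finite {j. s j \<noteq> 0}}"

text \<open>The subgroup generated by a commutative semigroup consists of its differences.\<close>

definition difference_group :: "('i \<Rightarrow> real) set \<Rightarrow> ('i \<Rightarrow> real) set" where
  "difference_group S = {s - t | s t. s \<in> S \<and> t \<in> S}"

definition pos_part :: "('i \<Rightarrow> real) \<Rightarrow> 'i \<Rightarrow> real" where
  "pos_part s = (\<lambda>j. max 0 (s j))"

definition neg_part :: "('i \<Rightarrow> real) \<Rightarrow> 'i \<Rightarrow> real" where
  "neg_part s = pos_part s - s"

definition restrict_index :: "('i \<Rightarrow> real) \<Rightarrow> 'i set \<Rightarrow> 'i \<Rightarrow> real" where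
  "restrict_index s u = (\<lambda>j. if j \<in> u then s j else 0)"

section \<open>Semigroups of operators and regular unitary dilations\<close>

definition op_semigroup ::
    "('i \<Rightarrow> real) set \<Rightarrow> 'a::complex_vector hilbert \<Rightarrow> (('i \<Rightarrow> real) \<Rightarrow> 'a \<Rightarrow> 'a) \<Rightarrow> bool" where
  "op_semigroup S H T \<longleftrightarrow>
     (\<forall>s\<in>S. bounded_op H H (T s)) \<and>
     (\<forall>x\<in>hcarrier H. T 0 x = x) \<and>
     (\<forall>s\<in>S. \<forall>t\<in>S. \<forall>x\<in>hcarrier H. T (s + t) x = T s (T t x))"

definition contraction_semigroup ::
    "('i \<Rightarrow> real) set \<Rightarrow> 'a::complex_vector hilbert \<Rightarrow> (('i \<Rightarrow> real) \<Rightarrow> 'a \<Rightarrow> 'a) \<Rightarrow> bool" where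
  "contraction_semigroup S H T \<longleftrightarrow> op_semigroup S H T \<and> (\<forall>s\<in>S. contraction_op H H (T s))"

definition unitary_semigroup ::
    "('i \<Rightarrow> real) set \<Rightarrow> 'a::complex_vector hilbert \<Rightarrow> (('i \<Rightarrow> real) \<Rightarrow> 'a \<Rightarrow> 'a) \<Rightarrow> bool" where
  "unitary_semigroup S H U \<longleftrightarrow> op_semigroup S H U \<and> (\<forall>s\<in>S. unitary_op H H (U s))"

text \<open>For \<open>g \<in> S - S\<close> this is the operator \<open>T\<^bsub>g-\<^esub>\<^sup>* T\<^bsub>g+\<^esub>\<close>.\<close>

definition regular_op ::
    "'a::complex_vector hilbert \<Rightarrow> (('i \<Rightarrow> real) \<Rightarrow> 'a \<Rightarrow> 'a) \<Rightarrow> ('i \<Rightarrow> real) \<Rightarrow> 'a \<Rightarrow> 'a" where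
  "regular_op H T g = adjoint_op H H (T (neg_part g)) \<circ> T (pos_part g)"

text \<open>The inclusion of \<open>H\<close> in \<open>K\<close> is given by an isometric embedding \<open>V\<close>.\<close>

definition regular_unitary_dilation ::
    "('i \<Rightarrow> real) set \<Rightarrow> 'h::complex_vector hilbert \<Rightarrow> (('i \<Rightarrow> real) \<Rightarrow> 'h \<Rightarrow> 'h) \<Rightarrow>
     'k::complex_vector hilbert \<Rightarrow> ('h \<Rightarrow> 'k) \<Rightarrow> (('i \<Rightarrow> real) \<Rightarrow> 'k \<Rightarrow> 'k) \<Rightarrow> bool" where
  "regular_unitary_dilation S H T K V U \<longleftrightarrow>
     hilbert_space K \<and> isometric_op H K V \<and> unitary_semigroup S K U \<and>
     (\<forall>g\<in>difference_group S. \<forall>h\<in>hcarrier H.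
        orth_proj K (V ` hcarrier H) (regular_op K U g (V h)) = V (regular_op H T g h))"

definition minimal_regular_unitary_dilation ::
    "('i \<Rightarrow> real) set \<Rightarrow> 'h::complex_vector hilbert \<Rightarrow> (('i \<Rightarrow> real) \<Rightarrow> 'h \<Rightarrow> 'h) \<Rightarrow>
     'k::complex_vector hilbert \<Rightarrow> ('h \<Rightarrow> 'k) \<Rightarrow> (('i \<Rightarrow> real) \<Rightarrow> 'k \<Rightarrow> 'k) \<Rightarrow> bool" where
  "minimal_regular_unitary_dilation S H T K V U \<longleftrightarrow>
     regular_unitary_dilation S H T K V U \<and>
     hcarrier K =
       htopology K closure_of
         cspan {regular_op K U g (V h) | g h. g \<in> difference_group S \<and> h \<in> hcarrier H}"

definition unitarily_equivalent_dilations ::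
    "('i \<Rightarrow> real) set \<Rightarrow> 'h::complex_vector hilbert \<Rightarrow>
     'k::complex_vector hilbert \<Rightarrow> ('h \<Rightarrow> 'k) \<Rightarrow> (('i \<Rightarrow> real) \<Rightarrow> 'k \<Rightarrow> 'k) \<Rightarrow>
     'l::complex_vector hilbert \<Rightarrow> ('h \<Rightarrow> 'l) \<Rightarrow> (('i \<Rightarrow> real) \<Rightarrow> 'l \<Rightarrow> 'l) \<Rightarrow> bool" where
  "unitarily_equivalent_dilations S H K V U K' V' U' \<longleftrightarrow>
     (\<exists>W. unitary_op K K' W \<and>
          (\<forall>h\<in>hcarrier H. W (V h) = V' h) \<and>
          (\<forall>s\<in>S. \<forall>x\<in>hcarrier K. W (U s x) = U' s (W x)))"

definition regular_positivity ::
    "'i set \<Rightarrow> ('i \<Rightarrow> real) set \<Rightarrow> 'h::complex_vector hilbert \<Rightarrow>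
     (('i \<Rightarrow> real) \<Rightarrow> 'h \<Rightarrow> 'h) \<Rightarrow> bool" where
  "regular_positivity \<Omega> S H T \<longleftrightarrow>
     (\<forall>v s. finite v \<and> v \<subseteq> \<Omega> \<and> s \<in> S \<longrightarrow>
        positive_op H
          (\<lambda>x. \<Sum>u\<in>Pow v. (- 1) ^ card u *\<^sub>C
             adjoint_op H H (T (restrict_index s u)) (T (restrict_index s u) x)))"

section \<open>Continuity\<close>

text \<open>
  For a topology on \<open>S\<close> unrelated to its algebraic structure, weak continuity of a semigroup does
  not pass to its minimal regular unitary dilation.  On \<open>S = \<nat>\<close> take the open sets
  \<open>{}\<close>, \<open>{0}\<close>, \<open>{1, 2, \<dots>}\<close>, \<open>\<nat>\<close>: addition is jointly continuous, and \<open>T\<^sub>0 = I\<close>, \<open>T\<^sub>n = 0\<close> for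
  \<open>n \<ge> 1\<close> is continuous, but its dilation is a bilateral shift, whose distinct powers \<open>n \<ge> 1\<close> would
  have to coincide.  The topology has to be compatible with the operations in terms of which regular
  dilations are defined.  Every topology that \<open>S\<close> inherits from a group topology on \<open>S - S\<close> with
  continuous positive parts is compatible in the following sense.
\<close>

definition compatible_topology :: "('i \<Rightarrow> real) set \<Rightarrow> ('i \<Rightarrow> real) topology \<Rightarrow> bool" where
  "compatible_topology S X \<longleftrightarrow>
     topspace X = S \<and>
     (\<forall>t\<in>S. continuous_map X X (\<lambda>s. pos_part (s - t)) \<and>
            continuous_map X X (\<lambda>s. neg_part (s - t)))"

definition weakly_continuous ::
    "('i \<Rightarrow> real) topology \<Rightarrow> 'a hilbert \<Rightarrow> (('i \<Rightarrow> real) \<Rightarrow> 'a \<Rightarrow> 'a) \<Rightarrow> bool" where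
  "weakly_continuous X H T \<longleftrightarrow>
     (\<forall>x\<in>hcarrier H. \<forall>y\<in>hcarrier H. continuous_map X euclidean (\<lambda>s. hinner H (T s x) y))"

definition strongly_continuous ::
    "('i \<Rightarrow> real) topology \<Rightarrow> 'a::complex_vector hilbert \<Rightarrow>
     (('i \<Rightarrow> real) \<Rightarrow> 'a \<Rightarrow> 'a) \<Rightarrow> bool" where
  "strongly_continuous X H T \<longleftrightarrow>
     (\<forall>x\<in>hcarrier H. continuous_map X (htopology H) (\<lambda>s. T s x))"

text \<open>In particular the topology of pointwise convergence is compatible.\<close>

lemma commensurable_max_diff:
  assumes A: "commensurable_subsemigroup A" and a: "a \<in> A" and b: "b \<in> A"
  shows "max 0 (a - b) \<in> A"
proof -
  have mult: "real n * c \<in> A" if "c \<in> A" for n c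
  proof (induction n)
    case 0
    then show ?case using A by (simp add: commensurable_subsemigroup_def)
  next
    case (Suc n)
    then have "c + real n * c \<in> A"
      using A that by (simp add: commensurable_subsemigroup_def)
    then show ?case by (simp add: distrib_right)
  qed
  define s where "s = (\<lambda>i::nat. if i = 1 then a else b)"
  have "\<forall>i\<in>{1..2}. s i \<in> A"
    using a b by (simp add: s_def)
  then obtain c and m :: "nat \<Rightarrow> nat" where c: "c \<in> A"
    and m: "\<forall>i\<in>{1..2}. s i = real (m i) * c"
    using A unfolding commensurable_subsemigroup_def commensurable_def by blast
  have ab: "a = real (m 1) * c" "b = real (m 2) * c"
    using m[rule_format, of 1] m[rule_format, of 2] by (simp_all add: s_def)
  have "0 \<le> c"
    using A c by (auto simp: commensurable_subsemigroup_def)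
  have "max 0 (a - b) = real (m 1 - m 2) * c"
  proof (cases "m 2 \<le> m 1")
    case True
    then have "a - b = real (m 1 - m 2) * c"
      by (simp add: ab of_nat_diff left_diff_distrib)
    then show ?thesis
      using \<open>0 \<le> c\<close> by simp
  next
    case False
    then have "a \<le> b"
      unfolding ab using \<open>0 \<le> c\<close> by (intro mult_right_mono) simp_all
    then show ?thesis
      using False by simp
  qed
  then show ?thesis
    using mult[OF c] by simp
qed

lemma pos_part_diff_in_index_semigroup:
  assumes "\<And>i. i \<in> \<Omega> \<Longrightarrow> commensurable_subsemigroup (\<S> i)"
    and s: "s \<in> index_semigroup \<Omega> \<S>" and t: "t \<in> index_semigroup \<Omega> \<S>"
  shows "pos_part (s - t) \<in> index_semigroup \<Omega> \<S>"
proof -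
  have "{j. pos_part (s - t) j \<noteq> 0} \<subseteq> {j. s j \<noteq> 0} \<union> {j. t j \<noteq> 0}"
    by (auto simp: pos_part_def)
  moreover have "finite ({j. s j \<noteq> 0} \<union> {j. t j \<noteq> 0})"
    using s t by (simp add: index_semigroup_def)
  ultimately have "finite {j. pos_part (s - t) j \<noteq> 0}"
    by (rule finite_subset)
  then show ?thesis
    using assms by (auto simp: index_semigroup_def pos_part_def intro!: commensurable_max_diff)
qed

lemma neg_part_diff: "neg_part (s - t) = pos_part (t - s)"
  by (auto simp: neg_part_def pos_part_def fun_eq_iff)

lemma compatible_topology_pointwise:
  assumes "\<And>i. i \<in> \<Omega> \<Longrightarrow> commensurable_subsemigroup (\<S> i)"
  shows "compatible_topology (index_semigroup \<Omega> \<S>) (top_of_set (index_semigroup \<Omega> \<S>))"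
proof -
  have "continuous_on A (\<lambda>s::'a \<Rightarrow> real. pos_part (s - t))"
    "continuous_on A (\<lambda>s::'a \<Rightarrow> real. pos_part (t - s))" for A t
    unfolding pos_part_def
    by (auto intro!: continuous_intros
        continuous_on_subset[OF continuous_on_product_coordinates])
  then show ?thesis
    using pos_part_diff_in_index_semigroup[OF assms]
    by (auto simp: compatible_topology_def neg_part_diff)
qed

end

theory Submission
  imports Defs
begin

text \<open>
  For \<open>g \<in> S - S\<close> the numbers \<open>\<langle>T\<^bsub>g+\<^esub> h, T\<^bsub>g-\<^esub> k\<rangle>\<close> are the Gram matrix of the vectors \<open>U\<^bsub>g\<^esub> h\<close> of a
  regular dilation.  Hence a minimal dilation is unique, and it exists exactly when
  \<open>(g, g') \<mapsto> T\<^bsub>(g - g')-\<^esub>\<^sup>* T\<^bsub>(g - g')+\<^esub>\<close> is positive definite: the dilation then acts by translations on the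
  reproducing kernel space of this kernel.  Conversely the Brehmer sum of \<open>s\<close> and \<open>v\<close> at \<open>h\<close> is the
  squared norm of \<open>\<Sum>u \<subseteq> v. (-1)\<^bsup>|u|\<^esup> U\<^bsub>s[u]\<^esub>\<^sup>* T\<^bsub>s[u]\<^esub> h\<close>.  To pass from Brehmer positivity to positive
  definiteness, finitely many indices are moved into \<open>S\<close> by a translation and placed in a finite
  grid; telescoping over the grid expresses the form as a sum of Brehmer sums.  Commensurability
  enters only in that differences of comparable elements of each \<open>\<S>\<^sub>i\<close> stay in \<open>\<S>\<^sub>i\<close>.
\<close>

section \<open>Hilbert spaces given by carriers\<close>

text \<open>For indices n, m in the cone with pointwise minimum q, the positive and negative parts
  of n - m are n - q and m - q. So the entry for the pair is F(q), where F(r) is the inner product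
  of T(n - r) x with T(m - r) y. Telescoping rebuilds F(q) from its mixed backward differences at
  the grid points p below q, with F read as 0 below the grid. At a fixed p all pairs of indices
  above p use the same step vectors, so their differences add up to one quadratic expression in a
  single vector. The grid may be unequally spaced because each step is itself an element of S, and
  positivity is available at every such element. The dilation space has to live in a type determined
  by those of H and of the indices. A space of H-valued functions on S - S serves: completeness
  comes from H through point evaluations, and norm bounds are expressed by pairings with finite
  lists, so that neither a quotient nor an abstract completion has to be formed.\<close>

lemma complex_quadratic_nonneg:
  fixes a d :: real and b :: complex
  assumes nonneg: "\<And>c. 0 \<le> a + 2 * Re (c * b) + (cmod c)\<^sup>2 * d" and d: "0 \<le> d"
  shows "(cmod b)\<^sup>2 \<le> a * d"
proof -
  have cnj_mult: "cnj b * b = of_real ((cmod b)\<^sup>2)"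
    by (metis complex_norm_square mult.commute)
  show ?thesis
  proof (cases "d = 0")
    case True
    have "b = 0"
    proof (rule ccontr)
      assume "b \<noteq> 0"
      then have pos: "(cmod b)\<^sup>2 > 0" by simp
      \<comment> \<open>With d = 0 the expression is affine along multiples of \<open>cnj b\<close>;
        this t makes it equal to -1. The case occurs for forms that are only semidefinite.\<close>
      define t where "t = (a + 1) / (2 * (cmod b)\<^sup>2)"
      have "complex_of_real (- t) * cnj b * b = of_real (- t * (cmod b)\<^sup>2)"
        by (simp add: mult.assoc cnj_mult)
      then have "Re (complex_of_real (- t) * cnj b * b) = - t * (cmod b)\<^sup>2"
        by (metis Re_complex_of_real)
      then have "0 \<le> a - 2 * t * (cmod b)\<^sup>2"
        using nonneg[of "of_real (- t) * cnj b"] True by simp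
      also have "2 * t * (cmod b)\<^sup>2 = a + 1" using pos by (simp add: t_def)
      finally show False by simp
    qed
    then show ?thesis using True by simp
  next
    case False
    then have pos: "d > 0" using d by simp
    \<comment> \<open>The minimiser of the quadratic; inserting it leaves a - |b|^2 / d.\<close>
    define c where "c = - cnj b / of_real d"
    have "c * b = of_real (- ((cmod b)\<^sup>2 / d))"
      by (simp add: c_def cnj_mult)
    then have 1: "Re (c * b) = - ((cmod b)\<^sup>2 / d)"
      by (metis Re_complex_of_real)
    have 2: "(cmod c)\<^sup>2 * d = (cmod b)\<^sup>2 / d"
      using pos by (simp add: c_def norm_divide power_divide power2_eq_square)
    show ?thesis
      using nonneg[of c] pos unfolding 1 2 by (simp add: field_simps)
  qed
qed

text \<open>Completeness is left out, so that norm, metric, closure and Cauchy-Schwarz are at hand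
  for the kernel space before that space is shown to be complete.\<close>

locale inner_space =
  fixes H :: "'a::complex_vector hilbert"
  assumes subspace: "csubspace (hcarrier H)"
    and inner_add_left: "x \<in> hcarrier H \<Longrightarrow> y \<in> hcarrier H \<Longrightarrow> z \<in> hcarrier H \<Longrightarrow>
      hinner H (x + y) z = hinner H x z + hinner H y z"
    and inner_scaleC_left: "x \<in> hcarrier H \<Longrightarrow> y \<in> hcarrier H \<Longrightarrow>
      hinner H (c *\<^sub>C x) y = c * hinner H x y"
    and inner_commute: "x \<in> hcarrier H \<Longrightarrow> y \<in> hcarrier H \<Longrightarrow> hinner H y x = cnj (hinner H x y)"
    and inner_self_nonneg: "x \<in> hcarrier H \<Longrightarrow> hinner H x x \<in> \<real>\<^sub>\<ge>\<^sub>0"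
    and inner_definite: "x \<in> hcarrier H \<Longrightarrow> hinner H x x = 0 \<Longrightarrow> x = 0"
begin

lemma zero_mem [simp]: "0 \<in> hcarrier H"
  by (rule complex_vector.subspace_0[OF subspace])

lemma add_mem [simp]: "x \<in> hcarrier H \<Longrightarrow> y \<in> hcarrier H \<Longrightarrow> x + y \<in> hcarrier H"
  by (rule complex_vector.subspace_add[OF subspace])

lemma diff_mem [simp]: "x \<in> hcarrier H \<Longrightarrow> y \<in> hcarrier H \<Longrightarrow> x - y \<in> hcarrier H"
  by (rule complex_vector.subspace_diff[OF subspace])

lemma scaleC_mem [simp]: "x \<in> hcarrier H \<Longrightarrow> c *\<^sub>C x \<in> hcarrier H"
  by (rule complex_vector.subspace_scale[OF subspace])

lemma sum_mem [simp]: "(\<And>i. i \<in> I \<Longrightarrow> f i \<in> hcarrier H) \<Longrightarrow> sum f I \<in> hcarrier H"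
  by (rule complex_vector.subspace_sum[OF subspace])

lemma inner_add_right:
  "x \<in> hcarrier H \<Longrightarrow> y \<in> hcarrier H \<Longrightarrow> z \<in> hcarrier H \<Longrightarrow>
   hinner H z (x + y) = hinner H z x + hinner H z y"
  by (metis add_mem complex_cnj_add inner_add_left inner_commute)

lemma inner_scaleC_right:
  "x \<in> hcarrier H \<Longrightarrow> y \<in> hcarrier H \<Longrightarrow> hinner H y (c *\<^sub>C x) = cnj c * hinner H y x"
  by (metis scaleC_mem complex_cnj_mult inner_scaleC_left inner_commute)

lemma inner_diff_left:
  "x \<in> hcarrier H \<Longrightarrow> y \<in> hcarrier H \<Longrightarrow> z \<in> hcarrier H \<Longrightarrow>
   hinner H (x - y) z = hinner H x z - hinner H y z"
  by (metis add_diff_cancel_right' diff_add_cancel diff_mem inner_add_left)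

lemma inner_diff_right:
  "x \<in> hcarrier H \<Longrightarrow> y \<in> hcarrier H \<Longrightarrow> z \<in> hcarrier H \<Longrightarrow>
   hinner H z (x - y) = hinner H z x - hinner H z y"
  by (metis add_diff_cancel_right' diff_add_cancel diff_mem inner_add_right)

lemma inner_zero_left [simp]: "x \<in> hcarrier H \<Longrightarrow> hinner H 0 x = 0"
  using inner_diff_left[of x x x] by simp

lemma inner_zero_right [simp]: "x \<in> hcarrier H \<Longrightarrow> hinner H x 0 = 0"
  using inner_diff_right[of x x x] by simp

lemma inner_sum_left:
  "(\<And>i. i \<in> I \<Longrightarrow> f i \<in> hcarrier H) \<Longrightarrow> y \<in> hcarrier H \<Longrightarrow>
   hinner H (sum f I) y = (\<Sum>i\<in>I. hinner H (f i) y)"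
  by (induction I rule: infinite_finite_induct) (simp_all add: inner_add_left)

lemma inner_sum_right:
  "(\<And>i. i \<in> I \<Longrightarrow> f i \<in> hcarrier H) \<Longrightarrow> y \<in> hcarrier H \<Longrightarrow>
   hinner H y (sum f I) = (\<Sum>i\<in>I. hinner H y (f i))"
  by (induction I rule: infinite_finite_induct) (simp_all add: inner_add_right)

lemma inner_sum_sum:
  assumes "\<And>i. i \<in> I \<Longrightarrow> f i \<in> hcarrier H" "\<And>k. k \<in> J \<Longrightarrow> g k \<in> hcarrier H"
  shows "hinner H (sum f I) (sum g J) = (\<Sum>i\<in>I. \<Sum>k\<in>J. hinner H (f i) (g k))"
proof -
  have "hinner H (sum f I) (sum g J) = (\<Sum>i\<in>I. hinner H (f i) (sum g J))"
    using assms by (intro inner_sum_left sum_mem)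
  also have "\<dots> = (\<Sum>i\<in>I. \<Sum>k\<in>J. hinner H (f i) (g k))"
    using assms by (intro sum.cong refl inner_sum_right)
  finally show ?thesis .
qed

lemma hnorm_ge_0 [simp]: "x \<in> hcarrier H \<Longrightarrow> 0 \<le> hnorm H x"
  using inner_self_nonneg[of x] by (simp add: hnorm_def complex_nonneg_Reals_iff)

lemma hnorm_square: "x \<in> hcarrier H \<Longrightarrow> (hnorm H x)\<^sup>2 = Re (hinner H x x)"
  using inner_self_nonneg[of x] by (simp add: hnorm_def complex_nonneg_Reals_iff)

lemma inner_self: "x \<in> hcarrier H \<Longrightarrow> hinner H x x = of_real ((hnorm H x)\<^sup>2)"
  using inner_self_nonneg[of x] hnorm_square[of x]
  by (simp add: complex_nonneg_Reals_iff complex_eq_iff)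

lemma hnorm_eq_0: "x \<in> hcarrier H \<Longrightarrow> hnorm H x = 0 \<longleftrightarrow> x = 0"
  using inner_self[of x] inner_definite[of x] by (auto simp: hnorm_def)

lemma hnorm_zero [simp]: "hnorm H 0 = 0"
  using hnorm_eq_0[of 0] by simp

lemma eq_zero_if_orthogonal:
  assumes "x \<in> hcarrier H" "\<And>y. y \<in> hcarrier H \<Longrightarrow> hinner H x y = 0"
  shows "x = 0"
  using assms hnorm_eq_0[of x] by (simp add: hnorm_def)

lemma hnorm_add_square:
  assumes "x \<in> hcarrier H" "y \<in> hcarrier H"
  shows "(hnorm H (x + y))\<^sup>2 = (hnorm H x)\<^sup>2 + 2 * Re (hinner H x y) + (hnorm H y)\<^sup>2"
proof -
  have "Re (hinner H y x) = Re (hinner H x y)"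
    using inner_commute[OF assms] by simp
  then show ?thesis
    using assms by (simp add: hnorm_square inner_add_left inner_add_right)
qed

lemma hnorm_diff_square:
  assumes "x \<in> hcarrier H" "y \<in> hcarrier H"
  shows "(hnorm H (x - y))\<^sup>2 = (hnorm H x)\<^sup>2 - 2 * Re (hinner H x y) + (hnorm H y)\<^sup>2"
proof -
  have "Re (hinner H y x) = Re (hinner H x y)"
    using inner_commute[OF assms] by simp
  then show ?thesis
    using assms by (simp add: hnorm_square inner_diff_left inner_diff_right)
qed

lemma hnorm_scaleC:
  assumes "x \<in> hcarrier H"
  shows "hnorm H (c *\<^sub>C x) = cmod c * hnorm H x"
proof -
  have "hinner H (c *\<^sub>C x) (c *\<^sub>C x) = (c * cnj c) * hinner H x x"
    using assms by (simp add: inner_scaleC_left inner_scaleC_right)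
  also have "\<dots> = of_real ((cmod c)\<^sup>2 * (hnorm H x)\<^sup>2)"
    using assms by (simp only: inner_self complex_norm_square[symmetric] of_real_mult)
  finally have "Re (hinner H (c *\<^sub>C x) (c *\<^sub>C x)) = (cmod c * hnorm H x)\<^sup>2"
    by (simp only: Re_complex_of_real power_mult_distrib)
  then show ?thesis
    using assms by (simp add: hnorm_def[of H "c *\<^sub>C x"])
qed

lemma Cauchy_Schwarz:
  assumes "x \<in> hcarrier H" "y \<in> hcarrier H"
  shows "cmod (hinner H x y) \<le> hnorm H x * hnorm H y"
proof -
  have "(cmod (hinner H y x))\<^sup>2 \<le> (hnorm H x)\<^sup>2 * (hnorm H y)\<^sup>2"
  proof (rule complex_quadratic_nonneg)
    fix c
    have "0 \<le> (hnorm H (x + c *\<^sub>C y))\<^sup>2" by simp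
    also have "\<dots> = (hnorm H x)\<^sup>2 + 2 * Re (hinner H x (c *\<^sub>C y)) + (hnorm H (c *\<^sub>C y))\<^sup>2"
      using assms by (intro hnorm_add_square) simp_all
    also have "hinner H x (c *\<^sub>C y) = cnj (c * hinner H y x)"
      using assms inner_commute[of y x] by (simp add: inner_scaleC_right)
    finally show "0 \<le> (hnorm H x)\<^sup>2 + 2 * Re (c * hinner H y x) + (cmod c)\<^sup>2 * (hnorm H y)\<^sup>2"
      using assms by (simp add: hnorm_scaleC power_mult_distrib)
  qed simp
  then have "(cmod (hinner H x y))\<^sup>2 \<le> (hnorm H x * hnorm H y)\<^sup>2"
    using inner_commute[of x y] assms by (simp add: power_mult_distrib)
  then show ?thesis
    using assms by (simp add: power2_le_iff_abs_le)
qed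

lemma hnorm_triangle:
  assumes "x \<in> hcarrier H" "y \<in> hcarrier H"
  shows "hnorm H (x + y) \<le> hnorm H x + hnorm H y"
proof -
  have "Re (hinner H x y) \<le> hnorm H x * hnorm H y"
    using Cauchy_Schwarz[OF assms] complex_Re_le_cmod order_trans by blast
  then have "(hnorm H (x + y))\<^sup>2 \<le> (hnorm H x + hnorm H y)\<^sup>2"
    using assms by (simp add: hnorm_add_square power2_sum)
  then show ?thesis
    using assms by (meson add_nonneg_nonneg hnorm_ge_0 power2_le_imp_le)
qed

lemma hnorm_minus_commute:
  assumes "x \<in> hcarrier H" "y \<in> hcarrier H"
  shows "hnorm H (x - y) = hnorm H (y - x)"
proof -
  have "x - y = (- 1) *\<^sub>C (y - x)"
    by (simp add: complex_vector.scale_minus_left scaleC_one)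
  then show ?thesis
    using assms by (simp add: hnorm_scaleC del: complex_vector.scale_minus_left)
qed

lemma hnorm_triangle_diff:
  assumes "x \<in> hcarrier H" "y \<in> hcarrier H" "z \<in> hcarrier H"
  shows "hnorm H (x - z) \<le> hnorm H (x - y) + hnorm H (y - z)"
  using hnorm_triangle[of "x - y" "y - z"] assms by simp

lemma metric_space: "Metric_space (hcarrier H) (hdist H)"
proof
  show "0 \<le> hdist H x y" for x y
    by (simp add: hdist_def)
  show "hdist H x y = hdist H y x" for x y
    by (simp add: hdist_def hnorm_minus_commute)
  show "hdist H x y = 0 \<longleftrightarrow> x = y" if "x \<in> hcarrier H" "y \<in> hcarrier H" for x y
    using that by (simp add: hdist_def hnorm_eq_0)
  show "hdist H x z \<le> hdist H x y + hdist H y z"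
    if "x \<in> hcarrier H" "y \<in> hcarrier H" "z \<in> hcarrier H" for x y z
    using that by (simp add: hdist_def hnorm_triangle_diff)
qed

sublocale metric: Metric_space "hcarrier H" "hdist H"
  by (rule metric_space)

lemma hilbert_spaceI:
  assumes "\<And>f. (\<And>n::nat. f n \<in> hcarrier H) \<Longrightarrow>
      (\<And>e. e > 0 \<Longrightarrow> \<exists>N. \<forall>m\<ge>N. \<forall>n\<ge>N. hnorm H (f m - f n) < e) \<Longrightarrow>
      \<exists>l\<in>hcarrier H. (\<lambda>n. hnorm H (f n - l)) \<longlonglongrightarrow> 0"
  shows "hilbert_space H"
proof -
  have "\<exists>l. limitin (htopology H) f l sequentially" if "metric.MCauchy f" for f
  proof -
    have f: "f n \<in> hcarrier H" for n
      using that by (auto simp: metric.MCauchy_def)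
    then have "\<exists>N. \<forall>m\<ge>N. \<forall>n\<ge>N. hnorm H (f m - f n) < e" if "e > 0" for e
      using \<open>metric.MCauchy f\<close> that by (auto simp: metric.MCauchy_def hdist_def)
    with f have "\<exists>l\<in>hcarrier H. (\<lambda>n. hnorm H (f n - l)) \<longlonglongrightarrow> 0"
      by (rule assms)
    then obtain l where l: "l \<in> hcarrier H" "(\<lambda>n. hnorm H (f n - l)) \<longlonglongrightarrow> 0" by blast
    have "\<exists>N. \<forall>n\<ge>N. f n \<in> hcarrier H \<and> hdist H (f n) l < e" if "e > 0" for e
      using order_tendstoD(2)[OF l(2) that] f l(1) by (simp add: eventually_sequentially hdist_def)
    then have "limitin (htopology H) f l sequentially"
      using l(1) by (simp add: metric.limit_metric_sequentially)
    then show ?thesis by blast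
  qed
  then have "metric.mcomplete" by (simp add: metric.mcomplete_def)
  then show ?thesis
    unfolding hilbert_space_def
    by (intro conjI ballI allI impI subspace inner_add_left inner_scaleC_left inner_commute
        inner_self_nonneg inner_definite)
qed

lemma in_closure_iff:
  assumes "D \<subseteq> hcarrier H"
  shows "x \<in> htopology H closure_of D \<longleftrightarrow>
    x \<in> hcarrier H \<and> (\<forall>e>0. \<exists>y\<in>D. hnorm H (x - y) < e)"
proof -
  have "x \<in> hcarrier H \<and> (\<exists>y\<in>D. y \<in> metric.mball x e) \<longleftrightarrow>
      x \<in> hcarrier H \<and> (\<exists>y\<in>D. hnorm H (x - y) < e)" for e
    using assms by (auto simp: metric.in_mball hdist_def)
  then show ?thesis
    unfolding metric.metric_closure_of by blast
qed

lemma tendsto_inner_left: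
  assumes f: "\<And>n. f n \<in> hcarrier H" and l: "l \<in> hcarrier H" and y: "y \<in> hcarrier H"
    and lim: "((\<lambda>n. hnorm H (f n - l)) \<longlongrightarrow> 0) F"
  shows "((\<lambda>n. hinner H (f n) y) \<longlongrightarrow> hinner H l y) F"
proof -
  have "((\<lambda>n. hinner H (f n) y - hinner H l y) \<longlongrightarrow> 0) F"
  proof (rule Lim_null_comparison)
    show "\<forall>\<^sub>F n in F. norm (hinner H (f n) y - hinner H l y) \<le> hnorm H (f n - l) * hnorm H y"
      using Cauchy_Schwarz[OF diff_mem[OF f l] y] f l y
      by (simp add: inner_diff_left)
    show "((\<lambda>n. hnorm H (f n - l) * hnorm H y) \<longlongrightarrow> 0) F"
      using tendsto_mult_right[OF lim, of "hnorm H y"] by simp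
  qed
  then show ?thesis
    by (rule LIM_zero_cancel)
qed

lemma tendsto_inner_right:
  assumes f: "\<And>n. f n \<in> hcarrier H" and l: "l \<in> hcarrier H" and y: "y \<in> hcarrier H"
    and lim: "((\<lambda>n. hnorm H (f n - l)) \<longlongrightarrow> 0) F"
  shows "((\<lambda>n. hinner H y (f n)) \<longlongrightarrow> hinner H y l) F"
  using tendsto_cnj[OF tendsto_inner_left[OF assms]]
  by (simp flip: inner_commute[OF f y] inner_commute[OF l y])

end

locale hspace =
  fixes H :: "'a::complex_vector hilbert"
  assumes hilbert: "hilbert_space H"

sublocale hspace \<subseteq> inner_space H
proof
  note h1 = hilbert[unfolded hilbert_space_def]
  note h2 = h1[THEN conjunct2]
  note h3 = h2[THEN conjunct2]
  note h4 = h3[THEN conjunct2]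
  note h5 = h4[THEN conjunct2]
  note h6 = h5[THEN conjunct2]
  show "csubspace (hcarrier H)"
    by (rule h1[THEN conjunct1])
  show "hinner H (x + y) z = hinner H x z + hinner H y z"
    if "x \<in> hcarrier H" "y \<in> hcarrier H" "z \<in> hcarrier H" for x y z
    using that by (rule h2[THEN conjunct1, rule_format])
  show "hinner H (c *\<^sub>C x) y = c * hinner H x y" if "x \<in> hcarrier H" "y \<in> hcarrier H" for c x y
    using that by (rule h3[THEN conjunct1, rule_format])
  show "hinner H y x = cnj (hinner H x y)" if "x \<in> hcarrier H" "y \<in> hcarrier H" for x y
    using that by (rule h4[THEN conjunct1, rule_format])
  show "hinner H x x \<in> \<real>\<^sub>\<ge>\<^sub>0" if "x \<in> hcarrier H" for x
    using that by (rule h5[THEN conjunct1, rule_format])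
  show "x = 0" if "x \<in> hcarrier H" "hinner H x x = 0" for x
    using that by (rule h6[THEN conjunct1, rule_format])
qed

section \<open>Completeness and the representation of bounded functionals\<close>

context hspace
begin

lemma complete: "metric.mcomplete"
  using hilbert by (simp only: hilbert_space_def)

lemma convergent_if_Cauchy:
  assumes f: "\<And>n. f n \<in> hcarrier H"
    and Cauchy: "\<And>e. e > 0 \<Longrightarrow> \<exists>N. \<forall>m\<ge>N. \<forall>n\<ge>N. hnorm H (f m - f n) < e"
  shows "\<exists>l\<in>hcarrier H. (\<lambda>n::nat. hnorm H (f n - l)) \<longlonglongrightarrow> 0"
proof -
  have "metric.MCauchy f"
    using f Cauchy by (fastforce simp: metric.MCauchy_def hdist_def)
  then obtain l where l: "limitin (htopology H) f l sequentially"
    using complete by (auto simp: metric.mcomplete_def)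
  then have "l \<in> hcarrier H" "\<And>e. e > 0 \<Longrightarrow> \<exists>N. \<forall>n\<ge>N. hdist H (f n) l < e"
    by (auto simp: metric.limit_metric_sequentially) blast
  then show ?thesis
    using f by (intro bexI[of _ l]) (simp_all add: LIMSEQ_iff hdist_def)
qed

text \<open>The representing vector is the minimiser of \<open>\<parallel>x\<parallel>\<^sup>2 - 2 Re (\<phi> x)\<close>.\<close>

theorem Riesz_representation:
  fixes \<phi> :: "'a \<Rightarrow> complex"
  assumes add: "\<And>x y. x \<in> hcarrier H \<Longrightarrow> y \<in> hcarrier H \<Longrightarrow> \<phi> (x + y) = \<phi> x + \<phi> y"
    and scale: "\<And>c x. x \<in> hcarrier H \<Longrightarrow> \<phi> (c *\<^sub>C x) = c * \<phi> x"
    and bounded: "\<And>x. x \<in> hcarrier H \<Longrightarrow> cmod (\<phi> x) \<le> B * hnorm H x"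
  shows "\<exists>z\<in>hcarrier H. \<forall>x\<in>hcarrier H. \<phi> x = hinner H x z"
proof -
  define J where "J x = (hnorm H x)\<^sup>2 - 2 * Re (\<phi> x)" for x
  define m where "m = Inf (J ` hcarrier H)"
  \<comment> \<open>Completing the square in |x| after bounding Re (\<phi> x) by B |x|.\<close>
  have J_ge: "- B\<^sup>2 \<le> J x" if "x \<in> hcarrier H" for x
  proof -
    have "Re (\<phi> x) \<le> B * hnorm H x"
      using bounded[OF that] complex_Re_le_cmod order_trans by blast
    moreover have "0 \<le> (hnorm H x - B)\<^sup>2" by simp
    ultimately show ?thesis by (simp add: J_def power2_diff algebra_simps)
  qed
  then have bdd: "bdd_below (J ` hcarrier H)"
    by (auto simp: bdd_below_def)
  then have m_le: "m \<le> J x" if "x \<in> hcarrier H" for x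
    using that by (auto simp: m_def intro: cInf_lower)
  have "\<exists>x\<in>hcarrier H. J x < m + 1 / real (Suc n)" for n
  proof -
    have "m < m + 1 / real (Suc n)" by simp
    moreover have "J ` hcarrier H \<noteq> {}" using zero_mem by blast
    ultimately show ?thesis
      unfolding m_def using cInf_lessD by (smt (verit) imageE)
  qed
  then obtain f where f: "\<And>n. f n \<in> hcarrier H" and Jf: "\<And>n. J (f n) < m + 1 / real (Suc n)"
    by metis
  \<comment> \<open>J is at least m at the midpoint; by the parallelogram law this forces two
    near-minimisers to be close, so a minimising sequence is Cauchy.\<close>
  have parallelogram: "(hnorm H (x - y))\<^sup>2 \<le> 2 * (J x - m) + 2 * (J y - m)"
    if x: "x \<in> hcarrier H" and y: "y \<in> hcarrier H" for x y
  proof -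
    have half: "hnorm H ((1/2) *\<^sub>C (x + y)) = hnorm H (x + y) / 2"
      using x y by (simp add: hnorm_scaleC norm_divide)
    have "m \<le> J ((1/2) *\<^sub>C (x + y))" using x y by (intro m_le) simp
    also have "\<dots> = (hnorm H (x + y))\<^sup>2 / 4 - Re (\<phi> x) - Re (\<phi> y)"
      using x y unfolding J_def half by (simp add: power_divide scale add add_divide_distrib)
    finally show ?thesis
      unfolding J_def hnorm_add_square[OF x y] hnorm_diff_square[OF x y] by argo
  qed
  obtain z where z: "z \<in> hcarrier H" and lim: "(\<lambda>n. hnorm H (f n - z)) \<longlonglongrightarrow> 0"
  proof -
    have "\<exists>N. \<forall>k\<ge>N. \<forall>n\<ge>N. hnorm H (f k - f n) < e" if e: "e > 0" for e
    proof -
      obtain N where N: "1 / real (Suc N) < e\<^sup>2 / 4"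
        using e nat_approx_posE[of "e\<^sup>2 / 4"] by auto
      have "hnorm H (f k - f n) < e" if "k \<ge> N" "n \<ge> N" for k n
      proof -
        have small: "J (f j) - m < e\<^sup>2 / 4" if "j \<ge> N" for j
        proof -
          have "1 / real (Suc j) \<le> 1 / real (Suc N)"
            using that by (intro divide_left_mono) auto
          then show ?thesis using Jf[of j] N by linarith
        qed
        have "(hnorm H (f k - f n))\<^sup>2 < e\<^sup>2"
          using parallelogram[OF f f, of k n] small[OF that(1)] small[OF that(2)] by argo
        then show ?thesis using e by (intro power_less_imp_less_base[of _ 2 e]) auto
      qed
      then show ?thesis by blast
    qed
    with f have "\<exists>l\<in>hcarrier H. (\<lambda>n. hnorm H (f n - l)) \<longlonglongrightarrow> 0"
      by (rule convergent_if_Cauchy)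
    then show ?thesis using that by blast
  qed
  have "J z \<le> m"
  proof -
    have "J (f n) = J z + (hnorm H (f n - z))\<^sup>2 + 2 * Re (hinner H (f n - z) z) - 2 * Re (\<phi> (f n - z))"
      for n
    proof -
      have "\<phi> (f n) = \<phi> z + \<phi> (f n - z)"
        using add[OF z diff_mem[OF f z]] by simp
      then show ?thesis
        using hnorm_add_square[OF diff_mem[OF f z, of n] z] by (simp add: J_def)
    qed
    moreover have "(\<lambda>n. J z + (hnorm H (f n - z))\<^sup>2 + 2 * Re (hinner H (f n - z) z)
        - 2 * Re (\<phi> (f n - z))) \<longlonglongrightarrow> J z + 0\<^sup>2 + 2 * Re 0 - 2 * Re 0"
    proof (intro tendsto_intros lim)
      show "(\<lambda>n. hinner H (f n - z) z) \<longlonglongrightarrow> 0"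
        using tendsto_inner_left[OF f z z lim] f z by (simp add: inner_diff_left LIM_zero)
      show "(\<lambda>n. \<phi> (f n - z)) \<longlonglongrightarrow> 0"
      proof (rule Lim_null_comparison)
        show "\<forall>\<^sub>F n in sequentially. norm (\<phi> (f n - z)) \<le> B * hnorm H (f n - z)"
          using bounded[OF diff_mem[OF f z]] by simp
        show "(\<lambda>n. B * hnorm H (f n - z)) \<longlonglongrightarrow> 0"
          using tendsto_mult_left[OF lim, of B] by simp
      qed
    qed
    ultimately have "(\<lambda>n. J (f n)) \<longlonglongrightarrow> J z" by simp
    moreover have "(\<lambda>n. m + 1 / real (Suc n)) \<longlonglongrightarrow> m + 0"
      by (intro tendsto_add tendsto_const LIMSEQ_Suc[OF lim_1_over_n])
    ultimately show ?thesis
      using Jf by (intro LIMSEQ_le[of "\<lambda>n. J (f n)" _ "\<lambda>n. m + 1 / real (Suc n)"])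
        (auto intro: less_imp_le)
  qed
  have "\<phi> x = hinner H x z" if x: "x \<in> hcarrier H" for x
  proof -
    \<comment> \<open>First variation at the minimiser: a quadratic in c that is nonnegative with
      constant term 0 has linear coefficient 0.\<close>
    have "(cmod (hinner H x z - \<phi> x))\<^sup>2 \<le> 0 * (hnorm H x)\<^sup>2"
    proof (rule complex_quadratic_nonneg)
      fix c
      have "J z \<le> J (c *\<^sub>C x + z)"
        using \<open>J z \<le> m\<close> m_le[of "c *\<^sub>C x + z"] x z by simp
      also have "\<dots> = J z + 2 * Re (c * (hinner H x z - \<phi> x)) + (cmod c)\<^sup>2 * (hnorm H x)\<^sup>2"
        using x z hnorm_add_square[of "c *\<^sub>C x" z]
        by (simp add: J_def hnorm_scaleC inner_scaleC_left add scale power_mult_distrib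
            right_diff_distrib)
      finally show "0 \<le> 0 + 2 * Re (c * (hinner H x z - \<phi> x)) + (cmod c)\<^sup>2 * (hnorm H x)\<^sup>2"
        by simp
    qed simp
    then show ?thesis by simp
  qed
  then show ?thesis using z by blast
qed

end

section \<open>Linear operators between carriers and their adjoints\<close>

lemma linear_op_diff:
  assumes "linear_op H K A" "hilbert_space H" "x \<in> hcarrier H" "y \<in> hcarrier H"
  shows "A (x - y) = A x - A y"
proof -
  interpret hspace H by unfold_locales fact
  have "A ((x - y) + y) = A (x - y) + A y"
    using assms diff_mem unfolding linear_op_def by blast
  then show ?thesis by simp
qed

lemma linear_op_sum:
  assumes "linear_op H K A" "hilbert_space H" "\<And>i. i \<in> I \<Longrightarrow> f i \<in> hcarrier H"
  shows "A (sum f I) = (\<Sum>i\<in>I. A (f i))"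
proof -
  interpret hspace H by unfold_locales fact
  have "A 0 = 0"
    using linear_op_diff[OF assms(1,2), of 0 0] by simp
  moreover have "A (x + y) = A x + A y" if "x \<in> hcarrier H" "y \<in> hcarrier H" for x y
    using assms(1) that by (simp add: linear_op_def)
  ultimately show ?thesis
    using assms(3) by (induction I rule: infinite_finite_induct) simp_all
qed

text \<open>Two vectors representing the same functional have a difference orthogonal to itself, so
  the definite description in \<open>adjoint_op\<close> has a unique witness.\<close>

lemma adjoint_op_eqI:
  assumes H: "hilbert_space H" and "z \<in> hcarrier H"
    and "\<And>x. x \<in> hcarrier H \<Longrightarrow> hinner K (A x) y = hinner H x z"
  shows "adjoint_op H K A y = z"
proof -
  interpret hspace H by unfold_locales fact
  have "w = z" if "w \<in> hcarrier H" "\<forall>x\<in>hcarrier H. hinner K (A x) y = hinner H x w" for w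
  proof -
    have "hinner H (w - z) (w - z) = 0"
      using that assms by (simp add: inner_diff_right)
    then have "hnorm H (w - z) = 0" by (simp add: hnorm_def)
    then show ?thesis using hnorm_eq_0[of "w - z"] that(1) assms(2) by simp
  qed
  then show ?thesis
    unfolding adjoint_op_def using assms by (intro the_equality) auto
qed

lemma
  assumes H: "hilbert_space H" and K: "hilbert_space K" and A: "bounded_op H K A"
    and y: "y \<in> hcarrier K"
  shows adjoint_op_mem: "adjoint_op H K A y \<in> hcarrier H"
    and inner_adjoint_op: "x \<in> hcarrier H \<Longrightarrow> hinner K (A x) y = hinner H x (adjoint_op H K A y)"
proof -
  interpret H: hspace H by unfold_locales fact
  interpret K: hspace K by unfold_locales fact
  obtain C where C: "\<And>x. x \<in> hcarrier H \<Longrightarrow> hnorm K (A x) \<le> C * hnorm H x"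
    using A by (auto simp: bounded_op_def)
  have mem: "A x \<in> hcarrier K" if "x \<in> hcarrier H" for x
    using A that by (auto simp: bounded_op_def linear_op_def)
  have "\<exists>z\<in>hcarrier H. \<forall>x\<in>hcarrier H. hinner K (A x) y = hinner H x z"
  proof (rule H.Riesz_representation)
    show "cmod (hinner K (A x) y) \<le> (C * hnorm K y) * hnorm H x" if x: "x \<in> hcarrier H" for x
    proof -
      have "cmod (hinner K (A x) y) \<le> hnorm K (A x) * hnorm K y"
        using mem[OF x] y by (rule K.Cauchy_Schwarz)
      also have "\<dots> \<le> (C * hnorm H x) * hnorm K y"
        using C[OF x] y by (intro mult_right_mono) simp_all
      finally show ?thesis by (simp add: mult_ac)
    qed
  qed (use A y mem in \<open>auto simp: bounded_op_def linear_op_def K.inner_add_left K.inner_scaleC_left\<close>)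
  then obtain z where z: "z \<in> hcarrier H" "\<forall>x\<in>hcarrier H. hinner K (A x) y = hinner H x z"
    by blast
  then have "adjoint_op H K A y = z"
    using H by (intro adjoint_op_eqI) auto
  with z show "adjoint_op H K A y \<in> hcarrier H"
    and "x \<in> hcarrier H \<Longrightarrow> hinner K (A x) y = hinner H x (adjoint_op H K A y)"
    by auto
qed

section \<open>The index semigroup and its group of differences\<close>

locale index_cone =
  fixes \<Omega> :: "'i set" and \<S> :: "'i \<Rightarrow> real set" and S :: "('i \<Rightarrow> real) set"
  assumes commensurable: "\<And>i. i \<in> \<Omega> \<Longrightarrow> commensurable_subsemigroup (\<S> i)"
    and S_eq: "S = index_semigroup \<Omega> \<S>"
begin

abbreviation "G \<equiv> difference_group S"

lemma cone_zero [simp]: "0 \<in> S"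
  using commensurable by (simp add: S_eq index_semigroup_def commensurable_subsemigroup_def)

lemma cone_add [simp]:
  assumes s: "s \<in> S" and t: "t \<in> S"
  shows "s + t \<in> S"
proof -
  have "finite ({j. s j \<noteq> 0} \<union> {j. t j \<noteq> 0})"
    using s t by (simp add: S_eq index_semigroup_def)
  then have "finite {j. (s + t) j \<noteq> 0}"
    by (rule rev_finite_subset) auto
  then show ?thesis
    using s t commensurable by (auto simp: S_eq index_semigroup_def commensurable_subsemigroup_def)
qed

lemma cone_sum: "(\<And>i. i \<in> I \<Longrightarrow> f i \<in> S) \<Longrightarrow> sum f I \<in> S"
  by (induction I rule: infinite_finite_induct) simp_all

lemma cone_nonneg:
  assumes "s \<in> S"
  shows "0 \<le> s j"
proof (cases "j \<in> \<Omega>")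
  case True
  then have "s j \<in> \<S> j" "\<S> j \<subseteq> {0..}"
    using assms commensurable by (auto simp: S_eq index_semigroup_def commensurable_subsemigroup_def)
  then show ?thesis by auto
qed (use assms in \<open>auto simp: S_eq index_semigroup_def\<close>)

lemma cone_pos_part_diff: "s \<in> S \<Longrightarrow> t \<in> S \<Longrightarrow> pos_part (s - t) \<in> S"
  using pos_part_diff_in_index_semigroup[OF commensurable] by (simp add: S_eq)

lemma cone_diff:
  assumes "s \<in> S" "t \<in> S" "t \<le> s"
  shows "s - t \<in> S"
proof -
  have "pos_part (s - t) = s - t"
    using assms(3) by (auto simp: pos_part_def le_fun_def fun_eq_iff)
  then show ?thesis
    using cone_pos_part_diff[OF assms(1,2)] by simp
qed

lemma cone_restrict_index [simp]:
  assumes "s \<in> S"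
  shows "restrict_index s u \<in> S"
proof -
  have "finite {j. restrict_index s u j \<noteq> 0}"
    by (rule finite_subset[of _ "{j. s j \<noteq> 0}"])
      (use assms in \<open>auto simp: S_eq index_semigroup_def restrict_index_def\<close>)
  then show ?thesis
    using assms commensurable
    by (auto simp: S_eq index_semigroup_def restrict_index_def commensurable_subsemigroup_def)
qed

lemma diff_in_group [simp]: "s \<in> S \<Longrightarrow> t \<in> S \<Longrightarrow> s - t \<in> G"
  by (auto simp: difference_group_def)

lemma cone_in_group [simp]: "s \<in> S \<Longrightarrow> s \<in> G"
  using diff_in_group[of s 0] by simp

lemma group_pos_part [simp]: "g \<in> G \<Longrightarrow> pos_part g \<in> S"
  and group_neg_part [simp]: "g \<in> G \<Longrightarrow> neg_part g \<in> S"
  by (auto simp: difference_group_def neg_part_diff cone_pos_part_diff)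

lemma pos_part_minus_neg_part: "pos_part g - neg_part g = g"
  by (simp add: neg_part_def)

lemma group_diff [simp]:
  assumes "g \<in> G" "g' \<in> G"
  shows "g - g' \<in> G"
proof -
  obtain s t s' t' where g: "g = s - t" "g' = s' - t'" and "s \<in> S" "t \<in> S" "s' \<in> S" "t' \<in> S"
    using assms by (auto simp: difference_group_def)
  then have "(s + t') - (t + s') \<in> G"
    by (intro diff_in_group cone_add)
  moreover have "g - g' = (s + t') - (t + s')"
    by (simp add: g)
  ultimately show ?thesis by (simp only:)
qed

lemma group_uminus [simp]: "g \<in> G \<Longrightarrow> - g \<in> G"
  using group_diff[of 0 g] by simp

lemma group_add [simp]: "g \<in> G \<Longrightarrow> g' \<in> G \<Longrightarrow> g + g' \<in> G"
  using group_diff[of g "- g'"] by simp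

lemma group_diff_iff: "s \<in> G \<Longrightarrow> g - s \<in> G \<longleftrightarrow> g \<in> G"
  by (metis group_add group_diff diff_add_cancel)

end

lemma pos_part_zero [simp]: "pos_part 0 = 0" and neg_part_zero [simp]: "neg_part 0 = 0"
  by (auto simp: pos_part_def neg_part_def fun_eq_iff)

lemma pos_part_uminus: "pos_part (- g) = neg_part g" and neg_part_uminus: "neg_part (- g) = pos_part g"
  by (auto simp: pos_part_def neg_part_def fun_eq_iff)

section \<open>Telescoping over a finite grid\<close>

text \<open>Meaningful only if some element of A lies below a. It is evaluated at positive points of
  sets that contain 0; the point 0 is always treated separately.\<close>

definition predecessor :: "real set \<Rightarrow> real \<Rightarrow> real" where
  "predecessor A a = Max {b \<in> A. b < a}"

lemma predecessor_mem:
  assumes "finite A" "0 \<in> A" "0 < a"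
  shows "predecessor A a \<in> A" "predecessor A a < a"
proof -
  have "predecessor A a \<in> {b \<in> A. b < a}"
    unfolding predecessor_def using assms by (intro Max_in) auto
  then show "predecessor A a \<in> A" "predecessor A a < a" by auto
qed

text \<open>The elements up to q are those up to its predecessor r, and q itself, whose term cancels
  the value f r reached so far. Nothing is subtracted at 0, which amounts to f = 0 below the grid;
  hence the total is f q and not f q - f 0.\<close>

lemma sum_predecessor_telescope:
  fixes f :: "real \<Rightarrow> 'b::ab_group_add"
  assumes A: "finite A" "0 \<in> A" "A \<subseteq> {0..}" and "q \<in> A"
  shows "(\<Sum>a\<in>{a\<in>A. a \<le> q}. f a - (if a \<noteq> 0 then f (predecessor A a) else 0)) = f q"
  using \<open>q \<in> A\<close>
proof (induction "card {a\<in>A. a < q}" arbitrary: q rule: less_induct)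
  case less
  show ?case
  proof (cases "q = 0")
    case True
    then have "{a\<in>A. a \<le> q} = {0}" using A by force
    with True show ?thesis by simp
  next
    case False
    define r where "r = predecessor A q"
    have "0 < q" using False less.prems A by force
    then have r: "r \<in> A" "r < q"
      using predecessor_mem A r_def by auto
    have r_max: "a \<le> r" if "a \<in> A" "a < q" for a
      unfolding r_def predecessor_def using A that by (intro Max_ge) auto
    have eq: "{a\<in>A. a \<le> q} = insert q {a\<in>A. a \<le> r}"
      using r r_max less.prems by force
    have "{a\<in>A. a < r} \<subset> {a\<in>A. a < q}"
      using r by force
    then have "card {a\<in>A. a < r} < card {a\<in>A. a < q}"
      using A by (intro psubset_card_mono) auto
    then have "(\<Sum>a\<in>{a\<in>A. a \<le> r}. f a - (if a \<noteq> 0 then f (predecessor A a) else 0)) = f r"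
      using less.hyps r by blast
    then show ?thesis
      unfolding eq using A r False by (simp add: r_def)
  qed
qed

text \<open>Coordinates outside v are pinned to q, so an induction over v can freeze one coordinate
  at a time by updating q.\<close>

definition grid_below :: "('i \<Rightarrow> real set) \<Rightarrow> 'i set \<Rightarrow> ('i \<Rightarrow> real) \<Rightarrow> ('i \<Rightarrow> real) set" where
  "grid_below A v q = {p. (\<forall>j\<in>v. p j \<in> A j \<and> p j \<le> q j) \<and> (\<forall>j. j \<notin> v \<longrightarrow> p j = q j)}"

text \<open>For u inside the support of p the difference p - \<open>lower A p u\<close> is the
  restriction to u of one fixed step vector; this is how s[u] enters.\<close>

definition lower :: "('i \<Rightarrow> real set) \<Rightarrow> ('i \<Rightarrow> real) \<Rightarrow> 'i set \<Rightarrow> 'i \<Rightarrow> real" where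
  "lower A p u = (\<lambda>j. if j \<in> u then predecessor (A j) (p j) else p j)"

lemma grid_below_insert:
  assumes "i \<notin> v"
  shows "grid_below A (insert i v) q = (\<Union>a\<in>{a\<in>A i. a \<le> q i}. grid_below A v (q(i := a)))"
proof (intro set_eqI iffI)
  fix p assume "p \<in> grid_below A (insert i v) q"
  then have "p i \<in> {a\<in>A i. a \<le> q i}" "p \<in> grid_below A v (q(i := p i))"
    using assms by (auto simp: grid_below_def)
  then show "p \<in> (\<Union>a\<in>{a\<in>A i. a \<le> q i}. grid_below A v (q(i := a)))" by blast
next
  fix p assume "p \<in> (\<Union>a\<in>{a\<in>A i. a \<le> q i}. grid_below A v (q(i := a)))"
  then obtain a where "a \<in> A i" "a \<le> q i" "p \<in> grid_below A v (q(i := a))" by blast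
  then show "p \<in> grid_below A (insert i v) q"
    using assms by (auto simp: grid_below_def split: if_splits)
qed

lemma finite_grid_below:
  assumes "finite v" "\<And>j. j \<in> v \<Longrightarrow> finite (A j)"
  shows "finite (grid_below A v q)"
  using assms
proof (induction v arbitrary: q rule: finite_induct)
  case empty
  have "grid_below A {} q = {q}" by (auto simp: grid_below_def fun_eq_iff)
  then show ?case by simp
next
  case (insert i v)
  then show ?case by (simp add: grid_below_insert)
qed

lemma sum_Pow_insert:
  fixes f :: "'a set \<Rightarrow> 'b::comm_monoid_add"
  assumes "finite W" "i \<notin> W"
  shows "(\<Sum>u\<in>Pow (insert i W). f u) = (\<Sum>u\<in>Pow W. f u + f (insert i u))"
proof -
  have "inj_on (insert i) (Pow W)"
    using assms(2) by (auto simp: inj_on_def)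
  moreover have "Pow W \<inter> insert i ` Pow W = {}"
    using assms(2) by auto
  ultimately show ?thesis
    using assms(1) by (simp add: Pow_insert sum.union_disjoint sum.reindex sum.distrib)
qed

text \<open>Backward differences in distinct coordinates commute, and the inner sum is their product
  applied to F at p, expanded by inclusion-exclusion. Restricting u to the coordinates where p is
  nonzero encodes the convention F = 0 below the grid. The function F is kept arbitrary so that the
  difference in one coordinate can be absorbed into it.\<close>

lemma sum_grid_telescope:
  fixes F :: "('i \<Rightarrow> real) \<Rightarrow> 'b::comm_ring_1"
  assumes "finite v" "\<And>j. j \<in> v \<Longrightarrow> finite (A j) \<and> 0 \<in> A j \<and> A j \<subseteq> {0..} \<and> q j \<in> A j"
  shows "(\<Sum>p\<in>grid_below A v q. \<Sum>u\<in>Pow {j\<in>v. p j \<noteq> 0}. (- 1) ^ card u * F (lower A p u)) = F q"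
  using assms
proof (induction v arbitrary: q F rule: finite_induct)
  case empty
  have "grid_below A {} q = {q}" by (auto simp: grid_below_def fun_eq_iff)
  then show ?case by (simp add: lower_def)
next
  case (insert i v)
  \<comment> \<open>The difference in coordinate i alone; the induction hypothesis is applied to
    this function on the remaining coordinates.\<close>
  define F' where "F' a r = F r - (if a \<noteq> 0 then F (r(i := predecessor (A i) a)) else 0)" for a r
  let ?t = "\<lambda>F w p. \<Sum>u\<in>Pow {j\<in>w. p j \<noteq> 0}. (- 1) ^ card u * F (lower A p u)"
  have step: "?t F (insert i v) p = ?t (F' a) v p" if p: "p \<in> grid_below A v (q(i := a))" for p a
  proof -
    have pi: "p i = a"
      using p insert.hyps by (auto simp: grid_below_def)
    let ?W = "{j\<in>v. p j \<noteq> 0}"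
    have fin: "finite ?W" and i: "i \<notin> ?W" using insert.hyps by auto
    show ?thesis
    proof (cases "a = 0")
      case True
      then have "{j\<in>insert i v. p j \<noteq> 0} = ?W" using pi by auto
      then show ?thesis using True by (simp add: F'_def)
    next
      case False
      then have "{j\<in>insert i v. p j \<noteq> 0} = insert i ?W" using pi by auto
      then have "?t F (insert i v) p =
          (\<Sum>u\<in>Pow ?W. (- 1) ^ card u * F (lower A p u) + (- 1) ^ card (insert i u) * F (lower A p (insert i u)))"
        using sum_Pow_insert[OF fin i] by simp
      also have "\<dots> = ?t (F' a) v p"
      proof (rule sum.cong[OF refl])
        fix u assume u: "u \<in> Pow ?W"
        then have "finite u" "i \<notin> u" using fin i finite_subset by auto
        moreover from this have "lower A p (insert i u) = (lower A p u)(i := predecessor (A i) a)"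
          using pi by (auto simp: lower_def)
        ultimately show "(- 1) ^ card u * F (lower A p u) + (- 1) ^ card (insert i u) * F (lower A p (insert i u))
            = (- 1) ^ card u * F' a (lower A p u)"
          using False by (simp add: F'_def right_diff_distrib)
      qed
      finally show ?thesis .
    qed
  qed
  have "(\<Sum>p\<in>grid_below A (insert i v) q. ?t F (insert i v) p) =
      (\<Sum>a\<in>{a\<in>A i. a \<le> q i}. \<Sum>p\<in>grid_below A v (q(i := a)). ?t F (insert i v) p)"
    unfolding grid_below_insert[OF insert.hyps(2)]
  proof (rule sum.UNION_disjoint)
    show "\<forall>a\<in>{a\<in>A i. a \<le> q i}. \<forall>b\<in>{a\<in>A i. a \<le> q i}. a \<noteq> b \<longrightarrow>
        grid_below A v (q(i := a)) \<inter> grid_below A v (q(i := b)) = {}"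
      using insert.hyps(2) by (auto simp: grid_below_def)
  qed (use insert in \<open>auto intro: finite_grid_below\<close>)
  also have "\<dots> = (\<Sum>a\<in>{a\<in>A i. a \<le> q i}. F' a (q(i := a)))"
  proof (rule sum.cong[OF refl])
    fix a assume "a \<in> {a\<in>A i. a \<le> q i}"
    have "(\<Sum>p\<in>grid_below A v (q(i := a)). ?t F (insert i v) p) =
        (\<Sum>p\<in>grid_below A v (q(i := a)). ?t (F' a) v p)"
      by (rule sum.cong[OF refl]) (rule step)
    also have "\<dots> = F' a (q(i := a))"
      using insert by (intro insert.IH) auto
    finally show "(\<Sum>p\<in>grid_below A v (q(i := a)). ?t F (insert i v) p) = F' a (q(i := a))" .
  qed
  also have "\<dots> = (\<Sum>a\<in>{a\<in>A i. a \<le> q i}. F (q(i := a))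
      - (if a \<noteq> 0 then F (q(i := predecessor (A i) a)) else 0))"
    by (simp only: F'_def fun_upd_upd)
  also have "\<dots> = F (q(i := q i))"
    using insert.prems[of i] by (intro sum_predecessor_telescope[where f = "\<lambda>a. F (q(i := a))"]) auto
  finally show ?case by simp
qed

section \<open>Brehmer positivity and positive definiteness\<close>

lemma sum_in_nonneg_Reals: "(\<And>i. i \<in> I \<Longrightarrow> f i \<in> \<real>\<^sub>\<ge>\<^sub>0) \<Longrightarrow> sum f I \<in> \<real>\<^sub>\<ge>\<^sub>0"
  by (induction I rule: infinite_finite_induct) simp_all

locale contraction_family = index_cone \<Omega> \<S> S + H: hspace H
  for \<Omega> :: "'i set" and \<S> S and H :: "'h::complex_vector hilbert" +
  fixes T :: "('i \<Rightarrow> real) \<Rightarrow> 'h \<Rightarrow> 'h"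
  assumes contractions: "contraction_semigroup S H T"
begin

abbreviation ip :: "'h \<Rightarrow> 'h \<Rightarrow> complex" where
  "ip \<equiv> hinner H"

lemma T_bounded: "s \<in> S \<Longrightarrow> bounded_op H H (T s)"
  using contractions by (simp add: contraction_semigroup_def op_semigroup_def)

lemma T_linear: "s \<in> S \<Longrightarrow> linear_op H H (T s)"
  using T_bounded by (simp add: bounded_op_def)

lemma T_mem [simp]: "s \<in> S \<Longrightarrow> x \<in> hcarrier H \<Longrightarrow> T s x \<in> hcarrier H"
  using T_linear[of s] by (auto simp: linear_op_def)

lemma T_norm: "s \<in> S \<Longrightarrow> x \<in> hcarrier H \<Longrightarrow> hnorm H (T s x) \<le> hnorm H x"
  using contractions by (simp add: contraction_semigroup_def contraction_op_def)

lemma T_zero [simp]: "x \<in> hcarrier H \<Longrightarrow> T 0 x = x"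
  using contractions by (simp add: contraction_semigroup_def op_semigroup_def)

lemma T_add: "s \<in> S \<Longrightarrow> t \<in> S \<Longrightarrow> x \<in> hcarrier H \<Longrightarrow> T (s + t) x = T s (T t x)"
  using contractions by (simp add: contraction_semigroup_def op_semigroup_def)

text \<open>The sesquilinear form of \<open>regular_op\<close> with the adjoint moved to the other
  side, which leaves an expression in the semigroup alone.\<close>

definition form :: "('i \<Rightarrow> real) \<Rightarrow> 'h \<Rightarrow> 'h \<Rightarrow> complex" where
  "form g x y = ip (T (pos_part g) x) (T (neg_part g) y)"

lemma regular_op_mem [simp]: "g \<in> G \<Longrightarrow> x \<in> hcarrier H \<Longrightarrow> regular_op H T g x \<in> hcarrier H"
  by (simp add: regular_op_def adjoint_op_mem H.hilbert T_bounded)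

lemma inner_regular_op:
  assumes "g \<in> G" "x \<in> hcarrier H" "y \<in> hcarrier H"
  shows "ip (regular_op H T g x) y = form g x y"
proof -
  let ?z = "adjoint_op H H (T (neg_part g)) (T (pos_part g) x)"
  have "ip (T (neg_part g) y) (T (pos_part g) x) = ip y ?z"
    using assms by (intro inner_adjoint_op H.hilbert T_bounded) simp_all
  then have "cnj (ip (T (neg_part g) y) (T (pos_part g) x)) = cnj (ip y ?z)"
    by simp
  then have "form g x y = ip ?z y"
    using assms H.inner_commute[of "T (neg_part g) y" "T (pos_part g) x"]
      H.inner_commute[of y ?z] regular_op_mem[of g x]
    by (simp add: form_def regular_op_def)
  then show ?thesis
    by (simp add: regular_op_def)
qed

lemma form_commute:
  "g \<in> G \<Longrightarrow> x \<in> hcarrier H \<Longrightarrow> y \<in> hcarrier H \<Longrightarrow> form (- g) y x = cnj (form g x y)"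
  by (simp add: form_def pos_part_uminus neg_part_uminus H.inner_commute[of "T (pos_part g) x"])

text \<open>Moving each adjoint across the inner product turns the term for u into a signed squared
  norm.\<close>

lemma regular_positivity_iff:
  "regular_positivity \<Omega> S H T \<longleftrightarrow>
   (\<forall>v s x. finite v \<and> v \<subseteq> \<Omega> \<and> s \<in> S \<and> x \<in> hcarrier H \<longrightarrow>
      (\<Sum>u\<in>Pow v. (- 1) ^ card u * ip (T (restrict_index s u) x) (T (restrict_index s u) x)) \<in> \<real>\<^sub>\<ge>\<^sub>0)"
proof -
  have eq: "ip (\<Sum>u\<in>Pow v. (- 1) ^ card u *\<^sub>C
             adjoint_op H H (T (restrict_index s u)) (T (restrict_index s u) x)) x =
      (\<Sum>u\<in>Pow v. (- 1) ^ card u * ip (T (restrict_index s u) x) (T (restrict_index s u) x))"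
    if s: "s \<in> S" and x: "x \<in> hcarrier H" for v s x
  proof -
    let ?A = "\<lambda>u. adjoint_op H H (T (restrict_index s u)) (T (restrict_index s u) x)"
    have mem: "?A u \<in> hcarrier H" for u
      using s x by (intro adjoint_op_mem H.hilbert T_bounded) simp_all
    have "ip (?A u) x = ip (T (restrict_index s u) x) (T (restrict_index s u) x)" for u
    proof -
      have "ip (T (restrict_index s u) x) (T (restrict_index s u) x) = ip x (?A u)"
        using s x by (intro inner_adjoint_op H.hilbert T_bounded) simp_all
      moreover have "cnj (ip (T (restrict_index s u) x) (T (restrict_index s u) x))
          = ip (T (restrict_index s u) x) (T (restrict_index s u) x)"
        using s x by (intro H.inner_commute[symmetric]) simp_all
      ultimately show ?thesis
        using H.inner_commute[OF x mem] by simp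
    qed
    then show ?thesis
      using x mem by (simp add: H.inner_sum_left H.inner_scaleC_left)
  qed
  show ?thesis
    unfolding regular_positivity_def positive_op_def
    by (intro iffI allI impI ballI; (elim conjE)?) (simp only: eq[symmetric], simp only: eq)
qed

text \<open>With \<open>a p = \<Sum>{T (n i - p) (x i) | p \<le> n i}\<close> for each grid point \<open>p\<close>, telescoping over the grid
  writes the form as the sum over \<open>p\<close> of the Brehmer sums of the steps from \<open>p\<close> to its
  predecessors, evaluated at \<open>a p\<close>.\<close>

lemma form_positive_cone:
  assumes pos: "regular_positivity \<Omega> S H T"
    and I: "finite I" and n: "\<And>i. i \<in> I \<Longrightarrow> n i \<in> S" and x: "\<And>i. i \<in> I \<Longrightarrow> x i \<in> hcarrier H"
  shows "(\<Sum>i\<in>I. \<Sum>k\<in>I. form (n i - n k) (x i) (x k)) \<in> \<real>\<^sub>\<ge>\<^sub>0"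
proof -
  define v where "v = (\<Union>i\<in>I. {j. n i j \<noteq> 0})"
  \<comment> \<open>The values of the given indices in coordinate j, with 0 added so that every
    positive value has a predecessor. Off v only 0 remains.\<close>
  define A where "A j = insert 0 ((\<lambda>i. n i j) ` I)" for j
  define P where "P = grid_below A v (\<lambda>j. Max (A j))"
  define supp where "supp p = {j\<in>v. p j \<noteq> 0}" for p :: "'i \<Rightarrow> real"
  \<comment> \<open>One step down in every nonzero coordinate. Its restriction to u leads from
    \<open>lower A p u\<close> up to p, so it is the element s of the Brehmer sum over the support
    of p.\<close>
  define st where "st p = p - lower A p (supp p)" for p
  define a where "a p = (\<Sum>i\<in>{i\<in>I. p \<le> n i}. T (n i - p) (x i))" for p
  have fin_v: "finite v"
    using I n by (auto simp: v_def S_eq index_semigroup_def)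
  have v_sub: "v \<subseteq> \<Omega>"
    using n by (auto simp: v_def S_eq index_semigroup_def)
  have A: "finite (A j)" "0 \<in> A j" "A j \<subseteq> {0..}" "i \<in> I \<Longrightarrow> n i j \<in> A j" for i j
    using I cone_nonneg[OF n] by (auto simp: A_def)
  have A_off: "A j = {0}" if "j \<notin> v" for j
    using that by (auto simp: A_def v_def)
  have A_S: "A j \<subseteq> \<S> j" if "j \<in> \<Omega>" for j
    using n that commensurable by (auto simp: A_def S_eq index_semigroup_def commensurable_subsemigroup_def)
  have P_iff: "p \<in> P \<longleftrightarrow> (\<forall>j. p j \<in> A j)" for p
  proof
    assume "p \<in> P"
    then show "\<forall>j. p j \<in> A j"
      using A_off unfolding P_def grid_below_def by (metis (mono_tags, lifting) Max_singleton
          mem_Collect_eq singletonI)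
  next
    assume p: "\<forall>j. p j \<in> A j"
    have "p j = Max (A j)" if "j \<notin> v" for j
      using p[rule_format, of j] A_off[OF that] by simp
    then show "p \<in> P"
      using p A(1) by (simp add: P_def grid_below_def)
  qed
  have P_S: "p \<in> S" if "\<And>j. p j \<in> A j" for p
  proof -
    have zero: "p j = 0" if "j \<notin> v" for j
      using \<open>\<And>j. p j \<in> A j\<close>[of j] A_off[OF that] by simp
    then have "finite {j. p j \<noteq> 0}"
      using fin_v by (elim rev_finite_subset) auto
    moreover have "p j = 0" if "j \<notin> \<Omega>" for j
      using zero that v_sub by blast
    ultimately show ?thesis
      using A_S that by (auto simp: S_eq index_semigroup_def)
  qed
  have low: "lower A p u \<in> P" "lower A p u \<le> p" if p: "p \<in> P" and u: "u \<subseteq> supp p" for p u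
  proof -
    have "predecessor (A j) (p j) \<in> A j \<and> predecessor (A j) (p j) < p j" if "j \<in> u" for j
    proof -
      have "p j \<in> A j" "p j \<noteq> 0" using p u that by (auto simp: P_iff supp_def)
      then have "0 < p j" using A(3)[of j] by force
      then show ?thesis using A predecessor_mem by blast
    qed
    then show "lower A p u \<in> P" "lower A p u \<le> p"
      using p unfolding P_iff by (auto simp: lower_def le_fun_def intro: less_imp_le)
  qed
  have st_S: "st p \<in> S" if "p \<in> P" for p
    unfolding st_def using low[OF that order_refl] that by (intro cone_diff P_S) (auto simp: P_iff)
  have restrict_st: "restrict_index (st p) u = p - lower A p u" if "u \<subseteq> supp p" for p u
    using that by (auto simp: st_def restrict_index_def lower_def fun_eq_iff)
  have n_diff: "n i - p \<in> S" if "i \<in> I" "p \<in> P" "p \<le> n i" for i p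
    using that n by (intro cone_diff P_S) (auto simp: P_iff A)
  define F where "F i k r = ip (T (n i - r) (x i)) (T (n k - r) (x k))" for i k r
  have a_mem: "a p \<in> hcarrier H" if "p \<in> P" for p
    unfolding a_def using n_diff that x by (intro H.sum_mem) simp
  \<comment> \<open>The sum runs over the indices above p for every u, although further indices may
    lie above the lowered point. Only because this range does not depend on u does the Brehmer sum
    become a mixed difference at p.\<close>
  have T_a: "T (restrict_index (st p) u) (a p) = (\<Sum>i\<in>{i\<in>I. p \<le> n i}. T (n i - lower A p u) (x i))"
    if p: "p \<in> P" and u: "u \<subseteq> supp p" for p u
  proof -
    have "T (restrict_index (st p) u) (a p) =
        (\<Sum>i\<in>{i\<in>I. p \<le> n i}. T (restrict_index (st p) u) (T (n i - p) (x i)))"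
      unfolding a_def using st_S[OF p] n_diff[OF _ p] x
      by (intro linear_op_sum[OF T_linear H.hilbert]) simp_all
    also have "\<dots> = (\<Sum>i\<in>{i\<in>I. p \<le> n i}. T (n i - lower A p u) (x i))"
    proof (rule sum.cong[OF refl])
      fix i assume i: "i \<in> {i\<in>I. p \<le> n i}"
      have "T (restrict_index (st p) u) (T (n i - p) (x i)) = T (restrict_index (st p) u + (n i - p)) (x i)"
        using st_S[OF p] n_diff[OF _ p] x i by (intro T_add[symmetric]) simp_all
      then show "T (restrict_index (st p) u) (T (n i - p) (x i)) = T (n i - lower A p u) (x i)"
        using restrict_st[OF u] by simp
    qed
    finally show ?thesis .
  qed
  define E where "E p = (\<Sum>u\<in>Pow (supp p). (- 1) ^ card u *
      ip (T (restrict_index (st p) u) (a p)) (T (restrict_index (st p) u) (a p)))" for p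
  have E_pos: "E p \<in> \<real>\<^sub>\<ge>\<^sub>0" if "p \<in> P" for p
  proof -
    have "finite (supp p)" "supp p \<subseteq> \<Omega>"
      using fin_v v_sub by (auto simp: supp_def)
    then show ?thesis
      using pos st_S[OF that] a_mem[OF that] unfolding regular_positivity_iff E_def by blast
  qed
  \<comment> \<open>Expanding the squares gives each pair of indices above p its own mixed
    difference; summation over p then leaves one telescoping sum per pair.\<close>
  have E_eq: "E p = (\<Sum>i\<in>I. \<Sum>k\<in>I. if p \<le> n i \<and> p \<le> n k
      then \<Sum>u\<in>Pow (supp p). (- 1) ^ card u * F i k (lower A p u) else 0)" if p: "p \<in> P" for p
  proof -
    let ?Ip = "{i\<in>I. p \<le> n i}"
    have mem: "T (n i - lower A p u) (x i) \<in> hcarrier H" if "i \<in> ?Ip" "u \<subseteq> supp p" for i u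
      using that low[OF p that(2)] x n_diff[OF _ low(1)[OF p that(2)], of i]
      by (auto intro: order_trans)
    have "E p = (\<Sum>u\<in>Pow (supp p). (- 1) ^ card u * (\<Sum>i\<in>?Ip. \<Sum>k\<in>?Ip. F i k (lower A p u)))"
      unfolding E_def
    proof (rule sum.cong[OF refl])
      fix u assume "u \<in> Pow (supp p)"
      then have u: "u \<subseteq> supp p" by simp
      show "(- 1) ^ card u * ip (T (restrict_index (st p) u) (a p)) (T (restrict_index (st p) u) (a p)) =
          (- 1) ^ card u * (\<Sum>i\<in>?Ip. \<Sum>k\<in>?Ip. F i k (lower A p u))"
        unfolding T_a[OF p u] F_def
        by (subst H.inner_sum_sum) (use mem[OF _ u] in simp_all)
    qed
    also have "\<dots> = (\<Sum>i\<in>?Ip. \<Sum>k\<in>?Ip. \<Sum>u\<in>Pow (supp p). (- 1) ^ card u * F i k (lower A p u))"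
      by (simp only: sum_distrib_left sum.swap[of _ _ "Pow (supp p)"])
    also have "\<dots> = (\<Sum>i\<in>I. if p \<le> n i then \<Sum>k\<in>I. if p \<le> n k
        then \<Sum>u\<in>Pow (supp p). (- 1) ^ card u * F i k (lower A p u) else 0 else 0)"
      using I by (simp only: sum.inter_filter)
    also have "\<dots> = (\<Sum>i\<in>I. \<Sum>k\<in>I. if p \<le> n i \<and> p \<le> n k
        then \<Sum>u\<in>Pow (supp p). (- 1) ^ card u * F i k (lower A p u) else 0)"
      by (intro sum.cong refl) (simp add: if_distrib[symmetric])
    finally show ?thesis .
  qed
  have finP: "finite P"
    unfolding P_def using fin_v A by (intro finite_grid_below) auto
  have telescope: "(\<Sum>p\<in>P. if p \<le> n i \<and> p \<le> n k
      then \<Sum>u\<in>Pow (supp p). (- 1) ^ card u * F i k (lower A p u) else 0) = form (n i - n k) (x i) (x k)"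
    if i: "i \<in> I" and k: "k \<in> I" for i k
  proof -
    \<comment> \<open>The meet of the two indices: the grid points below both are the grid below q,
      and n i - q and n k - q are the positive and negative parts of n i - n k.\<close>
    define q where "q j = min (n i j) (n k j)" for j
    have q_A: "q j \<in> A j" for j
      using A(4)[OF i] A(4)[OF k] by (simp add: q_def min_def)
    have "{p\<in>P. p \<le> n i \<and> p \<le> n k} = grid_below A v q"
    proof -
      have q0: "q j = 0" if "j \<notin> v" for j
        using q_A[of j] A_off[OF that] by simp
      have "p \<in> P \<and> p \<le> n i \<and> p \<le> n k \<longleftrightarrow> (\<forall>j. p j \<in> A j \<and> p j \<le> q j)" for p
        by (auto simp: P_iff q_def le_fun_def)
      also have "(\<forall>j. p j \<in> A j \<and> p j \<le> q j) \<longleftrightarrow> p \<in> grid_below A v q" for p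
      proof
        assume p: "\<forall>j. p j \<in> A j \<and> p j \<le> q j"
        have "p j = q j" if "j \<notin> v" for j
          using p[rule_format, of j] A_off[OF that] q0[OF that] by simp
        then show "p \<in> grid_below A v q"
          using p by (simp add: grid_below_def)
      next
        assume p: "p \<in> grid_below A v q"
        show "\<forall>j. p j \<in> A j \<and> p j \<le> q j"
        proof
          fix j
          show "p j \<in> A j \<and> p j \<le> q j"
            using p q_A[of j] by (cases "j \<in> v") (simp_all add: grid_below_def)
        qed
      qed
      finally show ?thesis by blast
    qed
    then have "(\<Sum>p\<in>P. if p \<le> n i \<and> p \<le> n k
        then \<Sum>u\<in>Pow (supp p). (- 1) ^ card u * F i k (lower A p u) else 0)
      = (\<Sum>p\<in>grid_below A v q. \<Sum>u\<in>Pow (supp p). (- 1) ^ card u * F i k (lower A p u))"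
      using finP by (simp flip: sum.inter_filter)
    also have "\<dots> = F i k q"
      unfolding supp_def using fin_v A q_A by (intro sum_grid_telescope) auto
    also have "\<dots> = form (n i - n k) (x i) (x k)"
    proof -
      have "n i - q = pos_part (n i - n k)" "n k - q = neg_part (n i - n k)"
        by (auto simp: q_def pos_part_def neg_part_def fun_eq_iff min_def max_def)
      then show ?thesis by (simp add: F_def form_def)
    qed
    finally show ?thesis .
  qed
  have "(\<Sum>p\<in>P. E p) = (\<Sum>i\<in>I. \<Sum>k\<in>I. \<Sum>p\<in>P. if p \<le> n i \<and> p \<le> n k
      then \<Sum>u\<in>Pow (supp p). (- 1) ^ card u * F i k (lower A p u) else 0)"
    by (simp add: E_eq sum.swap[of _ _ P])
  also have "\<dots> = (\<Sum>i\<in>I. \<Sum>k\<in>I. form (n i - n k) (x i) (x k))"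
    using telescope by (intro sum.cong refl) blast
  finally show ?thesis
    using E_pos by (metis (no_types, lifting) sum_in_nonneg_Reals)
qed

lemma form_positive:
  assumes pos: "regular_positivity \<Omega> S H T"
    and I: "finite I" and g: "\<And>i. i \<in> I \<Longrightarrow> g i \<in> G" and x: "\<And>i. i \<in> I \<Longrightarrow> x i \<in> hcarrier H"
  shows "(\<Sum>i\<in>I. \<Sum>k\<in>I. form (g i - g k) (x i) (x k)) \<in> \<real>\<^sub>\<ge>\<^sub>0"
proof -
  \<comment> \<open>Adding \<open>neg_part (g i)\<close> turns \<open>g i\<close> into
    \<open>pos_part (g i)\<close>, and the other summands stay in the cone. The differences g i - g
    k are unaffected.\<close>
  define t where "t = (\<Sum>i\<in>I. neg_part (g i))"
  have "g i + t \<in> S" if i: "i \<in> I" for i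
  proof -
    have "t = neg_part (g i) + (\<Sum>k\<in>I - {i}. neg_part (g k))"
      unfolding t_def using I i by (rule sum.remove)
    then have "g i + t = pos_part (g i) + (\<Sum>k\<in>I - {i}. neg_part (g k))"
      by (simp add: neg_part_def)
    then show ?thesis
      using g i by (auto intro!: cone_add cone_sum)
  qed
  from form_positive_cone[OF pos I this x] show ?thesis by simp
qed

end

section \<open>The group representation of a unitary semigroup\<close>

locale unitary_family = index_cone \<Omega> \<S> S + K: hspace K
  for \<Omega> :: "'i set" and \<S> S and K :: "'k::complex_vector hilbert" +
  fixes U :: "('i \<Rightarrow> real) \<Rightarrow> 'k \<Rightarrow> 'k"
  assumes unitaries: "unitary_semigroup S K U"
begin

lemma U_unitary: "s \<in> S \<Longrightarrow> unitary_op K K (U s)"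
  using unitaries by (simp add: unitary_semigroup_def)

lemma U_linear: "s \<in> S \<Longrightarrow> linear_op K K (U s)"
  using U_unitary by (simp add: unitary_op_def isometric_op_def)

lemma U_mem [simp]: "s \<in> S \<Longrightarrow> x \<in> hcarrier K \<Longrightarrow> U s x \<in> hcarrier K"
  using U_linear[of s] by (auto simp: linear_op_def)

lemma U_inner [simp]:
  "s \<in> S \<Longrightarrow> x \<in> hcarrier K \<Longrightarrow> y \<in> hcarrier K \<Longrightarrow> hinner K (U s x) (U s y) = hinner K x y"
  using U_unitary by (simp add: unitary_op_def isometric_op_def)

lemma U_diff: "s \<in> S \<Longrightarrow> x \<in> hcarrier K \<Longrightarrow> y \<in> hcarrier K \<Longrightarrow> U s (x - y) = U s x - U s y"
  using linear_op_diff[OF U_linear K.hilbert] .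

lemma U_norm [simp]: "s \<in> S \<Longrightarrow> x \<in> hcarrier K \<Longrightarrow> hnorm K (U s x) = hnorm K x"
  by (simp add: hnorm_def)

lemma U_inj:
  assumes "s \<in> S" "x \<in> hcarrier K" "y \<in> hcarrier K" "U s x = U s y"
  shows "x = y"
proof -
  have "hnorm K (x - y) = hnorm K (U s (x - y))"
    using assms by simp
  also have "\<dots> = 0"
    using assms by (simp add: U_diff)
  finally show ?thesis
    using assms K.hnorm_eq_0[of "x - y"] by simp
qed

lemma U_surj: "s \<in> S \<Longrightarrow> y \<in> hcarrier K \<Longrightarrow> \<exists>x\<in>hcarrier K. U s x = y"
  using U_unitary[of s] unfolding unitary_op_def by (metis imageE)

lemma U_zero [simp]: "x \<in> hcarrier K \<Longrightarrow> U 0 x = x"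
  using unitaries by (simp add: unitary_semigroup_def op_semigroup_def)

lemma U_add: "s \<in> S \<Longrightarrow> t \<in> S \<Longrightarrow> x \<in> hcarrier K \<Longrightarrow> U (s + t) x = U s (U t x)"
  using unitaries by (simp add: unitary_semigroup_def op_semigroup_def)

abbreviation R :: "('i \<Rightarrow> real) \<Rightarrow> 'k \<Rightarrow> 'k" where
  "R \<equiv> regular_op K U"

text \<open>The adjoint of a unitary is its inverse. The second equation says so without inverses,
  so that later identities are verified by cancelling a unitary.\<close>

lemma R_parts:
  assumes "g \<in> G" "x \<in> hcarrier K"
  shows "R g x \<in> hcarrier K" "U (neg_part g) (R g x) = U (pos_part g) x"
proof -
  obtain z where z: "z \<in> hcarrier K" "U (neg_part g) z = U (pos_part g) x"
    using assms U_surj[of "neg_part g" "U (pos_part g) x"] by auto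
  have "adjoint_op K K (U (neg_part g)) (U (pos_part g) x) = z"
    using z assms by (intro adjoint_op_eqI K.hilbert) (auto simp flip: z(2))
  then show "R g x \<in> hcarrier K" "U (neg_part g) (R g x) = U (pos_part g) x"
    using z by (simp_all add: regular_op_def)
qed

lemma R_mem [simp]: "g \<in> G \<Longrightarrow> x \<in> hcarrier K \<Longrightarrow> R g x \<in> hcarrier K"
  by (rule R_parts)

text \<open>Any representation g = b - a gives the same operator: b and a differ from the positive
  and negative parts by a common summand, since a + g+ = g- + b, and U(g-) is injective.\<close>

lemma U_R_diff:
  assumes a: "a \<in> S" and b: "b \<in> S" and x: "x \<in> hcarrier K"
  shows "U a (R (b - a) x) = U b x"
proof -
  define g where "g = b - a"
  have g: "g \<in> G" using a b by (simp add: g_def)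
  have "U (neg_part g) (U a (R g x)) = U (a + neg_part g) (R g x)"
    using g a x by (simp add: U_add[symmetric] add.commute)
  also have "\<dots> = U (a + pos_part g) x"
    using g a x by (simp add: U_add R_parts)
  also have "a + pos_part g = neg_part g + b"
    by (simp add: neg_part_def g_def)
  also have "U \<dots> x = U (neg_part g) (U b x)"
    using g b x by (simp add: U_add)
  finally have eq: "U (neg_part g) (U a (R g x)) = U (neg_part g) (U b x)" .
  have "U a (R g x) = U b x"
    by (rule U_inj[OF group_neg_part[OF g] _ _ eq]) (use g a b x in simp_all)
  then show ?thesis by (simp only: g_def)
qed

lemma R_eqI:
  assumes "a \<in> S" "b \<in> S" "x \<in> hcarrier K" "z \<in> hcarrier K" "U a z = U b x"
  shows "R (b - a) x = z"
  using assms by (metis U_R_diff U_inj R_mem diff_in_group)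

lemma R_zero [simp]: "x \<in> hcarrier K \<Longrightarrow> R 0 x = x"
  using R_eqI[of 0 0 x x] by simp

lemma U_R:
  assumes s: "s \<in> S" and g: "g \<in> G" and x: "x \<in> hcarrier K"
  shows "U s (R g x) = R (g + s) x"
proof -
  obtain b a where ab: "b \<in> S" "a \<in> S" "g = b - a"
    using g by (auto simp: difference_group_def)
  have "U a (U s (R g x)) = U s (U a (R g x))"
    using ab s g x by (simp flip: U_add add: add.commute)
  also have "\<dots> = U (b + s) x"
    using ab s x U_R_diff[of a b x] by (simp add: U_add[symmetric] add.commute)
  finally have "R ((b + s) - a) x = U s (R g x)"
    using ab s g x by (intro R_eqI) simp_all
  moreover have "(b + s) - a = g + s"
    using ab by simp
  ultimately show ?thesis by simp
qed

text \<open>R is a unitary representation of the commutative group S - S. Writing both indices as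
  differences, U(a + a') clears the two denominators without changing the inner product.\<close>

lemma R_inner:
  assumes g: "g \<in> G" "g' \<in> G" and x: "x \<in> hcarrier K" "y \<in> hcarrier K"
  shows "hinner K (R g x) (R g' y) = hinner K (R (g - g') x) y"
proof -
  obtain b a b' a' where ab: "b \<in> S" "a \<in> S" "g = b - a" "b' \<in> S" "a' \<in> S" "g' = b' - a'"
    using g by (auto simp: difference_group_def)
  have "hinner K (R g x) (R g' y) = hinner K (U (a + a') (R g x)) (U (a + a') (R g' y))"
    using ab g x by simp
  also have "U (a + a') (R g x) = U a' (U a (R g x))"
    using ab g x by (simp add: U_add[symmetric] add.commute)
  also have "\<dots> = U (b + a') x"
    using ab x U_R_diff[of a b x] by (simp add: U_add[symmetric] add.commute)
  also have "U (a + a') (R g' y) = U a (U a' (R g' y))"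
    using ab g x by (simp add: U_add)
  also have "\<dots> = U (a + b') y"
    using ab x U_R_diff[of a' b' y] by (simp add: U_add)
  also have "U (b + a') x = U (a + b') (R ((b + a') - (a + b')) x)"
    using ab x by (intro U_R_diff[symmetric]) simp_all
  also have "(b + a') - (a + b') = g - g'"
    using ab by simp
  also have "hinner K (U (a + b') (R (g - g') x)) (U (a + b') y) = hinner K (R (g - g') x) y"
    using ab g x by (intro U_inner) (simp_all only: cone_add R_mem group_diff)
  finally show ?thesis .
qed

end

lemma isometric_imp_bounded:
  assumes "isometric_op H K V"
  shows "bounded_op H K V"
proof -
  have "hnorm K (V x) \<le> 1 * hnorm H x" if "x \<in> hcarrier H" for x
    using assms that by (simp add: isometric_op_def hnorm_def)
  then show ?thesis
    using assms unfolding bounded_op_def isometric_op_def by blast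
qed

text \<open>\<open>orth_proj\<close> is a definite description, so a witness V z is supplied; any
  other candidate has the same inner products with the range and lies in it, hence coincides with V
  z.\<close>

lemma orth_proj_range_eqI:
  assumes "hilbert_space K" "isometric_op H K V"
    and x: "x \<in> hcarrier K" and z: "z \<in> hcarrier H"
    and orth: "\<And>h. h \<in> hcarrier H \<Longrightarrow> hinner K x (V h) = hinner K (V z) (V h)"
  shows "orth_proj K (V ` hcarrier H) x = V z"
proof -
  interpret K: hspace K by unfold_locales fact
  have mem: "V h \<in> hcarrier K" if "h \<in> hcarrier H" for h
    using assms(2) that by (auto simp: isometric_op_def linear_op_def)
  have "w = V z" if w: "w \<in> V ` hcarrier H" "\<forall>y\<in>V ` hcarrier H. hinner K (x - w) y = 0" for w
  proof -
    obtain h where h: "h \<in> hcarrier H" "w = V h" using w by blast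
    have eq: "hinner K w y = hinner K (V z) y" if "y \<in> V ` hcarrier H" for y
      using that w(2) x mem h orth by (auto simp: K.inner_diff_left)
    have "hinner K (w - V z) (w - V z) = 0"
      using eq[OF w(1)] eq[of "V z"] z h mem by (simp add: K.inner_diff_left K.inner_diff_right)
    then have "hnorm K (w - V z) = 0" by (simp add: hnorm_def)
    then show ?thesis using K.hnorm_eq_0[of "w - V z"] h z mem by simp
  qed
  moreover have "\<forall>y\<in>V ` hcarrier H. hinner K (x - V z) y = 0"
    using x z mem orth by (auto simp: K.inner_diff_left)
  ultimately show ?thesis
    unfolding orth_proj_def using z by (intro the_equality) auto
qed

text \<open>For a fixed union z the signs of the pairs (u, w) add up to (-1)^|z|: an element of z
  lies in u only, in w only, or in both, contributing -1 - 1 + 1 = -1. This turns the squared norm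
  of an alternating sum into a single alternating sum.\<close>

lemma sum_Pow_union_sign:
  fixes f :: "'a set \<Rightarrow> 'b::comm_ring_1"
  assumes "finite v"
  shows "(\<Sum>u\<in>Pow v. \<Sum>w\<in>Pow v. (- 1) ^ card u * ((- 1) ^ card w * f (u \<union> w))) =
    (\<Sum>u\<in>Pow v. (- 1) ^ card u * f u)"
  using assms
proof (induction v arbitrary: f rule: finite_induct)
  case empty
  then show ?case by simp
next
  case (insert i v)
  have card_insert: "card (insert i u) = Suc (card u)" if "u \<in> Pow v" for u
    using that insert.hyps finite_subset by (auto intro!: card_insert_disjoint)
  \<comment> \<open>Of the four ways to place i, one leaves the union without i, and the other three
    carry total sign -1.\<close>
  let ?f = "\<lambda>u. f u - f (insert i u)"
  have "(\<Sum>u\<in>Pow (insert i v). \<Sum>w\<in>Pow (insert i v). (- 1) ^ card u * ((- 1) ^ card w * f (u \<union> w)))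
      = (\<Sum>u\<in>Pow v. (\<Sum>w\<in>Pow v. (- 1) ^ card u * ((- 1) ^ card w * ?f (u \<union> w))) )"
    unfolding sum_Pow_insert[OF insert.hyps] sum.distrib[symmetric]
    by (intro sum.cong refl) (simp add: card_insert algebra_simps)
  also have "\<dots> = (\<Sum>u\<in>Pow v. (- 1) ^ card u * ?f u)"
    by (rule insert.IH)
  also have "\<dots> = (\<Sum>u\<in>Pow (insert i v). (- 1) ^ card u * f u)"
    unfolding sum_Pow_insert[OF insert.hyps]
    by (intro sum.cong refl) (simp add: card_insert algebra_simps)
  finally show ?case .
qed

section \<open>Regular unitary dilations\<close>

locale regular_dilation = contraction_family \<Omega> \<S> S H T + unitary_family \<Omega> \<S> S K U
  for \<Omega> :: "'i set" and \<S> S and H :: "'h::complex_vector hilbert" and T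
    and K :: "'k::complex_vector hilbert" and U +
  fixes V :: "'h \<Rightarrow> 'k"
  assumes dilation: "regular_unitary_dilation S H T K V U"
begin

lemma V_isometric: "isometric_op H K V"
  using dilation by (simp add: regular_unitary_dilation_def)

lemma V_mem [simp]: "x \<in> hcarrier H \<Longrightarrow> V x \<in> hcarrier K"
  using V_isometric by (auto simp: isometric_op_def linear_op_def)

lemma V_inner [simp]: "x \<in> hcarrier H \<Longrightarrow> y \<in> hcarrier H \<Longrightarrow> hinner K (V x) (V y) = hinner H x y"
  using V_isometric by (simp add: isometric_op_def)

text \<open>The projection onto the range of the isometry V is V composed with its adjoint. This
  supplies the witness for \<open>orth_proj\<close>, without which the dilation identity would say
  nothing about inner products.\<close>

lemma inner_R_V_V:
  assumes g: "g \<in> G" and x: "x \<in> hcarrier H" and y: "y \<in> hcarrier H"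
  shows "hinner K (R g (V x)) (V y) = form g x y"
proof -
  let ?k = "R g (V x)" and ?z = "adjoint_op H K V (R g (V x))"
  have k: "?k \<in> hcarrier K" using g x by simp
  have z: "?z \<in> hcarrier H"
    by (intro adjoint_op_mem H.hilbert K.hilbert isometric_imp_bounded V_isometric k)
  have orth: "hinner K ?k (V h) = hinner K (V ?z) (V h)" if h: "h \<in> hcarrier H" for h
  proof -
    have "hinner K (V h) ?k = hinner H h ?z"
      using h by (intro inner_adjoint_op H.hilbert K.hilbert isometric_imp_bounded V_isometric k)
    then show ?thesis
      using K.inner_commute[of "V h" ?k] H.inner_commute[OF h z] h k z by simp
  qed
  then have "orth_proj K (V ` hcarrier H) ?k = V ?z"
    by (rule orth_proj_range_eqI[OF K.hilbert V_isometric k z])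
  then have "V ?z = V (regular_op H T g x)"
    using dilation g x by (simp add: regular_unitary_dilation_def)
  then have "hinner K ?k (V y) = hinner H (regular_op H T g x) y"
    using orth[OF y] g x y by simp
  then show ?thesis
    using g x y by (simp add: inner_regular_op)
qed

lemma inner_R_V:
  assumes "g \<in> G" "g' \<in> G" "x \<in> hcarrier H" "y \<in> hcarrier H"
  shows "hinner K (R g (V x)) (R g' (V y)) = form (g - g') x y"
  using assms by (simp add: R_inner inner_R_V_V)

theorem regular_positivity: "regular_positivity \<Omega> S H T"
  unfolding regular_positivity_iff
proof (intro allI impI; elim conjE)
  fix v :: "'i set" and s x
  assume v: "finite v" and s: "s \<in> S" and x: "x \<in> hcarrier H"
  define r where "r u = restrict_index s u" for u
  have r [simp]: "r u \<in> S" for u using s by (simp add: r_def)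
  define y where "y u = ((- 1) ^ card u) *\<^sub>C R (- r u) (V (T (r u) x))" for u
  have y [simp]: "y u \<in> hcarrier K" for u
    unfolding y_def using x by (intro K.scaleC_mem R_mem V_mem T_mem group_uminus cone_in_group r)
  \<comment> \<open>The positive and negative parts of r w - r u are r on w - u and on u - w; adding
    r u and r w respectively gives r (u \<union> w) on both sides, so up to sign the inner product
    depends on the union only.\<close>
  have inner_y: "hinner K (y u) (y w) =
      (- 1) ^ card u * ((- 1) ^ card w * ip (T (r (u \<union> w)) x) (T (r (u \<union> w)) x))" for u w
  proof -
    have parts: "pos_part (r w - r u) = r (w - u)" "neg_part (r w - r u) = r (u - w)"
      using cone_nonneg[OF s]
      by (auto simp: r_def restrict_index_def pos_part_def neg_part_def fun_eq_iff max_def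
          intro: order_antisym)
    have union: "r (w - u) + r u = r (u \<union> w)" "r (u - w) + r w = r (u \<union> w)"
      by (auto simp: r_def restrict_index_def fun_eq_iff)
    have "hinner K (R (- r u) (V (T (r u) x))) (R (- r w) (V (T (r w) x))) =
        form (r w - r u) (T (r u) x) (T (r w) x)"
      using x inner_R_V[of "- r u" "- r w" "T (r u) x" "T (r w) x"] by simp
    also have "\<dots> = ip (T (r (u \<union> w)) x) (T (r (u \<union> w)) x)"
      using x by (simp add: form_def parts union flip: T_add)
    finally show ?thesis
      using x by (simp add: y_def K.inner_scaleC_left K.inner_scaleC_right)
  qed
  have "hinner K (sum y (Pow v)) (sum y (Pow v)) = (\<Sum>u\<in>Pow v. \<Sum>w\<in>Pow v. hinner K (y u) (y w))"
    by (rule K.inner_sum_sum) simp_all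
  also have "\<dots> = (\<Sum>u\<in>Pow v. (- 1) ^ card u * ip (T (r u) x) (T (r u) x))"
    unfolding inner_y using v by (rule sum_Pow_union_sign)
  finally show "(\<Sum>u\<in>Pow v. (- 1) ^ card u *
      ip (T (restrict_index s u) x) (T (restrict_index s u) x)) \<in> \<real>\<^sub>\<ge>\<^sub>0"
    using K.inner_self_nonneg[OF K.sum_mem[of "Pow v" y]] y by (simp add: r_def)
qed

end

section \<open>Total families with equal Gram matrices\<close>

lemma (in hspace) Cauchy_if_convergent:
  assumes f: "\<And>n::nat. f n \<in> hcarrier H" and l: "l \<in> hcarrier H"
    and lim: "(\<lambda>n. hnorm H (f n - l)) \<longlonglongrightarrow> 0" and "e > 0"
  shows "\<exists>N. \<forall>m\<ge>N. \<forall>n\<ge>N. hnorm H (f m - f n) < e"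
proof -
  have "\<forall>\<^sub>F n in sequentially. hnorm H (f n - l) < e / 2"
    using lim \<open>e > 0\<close> by (intro order_tendstoD(2)) auto
  then obtain N where N: "\<And>n. n \<ge> N \<Longrightarrow> hnorm H (f n - l) < e / 2"
    unfolding eventually_sequentially by blast
  have "hnorm H (f m - f n) < e" if "m \<ge> N" "n \<ge> N" for m n
    using hnorm_triangle_diff[OF f l f, of m n] hnorm_minus_commute[OF l f, of n]
      N[OF that(1)] N[OF that(2)] by simp
  then show ?thesis by blast
qed

text \<open>The density argument as an induction rule: vectors with P contain a subspace through E,
  and every vector is the limit of a sequence in the span of E. It serves for orthogonality, for
  building and inverting the intertwining unitary, and for continuity.\<close>

lemma (in hspace) total_induct [consumes 3, case_names generator zero add scale limit]:
  assumes total: "hcarrier H = htopology H closure_of cspan E" and E: "E \<subseteq> hcarrier H"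
    and x: "x \<in> hcarrier H"
    and generator: "\<And>e. e \<in> E \<Longrightarrow> P e"
    and zero: "P 0"
    and add: "\<And>x y. x \<in> hcarrier H \<Longrightarrow> y \<in> hcarrier H \<Longrightarrow> P x \<Longrightarrow> P y \<Longrightarrow> P (x + y)"
    and scale: "\<And>c x. x \<in> hcarrier H \<Longrightarrow> P x \<Longrightarrow> P (c *\<^sub>C x)"
    and limit: "\<And>f l. (\<And>n::nat. f n \<in> hcarrier H) \<Longrightarrow> (\<And>n. P (f n)) \<Longrightarrow> l \<in> hcarrier H \<Longrightarrow>
      (\<lambda>n. hnorm H (f n - l)) \<longlonglongrightarrow> 0 \<Longrightarrow> P l"
  shows "P x"
proof -
  have "csubspace {x \<in> hcarrier H. P x}"
    using zero add scale by (auto simp: complex_vector.subspace_def)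
  then have span: "cspan E \<subseteq> {x \<in> hcarrier H. P x}"
    using E generator by (intro complex_vector.span_minimal) auto
  have "\<forall>e>0. \<exists>y\<in>cspan E. hnorm H (x - y) < e"
    using x total span in_closure_iff[of "cspan E" x] by auto
  then have "\<exists>y\<in>cspan E. hnorm H (x - y) < 1 / real (Suc n)" for n
    by simp
  then obtain f where f: "\<And>n. f n \<in> cspan E" and less: "\<And>n. hnorm H (x - f n) < 1 / real (Suc n)"
    by metis
  have mem: "f n \<in> hcarrier H" for n using f span by blast
  have "(\<lambda>n. hnorm H (f n - x)) \<longlonglongrightarrow> 0"
  proof (rule Lim_null_comparison)
    show "\<forall>\<^sub>F n in sequentially. norm (hnorm H (f n - x)) \<le> 1 / real (Suc n)"
      using less mem x by (auto simp: hnorm_minus_commute[of x] intro!: always_eventually less_imp_le)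
    show "(\<lambda>n. 1 / real (Suc n)) \<longlonglongrightarrow> 0"
      by (rule LIMSEQ_Suc[OF lim_1_over_n])
  qed
  then show ?thesis
    using f span mem x by (intro limit[of f x]) auto
qed

lemma (in hspace) total_orthogonal_eq_0:
  assumes total: "hcarrier H = htopology H closure_of cspan E" and E: "E \<subseteq> hcarrier H"
    and x: "x \<in> hcarrier H" and orth: "\<And>e. e \<in> E \<Longrightarrow> hinner H x e = 0"
  shows "x = 0"
proof (rule eq_zero_if_orthogonal[OF x])
  fix y assume "y \<in> hcarrier H"
  with total E show "hinner H x y = 0"
  proof (induction rule: total_induct)
    case (limit f l)
    then have "(\<lambda>n. hinner H x (f n)) \<longlonglongrightarrow> hinner H x l"
      by (intro tendsto_inner_right x)
    then show ?case using limit by (simp add: LIMSEQ_const_iff)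
  qed (use x orth in \<open>simp_all add: inner_add_right inner_scaleC_right\<close>)
qed

text \<open>The graph of \<open>W\<close> consists of the pairs with equal inner products against the two families.\<close>

lemma Gram_unitary:
  fixes K :: "'k::complex_vector hilbert" and K' :: "'l::complex_vector hilbert"
  assumes K: "hilbert_space K" and K': "hilbert_space K'"
    and e: "e ` I \<subseteq> hcarrier K" and e': "e' ` I \<subseteq> hcarrier K'"
    and total: "hcarrier K = htopology K closure_of cspan (e ` I)"
    and total': "hcarrier K' = htopology K' closure_of cspan (e' ` I)"
    and Gram: "\<And>i j. i \<in> I \<Longrightarrow> j \<in> I \<Longrightarrow> hinner K (e i) (e j) = hinner K' (e' i) (e' j)"
  shows "\<exists>W. unitary_op K K' W \<and>
    (\<forall>x\<in>hcarrier K. \<forall>x'\<in>hcarrier K'. (\<forall>i\<in>I. hinner K x (e i) = hinner K' x' (e' i)) \<longrightarrow> W x = x') \<and>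
    (\<forall>x\<in>hcarrier K. \<forall>i\<in>I. hinner K x (e i) = hinner K' (W x) (e' i))"
proof -
  interpret K: hspace K by unfold_locales fact
  interpret K': hspace K' by unfold_locales fact
  define rel where "rel x x' \<longleftrightarrow> (\<forall>i\<in>I. hinner K x (e i) = hinner K' x' (e' i))" for x x'
  \<comment> \<open>Matching inner products with the two families is not visibly stable under norm
    limits. Comparing in addition with all related pairs makes the correspondence isometric on
    differences, so approximants of y yield a Cauchy sequence of images.\<close>
  define good where "good y y' \<longleftrightarrow> rel y y' \<and> (\<forall>x\<in>hcarrier K. \<forall>x'\<in>hcarrier K'. rel x x' \<longrightarrow>
      hinner K x y = hinner K' x' y')" for y y'
  have e_mem: "e i \<in> hcarrier K" "e' i \<in> hcarrier K'" if "i \<in> I" for i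
    using e e' that by auto
  have rel_diff: "rel (x - y) (x' - y')"
    if "rel x x'" "rel y y'" "x \<in> hcarrier K" "y \<in> hcarrier K" "x' \<in> hcarrier K'" "y' \<in> hcarrier K'"
    for x x' y y'
    using that e_mem by (simp add: rel_def K.inner_diff_left K'.inner_diff_left)
  have ex: "\<exists>y'\<in>hcarrier K'. good y y'" if "y \<in> hcarrier K" for y
    using total e that
  proof (induction rule: K.total_induct)
    case (generator y)
    then obtain i where "i \<in> I" "y = e i" by blast
    then have "good y (e' i)"
      using Gram by (auto simp: good_def rel_def)
    then show ?case using e_mem \<open>i \<in> I\<close> by blast
  next
    case zero
    have "good 0 0"
      using e_mem by (auto simp: good_def rel_def)
    then show ?case using K'.zero_mem by blast
  next
    case (add x y)
    then obtain x' y' where "x' \<in> hcarrier K'" "y' \<in> hcarrier K'" "good x x'" "good y y'" by blast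
    then have "good (x + y) (x' + y')"
      using add.hyps e_mem
      by (auto simp: good_def rel_def K.inner_add_left K'.inner_add_left K.inner_add_right K'.inner_add_right)
    then show ?case using \<open>x' \<in> hcarrier K'\<close> \<open>y' \<in> hcarrier K'\<close> K'.add_mem by blast
  next
    case (scale c x)
    then obtain x' where "x' \<in> hcarrier K'" "good x x'" by blast
    then have "good (c *\<^sub>C x) (c *\<^sub>C x')"
      using scale.hyps e_mem
      by (auto simp: good_def rel_def K.inner_scaleC_left K'.inner_scaleC_left
          K.inner_scaleC_right K'.inner_scaleC_right)
    then show ?case using \<open>x' \<in> hcarrier K'\<close> K'.scaleC_mem by blast
  next
    case (limit f l)
    then obtain f' where f': "\<And>n. f' n \<in> hcarrier K'" and good: "\<And>n. good (f n) (f' n)"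
      by metis
    have norm_eq: "hnorm K' (f' m - f' n) = hnorm K (f m - f n)" for m n
    proof -
      have r: "rel (f m - f n) (f' m - f' n)"
        using good f' limit.hyps by (intro rel_diff) (auto simp: good_def)
      have "hinner K (f m - f n) (f k) = hinner K' (f' m - f' n) (f' k)" for k
        using good[of k] r f' limit.hyps by (simp add: good_def)
      then have "hinner K (f m - f n) (f m - f n) = hinner K' (f' m - f' n) (f' m - f' n)"
        using f' limit.hyps
        by (simp add: K.inner_diff_right K'.inner_diff_right)
      then show ?thesis by (simp add: hnorm_def)
    qed
    have "\<exists>N. \<forall>m\<ge>N. \<forall>n\<ge>N. hnorm K' (f' m - f' n) < \<epsilon>" if "\<epsilon> > 0" for \<epsilon>
      unfolding norm_eq using limit.hyps that by (intro K.Cauchy_if_convergent) auto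
    with f' have "\<exists>l'\<in>hcarrier K'. (\<lambda>n. hnorm K' (f' n - l')) \<longlonglongrightarrow> 0"
      by (rule K'.convergent_if_Cauchy)
    then obtain l' where l': "l' \<in> hcarrier K'" "(\<lambda>n. hnorm K' (f' n - l')) \<longlonglongrightarrow> 0" by blast
    have "rel l l'"
      unfolding rel_def
    proof
      fix i assume i: "i \<in> I"
      have "(\<lambda>n. hinner K (f n) (e i)) \<longlonglongrightarrow> hinner K l (e i)"
        using limit.hyps e_mem[OF i] by (intro K.tendsto_inner_left) auto
      moreover have "(\<lambda>n. hinner K' (f' n) (e' i)) \<longlonglongrightarrow> hinner K' l' (e' i)"
        using l' f' e_mem[OF i] by (intro K'.tendsto_inner_left) auto
      moreover have "hinner K (f n) (e i) = hinner K' (f' n) (e' i)" for n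
        using good[of n] i by (simp add: good_def rel_def)
      ultimately show "hinner K l (e i) = hinner K' l' (e' i)"
        by (simp add: LIMSEQ_unique)
    qed
    moreover have "hinner K x l = hinner K' x' l'"
      if x: "x \<in> hcarrier K" "x' \<in> hcarrier K'" and "rel x x'" for x x'
    proof -
      have "(\<lambda>n. hinner K x (f n)) \<longlonglongrightarrow> hinner K x l"
        using limit.hyps x by (intro K.tendsto_inner_right) auto
      moreover have "(\<lambda>n. hinner K' x' (f' n)) \<longlonglongrightarrow> hinner K' x' l'"
        using l' f' x by (intro K'.tendsto_inner_right) auto
      moreover have "hinner K x (f n) = hinner K' x' (f' n)" for n
        using good[of n] that by (simp add: good_def)
      ultimately show ?thesis
        by (simp add: LIMSEQ_unique)
    qed
    ultimately have "good l l'" by (auto simp: good_def)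
    then show ?case using l'(1) by blast
  qed
  define W where "W x = (SOME x'. x' \<in> hcarrier K' \<and> good x x')" for x
  have W: "W x \<in> hcarrier K'" "good x (W x)" if "x \<in> hcarrier K" for x
    using someI_ex[of "\<lambda>x'. x' \<in> hcarrier K' \<and> good x x'"] ex[OF that] unfolding W_def by blast+
  have W_rel: "rel x (W x)" if "x \<in> hcarrier K" for x
    using W(2)[OF that] by (simp add: good_def)
  \<comment> \<open>The second family is total, so related images are unique. Linearity of W and
    membership of concrete vectors in its graph follow from this by comparing inner
    products.\<close>
  have W_eqI: "W x = x'" if x: "x \<in> hcarrier K" "x' \<in> hcarrier K'" and r: "rel x x'" for x x'
  proof -
    have "hinner K' (W x - x') (e' i) = 0" if "i \<in> I" for i
      using W_rel[OF x(1)] W(1)[OF x(1)] r that x e_mem by (simp add: rel_def K'.inner_diff_left)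
    then have "W x - x' = 0"
      using W(1)[OF x(1)] x by (intro K'.total_orthogonal_eq_0[OF total' e']) auto
    then show ?thesis by simp
  qed
  have "hinner K' (W x) (W y) = hinner K x y" if "x \<in> hcarrier K" "y \<in> hcarrier K" for x y
    using W(2)[OF that(2)] W(1)[OF that(1)] W_rel[OF that(1)] that(1) by (simp add: good_def)
  moreover have W_add: "W (x + y) = W x + W y" if "x \<in> hcarrier K" "y \<in> hcarrier K" for x y
  proof (rule W_eqI)
    show "rel (x + y) (W x + W y)"
      using W_rel[OF that(1)] W_rel[OF that(2)] W(1)[OF that(1)] W(1)[OF that(2)] that e_mem
      by (simp add: rel_def K.inner_add_left K'.inner_add_left)
  qed (use W(1) that in auto)
  moreover have W_scale: "W (c *\<^sub>C x) = c *\<^sub>C W x" if "x \<in> hcarrier K" for c x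
  proof (rule W_eqI)
    show "rel (c *\<^sub>C x) (c *\<^sub>C W x)"
      using W_rel[OF that] W(1)[OF that] that e_mem
      by (simp add: rel_def K.inner_scaleC_left K'.inner_scaleC_left)
  qed (use W(1) that in auto)
  ultimately have iso: "isometric_op K K' W"
    using W(1) by (simp add: isometric_op_def linear_op_def)
  have "W ` hcarrier K = hcarrier K'"
  proof
    show "W ` hcarrier K \<subseteq> hcarrier K'" using W(1) by blast
    show "hcarrier K' \<subseteq> W ` hcarrier K"
    proof
      fix z assume "z \<in> hcarrier K'"
      with total' e' show "z \<in> W ` hcarrier K"
      proof (induction rule: K'.total_induct)
        case (generator z)
        then obtain i where i: "i \<in> I" "z = e' i" by blast
        then have "W (e i) = z"
          using Gram e_mem by (intro W_eqI) (auto simp: rel_def)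
        then show ?case using i e_mem by blast
      next
        case zero
        have "W 0 = 0"
          using e_mem by (intro W_eqI) (auto simp: rel_def)
        then show ?case using K.zero_mem by (metis imageI)
      next
        case (add x y)
        then obtain a b where "a \<in> hcarrier K" "b \<in> hcarrier K" "x = W a" "y = W b" by blast
        then have "x + y = W (a + b)" "a + b \<in> hcarrier K" using W_add by simp_all
        then show ?case by blast
      next
        case (scale c x)
        then obtain a where "a \<in> hcarrier K" "x = W a" by blast
        then have "c *\<^sub>C x = W (c *\<^sub>C a)" "c *\<^sub>C a \<in> hcarrier K" using W_scale by simp_all
        then show ?case by blast
      next
        \<comment> \<open>An isometry between complete spaces has closed range: the preimages
          inherit the Cauchy property, and the image of their limit is l.\<close>
        case (limit f l)
        have "\<forall>n. \<exists>y. y \<in> hcarrier K \<and> f n = W y"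
          using limit.IH by blast
        then obtain g where g: "\<And>n. g n \<in> hcarrier K" and f: "\<And>n. f n = W (g n)"
          by metis
        have lin: "linear_op K K' W" using iso by (simp add: isometric_op_def)
        have norm_W: "hnorm K' (W x) = hnorm K x" if "x \<in> hcarrier K" for x
          using iso that by (simp add: isometric_op_def hnorm_def)
        have norm_eq: "hnorm K (x - y) = hnorm K' (W x - W y)" if "x \<in> hcarrier K" "y \<in> hcarrier K" for x y
          using norm_W[of "x - y"] that linear_op_diff[OF lin K] by simp
        have "\<exists>N. \<forall>m\<ge>N. \<forall>n\<ge>N. hnorm K (g m - g n) < \<epsilon>" if "\<epsilon> > 0" for \<epsilon>
          unfolding norm_eq[OF g g] f[symmetric] using limit.hyps that
          by (intro K'.Cauchy_if_convergent) auto
        with g have "\<exists>y\<in>hcarrier K. (\<lambda>n. hnorm K (g n - y)) \<longlonglongrightarrow> 0"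
          by (rule K.convergent_if_Cauchy)
        then obtain y where y: "y \<in> hcarrier K" "(\<lambda>n. hnorm K (g n - y)) \<longlonglongrightarrow> 0" by blast
        have "hnorm K' (W y - l) \<le> 0"
        proof (rule LIMSEQ_le_const)
          show "(\<lambda>n. hnorm K (g n - y) + hnorm K' (f n - l)) \<longlonglongrightarrow> 0"
            using tendsto_add[OF y(2) limit.hyps(3)] by simp
          show "\<exists>N. \<forall>n\<ge>N. hnorm K' (W y - l) \<le> hnorm K (g n - y) + hnorm K' (f n - l)"
          proof (intro exI allI impI)
            fix n
            have "hnorm K' (W y - l) \<le> hnorm K' (W y - f n) + hnorm K' (f n - l)"
              using limit.hyps W(1)[OF y(1)] by (intro K'.hnorm_triangle_diff) auto
            then show "hnorm K' (W y - l) \<le> hnorm K (g n - y) + hnorm K' (f n - l)"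
              using K'.hnorm_minus_commute[of "W y" "f n"] limit.hyps W(1)[OF y(1)]
                norm_eq[OF g y(1), of n] f by simp
          qed
        qed
        then have "W y - l = 0"
          using K'.hnorm_eq_0[of "W y - l"] K'.hnorm_ge_0[of "W y - l"] limit.hyps W(1)[OF y(1)]
          by (simp add: order_antisym)
        then show ?case using y(1) by auto
      qed
    qed
  qed
  with iso have "unitary_op K K' W" by (simp add: unitary_op_def)
  with W_eqI W_rel show ?thesis
    unfolding rel_def by blast
qed

section \<open>Minimal dilations: uniqueness and continuity\<close>

locale minimal_dilation = regular_dilation +
  assumes total: "hcarrier K = htopology K closure_of
      cspan {R g (V h) | g h. g \<in> G \<and> h \<in> hcarrier H}"
begin

abbreviation generator :: "('a \<Rightarrow> real) \<times> 'b \<Rightarrow> 'c" where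
  "generator \<equiv> \<lambda>(g, h). R g (V h)"

lemma generator_image:
  "{R g (V h) | g h. g \<in> G \<and> h \<in> hcarrier H} = generator ` (G \<times> hcarrier H)"
  by auto

lemma generator_mem: "generator ` (G \<times> hcarrier H) \<subseteq> hcarrier K"
  by auto

lemma generator_total: "hcarrier K = htopology K closure_of cspan (generator ` (G \<times> hcarrier H))"
  using total by (simp only: generator_image)

lemma inner_generator:
  "p \<in> G \<times> hcarrier H \<Longrightarrow> q \<in> G \<times> hcarrier H \<Longrightarrow>
   hinner K (generator p) (generator q) = form (fst p - fst q) (snd p) (snd q)"
  by (auto simp: inner_R_V)

text \<open>For a contraction |T h| \<le> |h|, so expanding the square leaves twice the real part of
  the inner product of h - T h with h: weak smallness at h is strong smallness.\<close>

lemma norm_T_diff: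
  assumes "s \<in> S" "h \<in> hcarrier H"
  shows "(hnorm H (T s h - h))\<^sup>2 \<le> 2 * cmod (ip h h - ip (T s h) h)"
proof -
  have "(hnorm H (T s h - h))\<^sup>2 = (hnorm H (T s h))\<^sup>2 - 2 * Re (ip (T s h) h) + (hnorm H h)\<^sup>2"
    using assms by (simp add: H.hnorm_diff_square)
  also have "\<dots> \<le> 2 * (hnorm H h)\<^sup>2 - 2 * Re (ip (T s h) h)"
    using power_mono[OF T_norm[OF assms], of 2] assms by simp
  also have "\<dots> = 2 * Re (ip h h - ip (T s h) h)"
    using assms by (simp add: H.hnorm_square)
  also have "\<dots> \<le> 2 * cmod (ip h h - ip (T s h) h)"
    by (intro mult_left_mono complex_Re_le_cmod) simp
  finally show ?thesis .
qed

text \<open>Since U is a commuting family of unitaries, g drops out and the distance is governed by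
  \<open>form (s - t) h h\<close>, in which only T at the two parts of s - t occurs.\<close>

lemma norm_U_diff_generator:
  assumes s: "s \<in> S" and t: "t \<in> S" and g: "g \<in> G" and h: "h \<in> hcarrier H"
  defines "a \<equiv> pos_part (s - t)" and "b \<equiv> neg_part (s - t)"
  shows "(hnorm K (U s (R g (V h)) - U t (R g (V h))))\<^sup>2 \<le>
    2 * hnorm H h * (hnorm H (T a h - h) + hnorm H (T b h - h))"
proof -
  have ab: "a \<in> S" "b \<in> S" using s t by (simp_all add: a_def b_def)
  have mem: "T a h \<in> hcarrier H" "T b h \<in> hcarrier H" using ab h by simp_all
  have norm: "(hnorm K (U r (R g (V h))))\<^sup>2 = (hnorm H h)\<^sup>2" if "r \<in> S" for r
    using that g h by (simp add: K.hnorm_square H.hnorm_square R_inner)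
  have "hinner K (U s (R g (V h))) (U t (R g (V h))) = form ((g + s) - (g + t)) h h"
    using s t g h by (simp add: U_R inner_R_V del: add_diff_cancel_left)
  then have inner: "hinner K (U s (R g (V h))) (U t (R g (V h))) = ip (T a h) (T b h)"
    by (simp add: form_def a_def b_def)
  have "(hnorm K (U s (R g (V h)) - U t (R g (V h))))\<^sup>2 = 2 * Re (ip h h - ip (T a h) (T b h))"
    using s t g h norm[OF s] by (simp add: K.hnorm_diff_square inner H.hnorm_square)
  \<comment> \<open>The inner product of h with T b h is inserted, so that each term contains one of
    the two small vectors.\<close>
  also have "ip h h - ip (T a h) (T b h) = - (ip (T a h - h) (T b h) + ip h (T b h - h))"
    using h mem by (simp add: H.inner_diff_left H.inner_diff_right)
  also have "2 * Re \<dots> \<le> 2 * cmod (ip (T a h - h) (T b h) + ip h (T b h - h))"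
    using complex_Re_le_cmod[of "- (ip (T a h - h) (T b h) + ip h (T b h - h))"]
    by (simp only: norm_minus_cancel)
  also have "cmod (ip (T a h - h) (T b h) + ip h (T b h - h)) \<le>
      cmod (ip (T a h - h) (T b h)) + cmod (ip h (T b h - h))"
    by (rule norm_triangle_ineq)
  also have "cmod (ip (T a h - h) (T b h)) \<le> hnorm H (T a h - h) * hnorm H (T b h)"
    using h mem by (intro H.Cauchy_Schwarz) simp_all
  also have "\<dots> \<le> hnorm H (T a h - h) * hnorm H h"
    using h mem T_norm[OF ab(2) h] by (intro mult_left_mono) simp_all
  also have "cmod (ip h (T b h - h)) \<le> hnorm H h * hnorm H (T b h - h)"
    using h mem by (intro H.Cauchy_Schwarz) simp_all
  finally show ?thesis by (simp add: algebra_simps)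
qed

text \<open>The positive and negative parts of s - t depend continuously on s and vanish at s = t,
  which transports weak continuity at 0 to the point t; \<open>norm_T_diff\<close> upgrades it to a
  norm estimate.\<close>

lemma weakly_continuous_near_zero:
  assumes X: "compatible_topology S X" and weak: "weakly_continuous X H T"
    and t: "t \<in> S" and h: "h \<in> hcarrier H" and \<delta>: "\<delta> > 0"
    and q: "q = pos_part \<or> q = neg_part"
  shows "\<exists>N. openin X N \<and> t \<in> N \<and> (\<forall>s\<in>N. hnorm H (T (q (s - t)) h - h) < \<delta>)"
proof -
  have top: "topspace X = S" using X by (simp add: compatible_topology_def)
  have part_S: "q (s - t) \<in> S" if "s \<in> S" for s
    using q that t by auto
  have part_0: "q (t - t) = 0" using q by auto
  have "continuous_map X X (\<lambda>s. q (s - t))"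
    using X t q by (auto simp: compatible_topology_def)
  moreover have "continuous_map X euclidean (\<lambda>s. ip (T s h) h)"
    using weak h by (simp add: weakly_continuous_def)
  ultimately have "continuous_map X euclidean ((\<lambda>s. ip (T s h) h) \<circ> (\<lambda>s. q (s - t)))"
    by (rule continuous_map_compose)
  \<comment> \<open>The radius \<delta>^2 / 2 compensates for the square and the factor 2 in
    \<open>norm_T_diff\<close>.\<close>
  then have "openin X {s \<in> topspace X. ((\<lambda>s. ip (T s h) h) \<circ> (\<lambda>s. q (s - t))) s \<in> ball (ip h h) (\<delta>\<^sup>2 / 2)}"
    by (rule openin_continuous_map_preimage) simp
  moreover have "t \<in> {s \<in> topspace X. ((\<lambda>s. ip (T s h) h) \<circ> (\<lambda>s. q (s - t))) s \<in> ball (ip h h) (\<delta>\<^sup>2 / 2)}"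
    using t h \<delta> part_0 by (simp add: top)
  moreover have "hnorm H (T (q (s - t)) h - h) < \<delta>"
    if "s \<in> topspace X" "((\<lambda>s. ip (T s h) h) \<circ> (\<lambda>s. q (s - t))) s \<in> ball (ip h h) (\<delta>\<^sup>2 / 2)" for s
  proof -
    have "(hnorm H (T (q (s - t)) h - h))\<^sup>2 < \<delta>\<^sup>2"
      using that norm_T_diff[OF part_S h, of s] by (simp add: top dist_norm)
    then show ?thesis using \<delta> by (intro power_less_imp_less_base[of _ 2 \<delta>]) auto
  qed
  ultimately show ?thesis by blast
qed

text \<open>Unitaries preserve norms, so the vectors with a continuous orbit map form a closed
  subspace. Only generators require the weak continuity of T.\<close>

theorem strongly_continuous:
  assumes X: "compatible_topology S X" and weak: "weakly_continuous X H T"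
  shows "strongly_continuous X K U"
proof -
  have top: "topspace X = S" using X by (simp add: compatible_topology_def)
  define cont where "cont x \<longleftrightarrow> (\<forall>t\<in>S. \<forall>\<epsilon>>0. \<exists>N. openin X N \<and> t \<in> N \<and>
      (\<forall>s\<in>N. hnorm K (U s x - U t x) < \<epsilon>))" for x
  have in_S: "s \<in> S" if "openin X N" "s \<in> N" for s N
    using that openin_subset top by blast
  have contD: "\<exists>N. openin X N \<and> t \<in> N \<and> (\<forall>s\<in>N. hnorm K (U s x - U t x) < \<epsilon>)"
    if "cont x" "t \<in> S" "\<epsilon> > 0" for x t \<epsilon>
    using that by (simp add: cont_def)
  have "cont x" if "x \<in> hcarrier K" for x
    using generator_total generator_mem that
  proof (induction rule: K.total_induct)
    case (generator x)
    then obtain g h where x: "x = R g (V h)" and g: "g \<in> G" and h: "h \<in> hcarrier H" by auto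
    show ?case
      unfolding cont_def
    proof (intro ballI allI impI)
      fix t \<epsilon> assume t: "t \<in> S" and \<epsilon>: "(0::real) < \<epsilon>"
      \<comment> \<open>The estimate for generators is at most 4 |h| \<delta>, which has to stay
        below \<epsilon>^2; the added 1 gives a strict inequality and covers h = 0.\<close>
      define \<delta> where "\<delta> = \<epsilon>\<^sup>2 / (4 * hnorm H h + 1)"
      have pos: "4 * hnorm H h + 1 > 0" using h by (simp add: add_nonneg_pos)
      then have \<delta>: "\<delta> > 0" using \<epsilon> by (simp add: \<delta>_def)
      obtain N1 where N1: "openin X N1" "t \<in> N1"
        "\<And>s. s \<in> N1 \<Longrightarrow> hnorm H (T (pos_part (s - t)) h - h) < \<delta>"
        using weakly_continuous_near_zero[OF X weak t h \<delta>, of pos_part] by blast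
      obtain N2 where N2: "openin X N2" "t \<in> N2"
        "\<And>s. s \<in> N2 \<Longrightarrow> hnorm H (T (neg_part (s - t)) h - h) < \<delta>"
        using weakly_continuous_near_zero[OF X weak t h \<delta>, of neg_part] by blast
      have "hnorm K (U s x - U t x) < \<epsilon>" if s: "s \<in> N1" "s \<in> N2" for s
      proof -
        have "(hnorm K (U s x - U t x))\<^sup>2 \<le> 2 * hnorm H h *
            (hnorm H (T (pos_part (s - t)) h - h) + hnorm H (T (neg_part (s - t)) h - h))"
          unfolding x using in_S[OF N1(1) s(1)] t g h by (rule norm_U_diff_generator)
        also have "\<dots> \<le> 2 * hnorm H h * (\<delta> + \<delta>)"
          using N1(3)[OF s(1)] N2(3)[OF s(2)] h by (intro mult_left_mono) simp_all
        also have "\<dots> < (4 * hnorm H h + 1) * \<delta>"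
          using \<delta> by (simp add: algebra_simps)
        also have "\<dots> = \<epsilon>\<^sup>2"
          using pos by (simp add: \<delta>_def)
        finally show ?thesis using \<epsilon> by (intro power_less_imp_less_base[of _ 2 \<epsilon>]) auto
      qed
      then show "\<exists>N. openin X N \<and> t \<in> N \<and> (\<forall>s\<in>N. hnorm K (U s x - U t x) < \<epsilon>)"
        using N1 N2 by (intro exI[of _ "N1 \<inter> N2"]) auto
    qed
  next
    case zero
    have "U s 0 = 0" if "s \<in> S" for s
      using U_diff[OF that, of 0 0] by simp
    then show ?case
      using in_S openin_topspace[of X] by (auto simp: cont_def top)
  next
    case (add x y)
    show ?case
      unfolding cont_def
    proof (intro ballI allI impI)
      fix t \<epsilon> assume t: "t \<in> S" and \<epsilon>: "(0::real) < \<epsilon>"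
      obtain N1 where N1: "openin X N1" "t \<in> N1" "\<And>s. s \<in> N1 \<Longrightarrow> hnorm K (U s x - U t x) < \<epsilon> / 2"
        using contD[OF add.IH(1) t half_gt_zero[OF \<epsilon>]] by blast
      obtain N2 where N2: "openin X N2" "t \<in> N2" "\<And>s. s \<in> N2 \<Longrightarrow> hnorm K (U s y - U t y) < \<epsilon> / 2"
        using contD[OF add.IH(2) t half_gt_zero[OF \<epsilon>]] by blast
      have "hnorm K (U s (x + y) - U t (x + y)) < \<epsilon>" if s: "s \<in> N1" "s \<in> N2" for s
      proof -
        have sS: "s \<in> S" using in_S N1(1) s(1) .
        have "U s (x + y) - U t (x + y) = (U s x - U t x) + (U s y - U t y)"
          using U_linear[OF sS] U_linear[OF t] add.hyps by (simp add: linear_op_def)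
        then show ?thesis
          using K.hnorm_triangle[of "U s x - U t x" "U s y - U t y"] N1(3)[OF s(1)] N2(3)[OF s(2)]
            sS t add.hyps by simp
      qed
      then show "\<exists>N. openin X N \<and> t \<in> N \<and> (\<forall>s\<in>N. hnorm K (U s (x + y) - U t (x + y)) < \<epsilon>)"
        using N1 N2 by (intro exI[of _ "N1 \<inter> N2"]) auto
    qed
  next
    case (scale c x)
    show ?case
      unfolding cont_def
    proof (intro ballI allI impI)
      fix t \<epsilon> assume t: "t \<in> S" and \<epsilon>: "(0::real) < \<epsilon>"
      have pos: "cmod c + 1 > 0" by (simp add: add_nonneg_pos)
      obtain N where N: "openin X N" "t \<in> N" "\<And>s. s \<in> N \<Longrightarrow> hnorm K (U s x - U t x) < \<epsilon> / (cmod c + 1)"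
        using contD[OF scale.IH t divide_pos_pos[OF \<epsilon> pos]] by blast
      have "hnorm K (U s (c *\<^sub>C x) - U t (c *\<^sub>C x)) < \<epsilon>" if s: "s \<in> N" for s
      proof -
        have sS: "s \<in> S" using in_S N(1) s .
        have "U s (c *\<^sub>C x) - U t (c *\<^sub>C x) = c *\<^sub>C (U s x - U t x)"
          using U_linear[OF sS] U_linear[OF t] scale.hyps
          by (simp add: linear_op_def complex_vector.scale_right_diff_distrib)
        then have "hnorm K (U s (c *\<^sub>C x) - U t (c *\<^sub>C x)) = cmod c * hnorm K (U s x - U t x)"
          using sS t scale.hyps by (simp add: K.hnorm_scaleC)
        also have "\<dots> \<le> (cmod c + 1) * hnorm K (U s x - U t x)"
          using sS t scale.hyps by (intro mult_right_mono) simp_all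
        also have "\<dots> < \<epsilon>"
          using N(3)[OF s] pos by (simp add: field_simps)
        finally show ?thesis .
      qed
      then show "\<exists>N. openin X N \<and> t \<in> N \<and> (\<forall>s\<in>N. hnorm K (U s (c *\<^sub>C x) - U t (c *\<^sub>C x)) < \<epsilon>)"
        using N by blast
    qed
  next
    case (limit f l)
    show ?case
      unfolding cont_def
    proof (intro ballI allI impI)
      fix t \<epsilon> assume t: "t \<in> S" and \<epsilon>: "(0::real) < \<epsilon>"
      \<comment> \<open>The usual three-term estimate; the approximation error is the same at all s
        and t because U preserves the norm.\<close>
      have "\<forall>\<^sub>F n in sequentially. hnorm K (f n - l) < \<epsilon> / 3"
        using limit.hyps(3) \<epsilon> by (intro order_tendstoD(2)) auto
      then obtain n where n: "hnorm K (f n - l) < \<epsilon> / 3"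
        by (auto simp: eventually_sequentially)
      have \<epsilon>3: "\<epsilon> / 3 > 0" using \<epsilon> by simp
      obtain N where N: "openin X N" "t \<in> N" "\<And>s. s \<in> N \<Longrightarrow> hnorm K (U s (f n) - U t (f n)) < \<epsilon> / 3"
        using contD[OF limit.IH[of n] t \<epsilon>3] by blast
      have "hnorm K (U s l - U t l) < \<epsilon>" if s: "s \<in> N" for s
      proof -
        have sS: "s \<in> S" using in_S N(1) s .
        have f: "f n \<in> hcarrier K" and l: "l \<in> hcarrier K" using limit.hyps by auto
        have near: "hnorm K (U r (f n) - U r l) = hnorm K (f n - l)" if "r \<in> S" for r
          using U_norm[OF that, of "f n - l"] U_diff[OF that f l] f l by simp
        have "hnorm K (U s l - U t l) \<le> hnorm K (U s l - U s (f n)) + hnorm K (U s (f n) - U t l)"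
          using sS t f l by (intro K.hnorm_triangle_diff) simp_all
        also have "hnorm K (U s (f n) - U t l) \<le> hnorm K (U s (f n) - U t (f n)) + hnorm K (U t (f n) - U t l)"
          using sS t f l by (intro K.hnorm_triangle_diff) simp_all
        finally show ?thesis
          using near[OF sS] near[OF t] n N(3)[OF s] K.hnorm_minus_commute[of "U s l" "U s (f n)"] sS f l
          by simp
      qed
      then show "\<exists>N. openin X N \<and> t \<in> N \<and> (\<forall>s\<in>N. hnorm K (U s l - U t l) < \<epsilon>)"
        using N by blast
    qed
  qed
  note cont = this
  show ?thesis
    unfolding strongly_continuous_def K.metric.continuous_map_to_metric
  proof (intro ballI allI impI)
    fix x t and \<epsilon> :: real assume x: "x \<in> hcarrier K" and t: "t \<in> topspace X" and \<epsilon>: "\<epsilon> > 0"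
    obtain N where N: "openin X N" "t \<in> N" "\<And>s. s \<in> N \<Longrightarrow> hnorm K (U s x - U t x) < \<epsilon>"
      using contD[OF cont[OF x] t[unfolded top] \<epsilon>] by blast
    have "U s x \<in> K.metric.mball (U t x) \<epsilon>" if "s \<in> N" for s
      using N(3)[OF that] in_S[OF N(1) that] t x K.hnorm_minus_commute[of "U s x" "U t x"]
      by (simp add: K.metric.in_mball hdist_def top)
    then show "\<exists>N. openin X N \<and> t \<in> N \<and> (\<forall>s\<in>N. U s x \<in> K.metric.mball (U t x) \<epsilon>)"
      using N by blast
  qed
qed

end

text \<open>Both families of generators have the Gram matrix determined by \<open>form\<close>, so
  one unitary matches them. Since a vector is determined by its inner products with a total family,
  the remaining identities are checked there.\<close>

theorem minimal_dilations_equivalent: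
  assumes "minimal_dilation \<Omega> \<S> S H T K U V" and "minimal_dilation \<Omega> \<S> S H T K' U' V'"
  shows "unitarily_equivalent_dilations S H K V U K' V' U'"
proof -
  interpret A: minimal_dilation \<Omega> \<S> S H T K U V by fact
  interpret B: minimal_dilation \<Omega> \<S> S H T K' U' V' by fact
  let ?I = "difference_group S \<times> hcarrier H"
  have Gram: "hinner K (A.generator p) (A.generator q) = hinner K' (B.generator p) (B.generator q)"
    if "p \<in> ?I" "q \<in> ?I" for p q
    using A.inner_generator[OF that] B.inner_generator[OF that] by simp
  have "\<exists>W. unitary_op K K' W \<and>
      (\<forall>x\<in>hcarrier K. \<forall>x'\<in>hcarrier K'.
        (\<forall>p\<in>?I. hinner K x (A.generator p) = hinner K' x' (B.generator p)) \<longrightarrow> W x = x') \<and>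
      (\<forall>x\<in>hcarrier K. \<forall>p\<in>?I. hinner K x (A.generator p) = hinner K' (W x) (B.generator p))"
    (is "\<exists>W. ?P W")
    using A.K.hilbert B.K.hilbert A.generator_mem B.generator_mem
      A.generator_total B.generator_total Gram by (rule Gram_unitary)
  then obtain W where W: "?P W" ..
  have unitary: "unitary_op K K' W"
    by (rule W[THEN conjunct1])
  have W_eqI: "W x = x'" if x: "x \<in> hcarrier K" "x' \<in> hcarrier K'"
    and inner: "\<And>p. p \<in> ?I \<Longrightarrow> hinner K x (A.generator p) = hinner K' x' (B.generator p)" for x x'
    by (rule W[THEN conjunct2, THEN conjunct1, THEN bspec, THEN bspec, THEN mp, OF x ballI]) (rule inner)
  have inner_W: "hinner K x (A.generator p) = hinner K' (W x) (B.generator p)"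
    if "x \<in> hcarrier K" "p \<in> ?I" for x p
    by (rule W[THEN conjunct2, THEN conjunct2, THEN bspec, THEN bspec, OF that])
  have W_mem: "W x \<in> hcarrier K'" if "x \<in> hcarrier K" for x
    using unitary that by (auto simp: unitary_op_def)
  have "W (V h) = V' h" if h: "h \<in> hcarrier H" for h
  proof (rule W_eqI)
    fix p assume p: "p \<in> ?I"
    have "(0, h) \<in> ?I" using h by simp
    from Gram[OF this p] show "hinner K (V h) (A.generator p) = hinner K' (V' h) (B.generator p)"
      using h by simp
  qed (use h in simp_all)
  moreover have "W (U s x) = U' s (W x)" if s: "s \<in> S" and x: "x \<in> hcarrier K" for s x
  proof (rule W_eqI)
    fix p assume p: "p \<in> ?I"
    obtain g h where gh: "p = (g, h)" "g \<in> difference_group S" "h \<in> hcarrier H"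
      using p by auto
    \<comment> \<open>\<open>U s\<close> is isometric and carries the generator at g - s to the one
      at g, so inner products of U s x with generators are inner products of x with translated
      generators, in either dilation.\<close>
    have q: "(g - s, h) \<in> ?I" using gh s by simp
    have "hinner K (U s x) (A.generator p) = hinner K x (A.generator (g - s, h))"
      using A.U_R[OF s, of "g - s" "V h"] A.U_inner[OF s x, of "A.R (g - s) (V h)"] gh s by simp
    also have "\<dots> = hinner K' (W x) (B.generator (g - s, h))"
      by (rule inner_W[OF x q])
    also have "\<dots> = hinner K' (U' s (W x)) (B.generator p)"
      using B.U_R[OF s, of "g - s" "V' h"] B.U_inner[OF s W_mem[OF x], of "B.R (g - s) (V' h)"] gh s by simp
    finally show "hinner K (U s x) (A.generator p) = hinner K' (U' s (W x)) (B.generator p)" .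
  qed (use s x W_mem in simp_all)
  ultimately show ?thesis
    using unitary unfolding unitarily_equivalent_dilations_def by blast
qed

section \<open>The function space of an operator-valued positive definite kernel\<close>

text \<open>\<open>\<kappa> i j h\<close> is the value at \<open>j\<close> of the function generated by \<open>h\<close> at \<open>i\<close>.  Finite combinations of
  such functions are given by lists of pairs \<open>(i, h)\<close>.\<close>

locale positive_definite_kernel = H: hspace H
  for H :: "'h::complex_vector hilbert" +
  fixes I :: "'g set" and \<kappa> :: "'g \<Rightarrow> 'g \<Rightarrow> 'h \<Rightarrow> 'h"
  assumes kernel_mem: "i \<in> I \<Longrightarrow> j \<in> I \<Longrightarrow> h \<in> hcarrier H \<Longrightarrow> \<kappa> i j h \<in> hcarrier H"
    and kernel_commute: "i \<in> I \<Longrightarrow> j \<in> I \<Longrightarrow> h \<in> hcarrier H \<Longrightarrow> k \<in> hcarrier H \<Longrightarrow>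
      hinner H (\<kappa> i j h) k = cnj (hinner H (\<kappa> j i k) h)"
    and kernel_positive: "(\<And>m::nat. m < n \<Longrightarrow> g m \<in> I) \<Longrightarrow> (\<And>m. m < n \<Longrightarrow> x m \<in> hcarrier H) \<Longrightarrow>
      0 \<le> Re (\<Sum>l<n. \<Sum>m<n. hinner H (\<kappa> (g l) (g m) (x l)) (x m))"
    and kernel_diag: "i \<in> I \<Longrightarrow> h \<in> hcarrier H \<Longrightarrow> \<kappa> i i h = h"
begin

declare plus_fun_apply [simp del] zero_fun_apply [simp del] minus_apply [simp del]

section \<open>Finite combinations of kernel functions and their pairing\<close>

abbreviation valid :: "('g \<times> 'h) list \<Rightarrow> bool" where
  "valid zs \<equiv> set zs \<subseteq> I \<times> hcarrier H"

text \<open>Values off I are pinned to 0, so functions that agree on I are equal; definiteness of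
  the norm relies on this.\<close>

definition hfuns :: "('g \<Rightarrow> 'h) set" where
  "hfuns = {f. (\<forall>i\<in>I. f i \<in> hcarrier H) \<and> (\<forall>i. i \<notin> I \<longrightarrow> f i = 0)}"

definition kf :: "('g \<times> 'h) list \<Rightarrow> 'g \<Rightarrow> 'h" where
  "kf ys j = (if j \<in> I then \<Sum>(i, h)\<leftarrow>ys. \<kappa> i j h else 0)"

text \<open>The reproducing property forces the inner product of f with \<open>kf zs\<close> to have
  this value. It is defined on lists, so nothing has to be checked when two lists give the same
  function.\<close>

definition pairing :: "('g \<Rightarrow> 'h) \<Rightarrow> ('g \<times> 'h) list \<Rightarrow> complex" where
  "pairing f zs = (\<Sum>(i, h)\<leftarrow>zs. hinner H (f i) h)"

definition scale :: "complex \<Rightarrow> ('g \<times> 'h) list \<Rightarrow> ('g \<times> 'h) list" where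
  "scale c zs = map (\<lambda>(i, h). (i, c *\<^sub>C h)) zs"

lemma hfunsD: "f \<in> hfuns \<Longrightarrow> i \<in> I \<Longrightarrow> f i \<in> hcarrier H"
  by (simp add: hfuns_def)

lemma hfuns_subspace: "csubspace hfuns"
  by (auto simp: complex_vector.subspace_def hfuns_def scaleC_fun_def plus_fun_apply zero_fun_apply)

lemmas hfuns_add = complex_vector.subspace_add[OF hfuns_subspace]
  and hfuns_diff = complex_vector.subspace_diff[OF hfuns_subspace]
  and hfuns_scaleC = complex_vector.subspace_scale[OF hfuns_subspace]

text \<open>Linearity of \<kappa> is not among the axioms: it follows from hermitian symmetry, just
  as an operator with an adjoint is linear.\<close>

lemma kernel_add:
  assumes i: "i \<in> I" "j \<in> I" and h: "h \<in> hcarrier H" "k \<in> hcarrier H"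
  shows "\<kappa> i j (h + k) = \<kappa> i j h + \<kappa> i j k"
proof -
  have "\<kappa> i j (h + k) - (\<kappa> i j h + \<kappa> i j k) = 0"
  proof (rule H.eq_zero_if_orthogonal)
    fix z assume z: "z \<in> hcarrier H"
    have "hinner H (\<kappa> i j (h + k)) z = hinner H (\<kappa> i j h) z + hinner H (\<kappa> i j k) z"
      using i h z kernel_mem[OF i(2,1) z]
      by (simp add: kernel_commute[OF i _ z] H.inner_add_right)
    then show "hinner H (\<kappa> i j (h + k) - (\<kappa> i j h + \<kappa> i j k)) z = 0"
      using i h z by (simp add: H.inner_diff_left H.inner_add_left kernel_mem)
  qed (use i h in \<open>simp add: kernel_mem\<close>)
  then show ?thesis by simp
qed

lemma kernel_scaleC:
  assumes i: "i \<in> I" "j \<in> I" and h: "h \<in> hcarrier H"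
  shows "\<kappa> i j (c *\<^sub>C h) = c *\<^sub>C \<kappa> i j h"
proof -
  have "\<kappa> i j (c *\<^sub>C h) - c *\<^sub>C \<kappa> i j h = 0"
  proof (rule H.eq_zero_if_orthogonal)
    fix z assume z: "z \<in> hcarrier H"
    have "hinner H (\<kappa> i j (c *\<^sub>C h)) z = c * hinner H (\<kappa> i j h) z"
      using i h z kernel_mem[OF i(2,1) z]
      by (simp add: kernel_commute[OF i _ z] H.inner_scaleC_right)
    then show "hinner H (\<kappa> i j (c *\<^sub>C h) - c *\<^sub>C \<kappa> i j h) z = 0"
      using i h z by (simp add: H.inner_diff_left H.inner_scaleC_left kernel_mem)
  qed (use i h in \<open>simp add: kernel_mem\<close>)
  then show ?thesis by simp
qed

lemma kf_Nil [simp]: "kf [] = 0"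
  by (simp add: kf_def fun_eq_iff zero_fun_apply)

lemma kf_append: "kf (xs @ ys) = kf xs + kf ys"
  by (simp add: kf_def fun_eq_iff plus_fun_apply)

lemma kf_Cons: "kf (p # ys) = kf [p] + kf ys"
  using kf_append[of "[p]" ys] by simp

lemma kf_mem: "valid ys \<Longrightarrow> kf ys \<in> hfuns"
proof (induction ys)
  case Nil
  then show ?case by (simp add: hfuns_def zero_fun_apply)
next
  case (Cons p ys)
  obtain i h where p: "p = (i, h)" "i \<in> I" "h \<in> hcarrier H"
    using Cons.prems by (cases p) auto
  then have "kf [p] \<in> hfuns"
    by (simp add: hfuns_def kf_def kernel_mem)
  moreover have "kf ys \<in> hfuns" using Cons by simp
  ultimately show ?case
    unfolding kf_Cons[of p ys] by (rule hfuns_add)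
qed

lemma kf_scale: "valid ys \<Longrightarrow> kf (scale c ys) = c *\<^sub>C kf ys"
proof (induction ys)
  case Nil
  then show ?case by (simp add: scale_def)
next
  case (Cons p ys)
  obtain i h where p: "p = (i, h)" "i \<in> I" "h \<in> hcarrier H"
    using Cons.prems by (cases p) auto
  then have "kf [(i, c *\<^sub>C h)] = c *\<^sub>C kf [p]"
    by (simp add: kf_def kernel_scaleC scaleC_fun_def fun_eq_iff)
  moreover have "kf (scale c ys) = c *\<^sub>C kf ys" using Cons by simp
  moreover have "scale c (p # ys) = (i, c *\<^sub>C h) # scale c ys"
    by (simp add: scale_def p)
  ultimately show ?case
    using kf_Cons[of "(i, c *\<^sub>C h)" "scale c ys"] kf_Cons[of p ys] by (simp add: scaleC_add_right)
qed

lemma valid_scale [simp]: "valid ys \<Longrightarrow> valid (scale c ys)"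
  by (auto simp: scale_def)

lemma pairing_Nil [simp]: "pairing f [] = 0"
  by (simp add: pairing_def)

lemma pairing_append: "pairing f (xs @ ys) = pairing f xs + pairing f ys"
  by (simp add: pairing_def)

lemma pairing_Cons: "pairing f ((i, h) # ys) = hinner H (f i) h + pairing f ys"
  by (simp add: pairing_def)

lemma pairing_scale: "f \<in> hfuns \<Longrightarrow> valid zs \<Longrightarrow> pairing f (scale c zs) = cnj c * pairing f zs"
  by (induction zs)
    (auto simp: scale_def pairing_Cons H.inner_scaleC_right hfunsD distrib_left)

lemma pairing_add:
  "f \<in> hfuns \<Longrightarrow> f' \<in> hfuns \<Longrightarrow> valid zs \<Longrightarrow> pairing (f + f') zs = pairing f zs + pairing f' zs"
  by (induction zs) (auto simp: pairing_Cons plus_fun_apply H.inner_add_left hfunsD)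

lemma pairing_diff:
  "f \<in> hfuns \<Longrightarrow> f' \<in> hfuns \<Longrightarrow> valid zs \<Longrightarrow> pairing (f - f') zs = pairing f zs - pairing f' zs"
  by (induction zs) (auto simp: pairing_Cons minus_apply H.inner_diff_left hfunsD)

lemma pairing_scaleC:
  "f \<in> hfuns \<Longrightarrow> valid zs \<Longrightarrow> pairing (c *\<^sub>C f) zs = c * pairing f zs"
  by (induction zs)
    (auto simp: pairing_Cons scaleC_fun_def H.inner_scaleC_left hfunsD distrib_left)

lemma pairing_zero: "valid zs \<Longrightarrow> pairing 0 zs = 0"
  by (induction zs) (auto simp: pairing_Cons zero_fun_apply)

lemma pairing_kf_commute:
  assumes xs: "valid xs" and ys: "valid ys"
  shows "pairing (kf xs) ys = cnj (pairing (kf ys) xs)"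
  using xs
proof (induction xs)
  case Nil
  then show ?case using ys by (simp add: pairing_zero)
next
  case (Cons p xs)
  obtain i h where p: "p = (i, h)" "i \<in> I" "h \<in> hcarrier H"
    using Cons.prems by (cases p) auto
  have p_valid: "valid [p]" and xs: "valid xs" using Cons.prems by auto
  have "pairing (kf [p]) ys = cnj (hinner H (kf ys i) h)"
    using ys
  proof (induction ys)
    case Nil
    then show ?case using p by (simp add: zero_fun_apply)
  next
    case (Cons q ys)
    obtain j k where q: "q = (j, k)" "j \<in> I" "k \<in> hcarrier H"
      using Cons.prems by (cases q) auto
    have ys: "valid ys" using Cons.prems by auto
    have "kf (q # ys) i = \<kappa> j i k + kf ys i"
      using p q by (simp add: kf_def)
    then have "hinner H (kf (q # ys) i) h = hinner H (\<kappa> j i k) h + hinner H (kf ys i) h"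
      using p q kernel_mem hfunsD[OF kf_mem[OF ys] p(2)] by (simp add: H.inner_add_left)
    moreover have "pairing (kf [p]) (q # ys) = hinner H (\<kappa> i j h) k + pairing (kf [p]) ys"
      using p q by (simp add: pairing_Cons kf_def)
    ultimately show ?case
      using Cons.IH[OF ys] kernel_commute[OF p(2) q(2) p(3) q(3)] by simp
  qed
  then show ?case
    using Cons.IH[OF xs] pairing_add[OF kf_mem[OF p_valid] kf_mem[OF xs] ys] kf_Cons[of p xs]
    by (simp add: p(1) pairing_Cons)
qed

lemma pairing_kf_positive:
  assumes "valid xs"
  shows "0 \<le> Re (pairing (kf xs) xs)"
proof -
  have mem: "fst (xs ! m) \<in> I" "snd (xs ! m) \<in> hcarrier H" if "m < length xs" for m
    using assms nth_mem[OF that] by (auto simp: mem_Times_iff)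
  have kf: "kf xs i = (\<Sum>l<length xs. \<kappa> (fst (xs ! l)) i (snd (xs ! l)))" if "i \<in> I" for i
    using that by (simp add: kf_def sum_list_sum_nth case_prod_beta atLeast0LessThan)
  have "pairing (kf xs) xs =
      (\<Sum>m<length xs. hinner H (kf xs (fst (xs ! m))) (snd (xs ! m)))"
    by (simp add: pairing_def sum_list_sum_nth case_prod_beta atLeast0LessThan)
  also have "\<dots> = (\<Sum>m<length xs. \<Sum>l<length xs.
      hinner H (\<kappa> (fst (xs ! l)) (fst (xs ! m)) (snd (xs ! l))) (snd (xs ! m)))"
  proof (rule sum.cong[OF refl])
    fix m assume "m \<in> {..<length xs}"
    then have m: "m < length xs" by simp
    show "hinner H (kf xs (fst (xs ! m))) (snd (xs ! m)) = (\<Sum>l<length xs.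
        hinner H (\<kappa> (fst (xs ! l)) (fst (xs ! m)) (snd (xs ! l))) (snd (xs ! m)))"
      unfolding kf[OF mem(1)[OF m]] using mem m by (intro H.inner_sum_left kernel_mem) auto
  qed
  also have "\<dots> = (\<Sum>l<length xs. \<Sum>m<length xs.
      hinner H (\<kappa> (fst (xs ! l)) (fst (xs ! m)) (snd (xs ! l))) (snd (xs ! m)))"
    by (rule sum.swap)
  also have "0 \<le> Re \<dots>"
    using mem kernel_positive[of "length xs" "\<lambda>m. fst (xs ! m)" "\<lambda>m. snd (xs ! m)"] by simp
  finally show ?thesis .
qed

definition nrm :: "('g \<times> 'h) list \<Rightarrow> real" where
  "nrm zs = sqrt (Re (pairing (kf zs) zs))"

lemma nrm_nonneg [simp]: "valid zs \<Longrightarrow> 0 \<le> nrm zs"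
  by (simp add: nrm_def pairing_kf_positive)

lemma nrm_square: "valid zs \<Longrightarrow> (nrm zs)\<^sup>2 = Re (pairing (kf zs) zs)"
  by (simp add: nrm_def pairing_kf_positive)

lemma pairing_kf_self: "valid zs \<Longrightarrow> pairing (kf zs) zs = of_real ((nrm zs)\<^sup>2)"
  using arg_cong[OF pairing_kf_commute[of zs zs], of Im] by (simp add: nrm_square complex_eq_iff)

text \<open>The list \<open>xs @ scale c ys\<close> plays the part of x + c y. The form on lists is
  only semidefinite, which is why the scalar lemma allows d = 0.\<close>

lemma pairing_Cauchy_Schwarz:
  assumes xs: "valid xs" and ys: "valid ys"
  shows "cmod (pairing (kf xs) ys) \<le> nrm xs * nrm ys"
proof -
  have "(cmod (pairing (kf ys) xs))\<^sup>2 \<le> (nrm xs)\<^sup>2 * (nrm ys)\<^sup>2"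
  proof (rule complex_quadratic_nonneg)
    fix c
    have v: "valid (scale c ys)" using ys by simp
    have cross: "pairing (kf xs) (scale c ys) = cnj (c * pairing (kf ys) xs)"
      using pairing_scale[OF kf_mem[OF xs] ys] pairing_kf_commute[OF xs ys] by simp
    have cross': "pairing (c *\<^sub>C kf ys) xs = c * pairing (kf ys) xs"
      by (rule pairing_scaleC[OF kf_mem[OF ys] xs])
    have diag: "pairing (c *\<^sub>C kf ys) (scale c ys) = of_real ((cmod c)\<^sup>2 * (nrm ys)\<^sup>2)"
    proof -
      have "pairing (c *\<^sub>C kf ys) (scale c ys) = (c * cnj c) * pairing (kf ys) ys"
        using pairing_scaleC[OF kf_mem[OF ys] v] pairing_scale[OF kf_mem[OF ys] ys] by simp
      then show ?thesis
        by (simp only: pairing_kf_self[OF ys] complex_norm_square[symmetric] of_real_mult)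
    qed
    have "0 \<le> Re (pairing (kf (xs @ scale c ys)) (xs @ scale c ys))"
      using xs v by (intro pairing_kf_positive) auto
    also have "pairing (kf (xs @ scale c ys)) (xs @ scale c ys) =
        pairing (kf xs) xs + pairing (kf xs) (scale c ys)
        + (pairing (c *\<^sub>C kf ys) xs + pairing (c *\<^sub>C kf ys) (scale c ys))"
      using xs ys v by (simp add: kf_append kf_scale pairing_append pairing_add kf_mem hfuns_scaleC)
    also have "Re \<dots> = (nrm xs)\<^sup>2 + 2 * Re (c * pairing (kf ys) xs) + (cmod c)\<^sup>2 * (nrm ys)\<^sup>2"
      unfolding cross cross' diag pairing_kf_self[OF xs]
      by (simp only: plus_complex.sel complex_cnj(1) cnj.sel Re_complex_of_real)
    finally show "0 \<le> (nrm xs)\<^sup>2 + 2 * Re (c * pairing (kf ys) xs) + (cmod c)\<^sup>2 * (nrm ys)\<^sup>2" .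
  qed simp
  then have "(cmod (pairing (kf xs) ys))\<^sup>2 \<le> (nrm xs * nrm ys)\<^sup>2"
    using pairing_kf_commute[OF xs ys] by (simp add: power_mult_distrib)
  then show ?thesis
    using xs ys by (simp add: power2_le_iff_abs_le)
qed

text \<open>\<open>bnd f c\<close> says that \<open>f\<close> is an element of norm at most \<open>c\<close> of the space to be constructed.\<close>

definition bnd :: "('g \<Rightarrow> 'h) \<Rightarrow> real \<Rightarrow> bool" where
  "bnd f c \<longleftrightarrow> (\<forall>zs. valid zs \<longrightarrow> cmod (pairing f zs) \<le> c * nrm zs)"

lemma bndD: "bnd f c \<Longrightarrow> valid zs \<Longrightarrow> cmod (pairing f zs) \<le> c * nrm zs"
  by (simp add: bnd_def)

lemma bnd_mono:
  assumes "bnd f a" "a \<le> b"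
  shows "bnd f b"
  unfolding bnd_def
proof (intro allI impI)
  fix zs assume zs: "valid zs"
  have "cmod (pairing f zs) \<le> a * nrm zs" using assms(1) zs by (rule bndD)
  also have "\<dots> \<le> b * nrm zs" using assms(2) zs by (intro mult_right_mono nrm_nonneg)
  finally show "cmod (pairing f zs) \<le> b * nrm zs" .
qed

lemma bnd_kf: "valid ys \<Longrightarrow> bnd (kf ys) (nrm ys)"
  by (simp add: bnd_def pairing_Cauchy_Schwarz)

lemma bnd_add:
  assumes "f \<in> hfuns" "f' \<in> hfuns" "bnd f a" "bnd f' b"
  shows "bnd (f + f') (a + b)"
  unfolding bnd_def
proof (intro allI impI)
  fix zs assume zs: "valid zs"
  have "cmod (pairing (f + f') zs) \<le> cmod (pairing f zs) + cmod (pairing f' zs)"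
    using assms zs by (simp add: pairing_add norm_triangle_ineq)
  also have "\<dots> \<le> (a + b) * nrm zs"
    using bndD[OF assms(3) zs] bndD[OF assms(4) zs] by (simp add: distrib_right)
  finally show "cmod (pairing (f + f') zs) \<le> (a + b) * nrm zs" .
qed

lemma bnd_scaleC:
  assumes "f \<in> hfuns" "bnd f a"
  shows "bnd (c *\<^sub>C f) (cmod c * a)"
  using assms by (auto simp: bnd_def pairing_scaleC norm_mult mult.assoc intro: mult_left_mono)

lemma bnd_minus_commute:
  assumes "f \<in> hfuns" "f' \<in> hfuns" "bnd (f - f') a"
  shows "bnd (f' - f) a"
  using assms by (simp add: bnd_def pairing_diff norm_minus_commute)

lemma bnd_triangle:
  assumes "f \<in> hfuns" "f' \<in> hfuns" "f'' \<in> hfuns" "bnd (f - f') a" "bnd (f' - f'') b"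
  shows "bnd (f - f'') (a + b)"
  using bnd_add[OF hfuns_diff[OF assms(1,2)] hfuns_diff[OF assms(2,3)] assms(4,5)] by simp

lemma nrm_le:
  assumes ys: "valid ys" and b: "bnd (kf ys) a" and a: "0 \<le> a"
  shows "nrm ys \<le> a"
proof (cases "nrm ys = 0")
  case False
  then have pos: "nrm ys > 0" using nrm_nonneg[OF ys] by simp
  have "nrm ys * nrm ys \<le> a * nrm ys"
    using bndD[OF b ys] unfolding pairing_kf_self[OF ys] norm_of_real by (simp add: power2_eq_square)
  then show ?thesis using pos by simp
qed (use a in simp)

text \<open>The completion taken inside the functions: limits of combinations \<open>kf ys\<close>
  in the norm that \<open>bnd\<close> expresses. Totality of the generators is thereby built in,
  while completeness has to be proved.\<close>

definition rk_carrier :: "('g \<Rightarrow> 'h) set" where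
  "rk_carrier = {f \<in> hfuns. \<forall>\<epsilon>>0. \<exists>ys. valid ys \<and> bnd (f - kf ys) \<epsilon>}"

lemma rk_hfuns: "f \<in> rk_carrier \<Longrightarrow> f \<in> hfuns"
  by (simp add: rk_carrier_def)

lemma kf_rk: "valid ys \<Longrightarrow> kf ys \<in> rk_carrier"
  unfolding rk_carrier_def using kf_mem
  by (auto simp: bnd_def pairing_zero intro!: exI[of _ ys])

lemma rk_bounded:
  assumes "f \<in> rk_carrier"
  shows "\<exists>a\<ge>0. bnd f a"
proof -
  obtain ys where ys: "valid ys" "bnd (f - kf ys) 1"
    using assms zero_less_one unfolding rk_carrier_def by blast
  have "bnd ((f - kf ys) + kf ys) (1 + nrm ys)"
    using ys assms rk_hfuns by (intro bnd_add bnd_kf hfuns_diff kf_mem)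
  moreover have "0 \<le> 1 + nrm ys" using ys nrm_nonneg by (simp add: add_nonneg_nonneg)
  ultimately show ?thesis by auto
qed

lemma rk_subspace: "csubspace rk_carrier"
  unfolding complex_vector.subspace_def
proof (intro conjI ballI allI)
  show "0 \<in> rk_carrier" using kf_rk[of "[]"] by simp
next
  fix f f' assume f: "f \<in> rk_carrier" and f': "f' \<in> rk_carrier"
  show "f + f' \<in> rk_carrier"
    unfolding rk_carrier_def
  proof (intro CollectI conjI allI impI)
    show "f + f' \<in> hfuns" using f f' rk_hfuns hfuns_add by blast
    fix \<epsilon> :: real assume "\<epsilon> > 0"
    then have half: "\<epsilon> / 2 > 0" by simp
    obtain xs where xs: "valid xs" "bnd (f - kf xs) (\<epsilon> / 2)"
      using f half unfolding rk_carrier_def by blast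
    obtain ys where ys: "valid ys" "bnd (f' - kf ys) (\<epsilon> / 2)"
      using f' half unfolding rk_carrier_def by blast
    have "bnd ((f - kf xs) + (f' - kf ys)) (\<epsilon> / 2 + \<epsilon> / 2)"
      using xs ys f f' rk_hfuns by (intro bnd_add hfuns_diff kf_mem)
    moreover have "(f - kf xs) + (f' - kf ys) = f + f' - kf (xs @ ys)"
      by (simp add: kf_append algebra_simps)
    ultimately show "\<exists>zs. valid zs \<and> bnd (f + f' - kf zs) \<epsilon>"
      using xs ys by (intro exI[of _ "xs @ ys"]) simp
  qed
next
  fix c f assume f: "f \<in> rk_carrier"
  show "c *\<^sub>C f \<in> rk_carrier"
    unfolding rk_carrier_def
  proof (intro CollectI conjI allI impI)
    show "c *\<^sub>C f \<in> hfuns" using f rk_hfuns hfuns_scaleC by blast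
    fix \<epsilon> :: real assume \<epsilon>: "\<epsilon> > 0"
    have pos: "cmod c + 1 > 0" by (simp add: add_nonneg_pos)
    obtain xs where xs: "valid xs" "bnd (f - kf xs) (\<epsilon> / (cmod c + 1))"
      using f divide_pos_pos[OF \<epsilon> pos] unfolding rk_carrier_def by blast
    have "bnd (c *\<^sub>C (f - kf xs)) (cmod c * (\<epsilon> / (cmod c + 1)))"
      using xs f rk_hfuns by (intro bnd_scaleC hfuns_diff kf_mem)
    moreover have "cmod c * (\<epsilon> / (cmod c + 1)) \<le> \<epsilon>"
      using \<epsilon> pos by (simp add: field_simps)
    moreover have "c *\<^sub>C (f - kf xs) = c *\<^sub>C f - kf (scale c xs)"
      using xs by (simp add: kf_scale complex_vector.scale_right_diff_distrib)
    ultimately show "\<exists>zs. valid zs \<and> bnd (c *\<^sub>C f - kf zs) \<epsilon>"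
      using xs bnd_mono by (intro exI[of _ "scale c xs"]) auto
  qed
qed

text \<open>One fixed approximating sequence with an explicit rate. That the inner product defined
  through it is independent of this choice is the content of \<open>rk_inner_approx\<close>.\<close>

definition appr :: "('g \<Rightarrow> 'h) \<Rightarrow> nat \<Rightarrow> ('g \<times> 'h) list" where
  "appr f n = (SOME ys. valid ys \<and> bnd (f - kf ys) (1 / real (Suc n)))"

lemma appr:
  assumes "f \<in> rk_carrier"
  shows "valid (appr f n)" "bnd (f - kf (appr f n)) (1 / real (Suc n))"
proof -
  have "1 / real (Suc n) > 0" by simp
  then have "\<exists>ys. valid ys \<and> bnd (f - kf ys) (1 / real (Suc n))"
    using assms unfolding rk_carrier_def by blast
  from someI_ex[OF this] show "valid (appr f n)" "bnd (f - kf (appr f n)) (1 / real (Suc n))"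
    unfolding appr_def by auto
qed

definition rk_inner :: "('g \<Rightarrow> 'h) \<Rightarrow> ('g \<Rightarrow> 'h) \<Rightarrow> complex" where
  "rk_inner f f' = lim (\<lambda>n. pairing f (appr f' n))"

text \<open>The list appending the (-1)-multiple of ys to xs represents the difference of two
  approximants of f', so its norm is at most \<delta> + \<epsilon>, and \<open>bnd f a\<close>
  applies to it.\<close>

lemma pairing_diff_le:
  assumes f: "f \<in> hfuns" "bnd f a" "0 \<le> a" and f': "f' \<in> hfuns"
    and xs: "valid xs" "bnd (f' - kf xs) \<delta>" and ys: "valid ys" "bnd (f' - kf ys) \<epsilon>"
    and pos: "0 \<le> \<delta>" "0 \<le> \<epsilon>"
  shows "cmod (pairing f xs - pairing f ys) \<le> a * (\<delta> + \<epsilon>)"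
proof -
  let ?w = "xs @ scale (- 1) ys"
  have w: "valid ?w" using xs ys by simp
  have "kf ?w = kf xs - kf ys"
    using ys by (simp add: kf_append kf_scale complex_vector.scale_minus_left scaleC_one)
  moreover have "bnd (kf xs - kf ys) (\<delta> + \<epsilon>)"
    using xs ys f' by (intro bnd_triangle[of _ f'] bnd_minus_commute[of f' "kf xs"] kf_mem) auto
  ultimately have "nrm ?w \<le> \<delta> + \<epsilon>"
    using w pos by (intro nrm_le) auto
  then have "a * nrm ?w \<le> a * (\<delta> + \<epsilon>)"
    using f(3) by (rule mult_left_mono)
  moreover have "pairing f ?w = pairing f xs - pairing f ys"
    using pairing_scale[OF f(1) ys(1)] by (simp add: pairing_append)
  ultimately show ?thesis
    using bndD[OF f(2) w] by simp
qed

lemma rk_inner_lim: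
  assumes f: "f \<in> rk_carrier" and f': "f' \<in> rk_carrier"
  shows "(\<lambda>n. pairing f (appr f' n)) \<longlonglongrightarrow> rk_inner f f'"
proof -
  obtain a where a: "0 \<le> a" "bnd f a" using rk_bounded[OF f] by blast
  have diff: "cmod (pairing f (appr f' m) - pairing f (appr f' n)) \<le> a * (1 / real (Suc m) + 1 / real (Suc n))"
    for m n
    using f f' a appr[OF f'] rk_hfuns by (intro pairing_diff_le[of f a f']) auto
  have "Cauchy (\<lambda>n. pairing f (appr f' n))"
  proof (rule CauchyI)
    fix e :: real assume "0 < e"
    \<comment> \<open>The added 1 keeps the divisor positive when a = 0.\<close>
    moreover have pos: "2 * a + 1 > 0" using a by simp
    ultimately obtain N where N: "1 / real (Suc N) < e / (2 * a + 1)"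
      using nat_approx_posE[of "e / (2 * a + 1)"] by auto
    have "norm (pairing f (appr f' m) - pairing f (appr f' n)) < e" if "m \<ge> N" "n \<ge> N" for m n
    proof -
      have "1 / real (Suc m) \<le> 1 / real (Suc N)" "1 / real (Suc n) \<le> 1 / real (Suc N)"
        using that by (auto intro!: divide_left_mono)
      then have "a * (1 / real (Suc m) + 1 / real (Suc n)) \<le> a * (1 / real (Suc N) + 1 / real (Suc N))"
        using a by (intro mult_left_mono add_mono)
      also have "\<dots> = 2 * a * (1 / real (Suc N))" by simp
      also have "\<dots> \<le> (2 * a + 1) * (1 / real (Suc N))"
        by (intro mult_right_mono) auto
      also have "\<dots> < e"
        using N pos by (simp add: pos_less_divide_eq mult.commute)
      finally show ?thesis using diff[of m n] by simp
    qed
    then show "\<exists>N. \<forall>m\<ge>N. \<forall>n\<ge>N. norm (pairing f (appr f' m) - pairing f (appr f' n)) < e" by blast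
  qed
  then show ?thesis
    unfolding rk_inner_def by (intro convergent_LIMSEQ_iff[THEN iffD1] Cauchy_convergent)
qed

lemma one_over_Suc_lim: "(\<lambda>n. 1 / real (Suc n)) \<longlonglongrightarrow> 0"
  by (rule LIMSEQ_Suc[OF lim_1_over_n])

text \<open>Any list close to f' computes the inner product up to a controlled error. With error 0
  this is the reproducing property.\<close>

lemma rk_inner_approx:
  assumes f: "f \<in> rk_carrier" "bnd f a" "0 \<le> a" and f': "f' \<in> rk_carrier"
    and ys: "valid ys" "bnd (f' - kf ys) \<delta>" "0 \<le> \<delta>"
  shows "cmod (pairing f ys - rk_inner f f') \<le> a * \<delta>"
proof (rule LIMSEQ_le)
  show "(\<lambda>n. cmod (pairing f ys - pairing f (appr f' n))) \<longlonglongrightarrow> cmod (pairing f ys - rk_inner f f')"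
    by (intro tendsto_intros rk_inner_lim f f')
  have "(\<lambda>n. a * (\<delta> + 1 / real (Suc n))) \<longlonglongrightarrow> a * (\<delta> + 0)"
    by (intro tendsto_mult tendsto_add tendsto_const one_over_Suc_lim)
  then show "(\<lambda>n. a * (\<delta> + 1 / real (Suc n))) \<longlonglongrightarrow> a * \<delta>" by simp
  show "\<exists>N. \<forall>n\<ge>N. cmod (pairing f ys - pairing f (appr f' n)) \<le> a * (\<delta> + 1 / real (Suc n))"
    using f f' ys appr[OF f'] rk_hfuns by (intro exI allI impI pairing_diff_le[of f a f']) auto
qed

lemma rk_inner_kf:
  assumes f: "f \<in> rk_carrier" and ys: "valid ys"
  shows "rk_inner f (kf ys) = pairing f ys"
proof -
  obtain a where a: "0 \<le> a" "bnd f a" using rk_bounded[OF f] by blast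
  have "bnd (kf ys - kf ys) 0" by (simp add: bnd_def pairing_zero)
  then have "cmod (pairing f ys - rk_inner f (kf ys)) \<le> a * 0"
    using f a ys by (intro rk_inner_approx kf_rk) auto
  then show ?thesis by simp
qed

lemma rk_inner_add_left:
  assumes "f \<in> rk_carrier" "f' \<in> rk_carrier" "k \<in> rk_carrier"
  shows "rk_inner (f + f') k = rk_inner f k + rk_inner f' k"
proof -
  have "(\<lambda>n. pairing f (appr k n) + pairing f' (appr k n)) \<longlonglongrightarrow> rk_inner f k + rk_inner f' k"
    using assms by (intro tendsto_add rk_inner_lim)
  moreover have "pairing (f + f') (appr k n) = pairing f (appr k n) + pairing f' (appr k n)" for n
    using assms appr rk_hfuns by (simp add: pairing_add)
  moreover have "(\<lambda>n. pairing (f + f') (appr k n)) \<longlonglongrightarrow> rk_inner (f + f') k"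
    using assms complex_vector.subspace_add[OF rk_subspace] by (intro rk_inner_lim)
  ultimately show ?thesis by (simp add: LIMSEQ_unique)
qed

lemma rk_inner_scaleC_left:
  assumes "f \<in> rk_carrier" "k \<in> rk_carrier"
  shows "rk_inner (c *\<^sub>C f) k = c * rk_inner f k"
proof -
  have "(\<lambda>n. c * pairing f (appr k n)) \<longlonglongrightarrow> c * rk_inner f k"
    using assms by (intro tendsto_mult_left rk_inner_lim)
  moreover have "pairing (c *\<^sub>C f) (appr k n) = c * pairing f (appr k n)" for n
    using assms appr rk_hfuns by (simp add: pairing_scaleC)
  moreover have "(\<lambda>n. pairing (c *\<^sub>C f) (appr k n)) \<longlonglongrightarrow> rk_inner (c *\<^sub>C f) k"
    using assms complex_vector.subspace_scale[OF rk_subspace] by (intro rk_inner_lim)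
  ultimately show ?thesis by (simp add: LIMSEQ_unique)
qed

text \<open>With both arguments approximated, hermitian symmetry and positivity descend from the
  form on lists. The approximants of f' are bounded in norm, so replacing f by its approximants
  costs an error tending to 0.\<close>

lemma rk_inner_lim_kf:
  assumes f: "f \<in> rk_carrier" and f': "f' \<in> rk_carrier"
  shows "(\<lambda>n. pairing (kf (appr f n)) (appr f' n)) \<longlonglongrightarrow> rk_inner f f'"
proof -
  obtain a where a: "0 \<le> a" "bnd f' a" using rk_bounded[OF f'] by blast
  have nrm_le': "nrm (appr f' n) \<le> 1 + a" for n
  proof (rule nrm_le)
    have "bnd ((kf (appr f' n) - f') + f') (1 / real (Suc n) + a)"
      using appr[OF f'] f' a rk_hfuns kf_mem
      by (intro bnd_add hfuns_diff bnd_minus_commute[of f']) auto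
    then have "bnd (kf (appr f' n)) (1 / real (Suc n) + a)" by simp
    then show "bnd (kf (appr f' n)) (1 + a)"
      by (rule bnd_mono) simp
  qed (use a appr[OF f'] in auto)
  have "(\<lambda>n. pairing f (appr f' n) - pairing (kf (appr f n)) (appr f' n)) \<longlonglongrightarrow> 0"
  proof (rule Lim_null_comparison)
    have "cmod (pairing f (appr f' n) - pairing (kf (appr f n)) (appr f' n)) \<le> 1 / real (Suc n) * (1 + a)" for n
    proof -
      have "cmod (pairing (f - kf (appr f n)) (appr f' n)) \<le> 1 / real (Suc n) * nrm (appr f' n)"
        using appr[OF f] appr[OF f'] by (intro bndD)
      also have "\<dots> \<le> 1 / real (Suc n) * (1 + a)"
        using nrm_le' by (intro mult_left_mono) auto
      finally show ?thesis
        using appr(1)[OF f] appr(1)[OF f'] f rk_hfuns kf_mem by (simp add: pairing_diff)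
    qed
    then show "\<forall>\<^sub>F n in sequentially. cmod (pairing f (appr f' n) - pairing (kf (appr f n)) (appr f' n))
        \<le> 1 / real (Suc n) * (1 + a)"
      by simp
    show "(\<lambda>n. 1 / real (Suc n) * (1 + a)) \<longlonglongrightarrow> 0"
      using tendsto_mult_right[OF one_over_Suc_lim, of "1 + a"] by simp
  qed
  from tendsto_diff[OF rk_inner_lim[OF f f'] this] show ?thesis by simp
qed

lemma rk_inner_commute:
  assumes "f \<in> rk_carrier" "f' \<in> rk_carrier"
  shows "rk_inner f' f = cnj (rk_inner f f')"
proof -
  have "(\<lambda>n. cnj (pairing (kf (appr f n)) (appr f' n))) \<longlonglongrightarrow> cnj (rk_inner f f')"
    using assms by (intro tendsto_cnj rk_inner_lim_kf)
  moreover have "cnj (pairing (kf (appr f n)) (appr f' n)) = pairing (kf (appr f' n)) (appr f n)" for n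
    using assms appr(1) by (intro pairing_kf_commute[symmetric])
  ultimately have "(\<lambda>n. pairing (kf (appr f' n)) (appr f n)) \<longlonglongrightarrow> cnj (rk_inner f f')" by simp
  then show ?thesis
    using rk_inner_lim_kf[OF assms(2,1)] LIMSEQ_unique by blast
qed

lemma nrm_appr_lim:
  assumes "f \<in> rk_carrier"
  shows "(\<lambda>n. (nrm (appr f n))\<^sup>2) \<longlonglongrightarrow> Re (rk_inner f f)"
  using tendsto_Re[OF rk_inner_lim_kf[OF assms assms]] appr(1)[OF assms] by (simp add: nrm_square)

lemma rk_inner_self_nonneg:
  assumes "f \<in> rk_carrier"
  shows "rk_inner f f \<in> \<real>\<^sub>\<ge>\<^sub>0"
proof -
  have "0 \<le> Re (rk_inner f f)"
    using nrm_appr_lim[OF assms] by (rule LIMSEQ_le_const) auto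
  moreover have "Im (rk_inner f f) = 0"
    using arg_cong[OF rk_inner_commute[OF assms assms], of Im] by simp
  ultimately show ?thesis by (simp add: complex_nonneg_Reals_iff)
qed

section \<open>Norm, definiteness and completeness of the kernel space\<close>

definition rk_space :: "('g \<Rightarrow> 'h) hilbert" where
  "rk_space = \<lparr>hcarrier = rk_carrier, hinner = rk_inner\<rparr>"

lemma rk_space_sel [simp]: "hcarrier rk_space = rk_carrier" "hinner rk_space = rk_inner"
  by (simp_all add: rk_space_def)

text \<open>Together with \<open>hnorm_le_if_bnd\<close> this makes the norm of f the least
  nonnegative c with \<open>bnd f c\<close>, so that norm estimates reduce to pairings with
  lists.\<close>

lemma bnd_hnorm:
  assumes f: "f \<in> rk_carrier"
  shows "bnd f (hnorm rk_space f)"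
  unfolding bnd_def
proof (intro allI impI)
  fix zs assume zs: "valid zs"
  show "cmod (pairing f zs) \<le> hnorm rk_space f * nrm zs"
  proof (rule LIMSEQ_le)
    have "(\<lambda>n. pairing f zs - pairing (kf (appr f n)) zs) \<longlonglongrightarrow> 0"
    proof (rule Lim_null_comparison)
      have "cmod (pairing f zs - pairing (kf (appr f n)) zs) \<le> 1 / real (Suc n) * nrm zs" for n
        using bndD[OF appr(2)[OF f] zs, of n] appr(1)[OF f] f rk_hfuns kf_mem zs
        by (simp add: pairing_diff)
      then show "\<forall>\<^sub>F n in sequentially. cmod (pairing f zs - pairing (kf (appr f n)) zs)
          \<le> 1 / real (Suc n) * nrm zs"
        by simp
      show "(\<lambda>n. 1 / real (Suc n) * nrm zs) \<longlonglongrightarrow> 0"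
        using tendsto_mult_right[OF one_over_Suc_lim, of "nrm zs"] by simp
    qed
    from tendsto_diff[OF tendsto_const[of "pairing f zs"] this]
    show "(\<lambda>n. cmod (pairing (kf (appr f n)) zs)) \<longlonglongrightarrow> cmod (pairing f zs)"
      by (intro tendsto_norm) simp
    have "(\<lambda>n. sqrt ((nrm (appr f n))\<^sup>2)) \<longlonglongrightarrow> hnorm rk_space f"
      unfolding hnorm_def rk_space_sel by (intro tendsto_real_sqrt nrm_appr_lim f)
    then have "(\<lambda>n. nrm (appr f n)) \<longlonglongrightarrow> hnorm rk_space f"
      using appr(1)[OF f] by simp
    then show "(\<lambda>n. nrm (appr f n) * nrm zs) \<longlonglongrightarrow> hnorm rk_space f * nrm zs"
      by (rule tendsto_mult_right)
    show "\<exists>N. \<forall>n\<ge>N. cmod (pairing (kf (appr f n)) zs) \<le> nrm (appr f n) * nrm zs"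
      using pairing_Cauchy_Schwarz[OF appr(1)[OF f] zs] by blast
  qed
qed

text \<open>Pairing f with the single entry (i, f i) gives |f i|^2, so a function of norm 0 vanishes
  at every point.\<close>

lemma bnd_0_imp_0:
  assumes f: "f \<in> hfuns" and b: "bnd f 0"
  shows "f = 0"
proof
  fix i
  show "f i = 0 i"
  proof (cases "i \<in> I")
    case True
    have "pairing f [(i, f i)] = 0"
      using bndD[OF b, of "[(i, f i)]"] hfunsD[OF f True] True by simp
    then show ?thesis
      using hfunsD[OF f True] H.inner_definite[of "f i"] by (simp add: pairing_def zero_fun_apply)
  next
    case False
    then show ?thesis using f by (simp add: hfuns_def zero_fun_apply)
  qed
qed

sublocale rk: inner_space rk_space
proof
  show "csubspace (hcarrier rk_space)" by (simp add: rk_subspace)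
  fix x y z c
  assume x: "x \<in> hcarrier rk_space"
  show "hinner rk_space x x \<in> \<real>\<^sub>\<ge>\<^sub>0" using x by (simp add: rk_inner_self_nonneg)
  show "x = 0" if "hinner rk_space x x = 0"
    using bnd_hnorm[of x] x that by (intro bnd_0_imp_0) (simp_all add: hnorm_def rk_hfuns)
  assume y: "y \<in> hcarrier rk_space"
  show "hinner rk_space (c *\<^sub>C x) y = c * hinner rk_space x y"
    using x y by (simp add: rk_inner_scaleC_left)
  show "hinner rk_space y x = cnj (hinner rk_space x y)"
    unfolding rk_space_sel using x y by (intro rk_inner_commute) simp_all
  show "hinner rk_space (x + y) z = hinner rk_space x z + hinner rk_space y z"
    if "z \<in> hcarrier rk_space"
    using x y that by (simp add: rk_inner_add_left)
qed

text \<open>The squared norm is the limit of the pairings of f with its own approximants, whose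
  norms tend to that of f; one factor of the norm then cancels.\<close>

lemma hnorm_le_if_bnd:
  assumes f: "f \<in> rk_carrier" and b: "bnd f a" "0 \<le> a"
  shows "hnorm rk_space f \<le> a"
proof -
  have "(hnorm rk_space f)\<^sup>2 \<le> a * hnorm rk_space f"
  proof (rule LIMSEQ_le)
    show "(\<lambda>n. cmod (pairing f (appr f n))) \<longlonglongrightarrow> (hnorm rk_space f)\<^sup>2"
    proof -
      have "cmod (rk_inner f f) = (hnorm rk_space f)\<^sup>2"
        using rk.inner_self[of f] f by (simp add: norm_power)
      then show ?thesis
        using tendsto_norm[OF rk_inner_lim[OF f f]] by simp
    qed
    have "(\<lambda>n. sqrt ((nrm (appr f n))\<^sup>2)) \<longlonglongrightarrow> hnorm rk_space f"
      unfolding hnorm_def rk_space_sel by (intro tendsto_real_sqrt nrm_appr_lim f)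
    then have "(\<lambda>n. nrm (appr f n)) \<longlonglongrightarrow> hnorm rk_space f"
      using appr(1)[OF f] by simp
    then show "(\<lambda>n. a * nrm (appr f n)) \<longlonglongrightarrow> a * hnorm rk_space f"
      by (rule tendsto_mult_left)
    show "\<exists>N. \<forall>n\<ge>N. cmod (pairing f (appr f n)) \<le> a * nrm (appr f n)"
      using bndD[OF b(1) appr(1)[OF f]] by blast
  qed
  moreover have "0 \<le> hnorm rk_space f" using f by simp
  ultimately show ?thesis
    using b(2) by (cases "hnorm rk_space f = 0") (simp_all add: power2_eq_square)
qed

text \<open>The kernel is the identity on the diagonal, so the entry (i, f i) has norm |f i|, and
  Cauchy-Schwarz makes evaluation a contraction.\<close>

lemma hnorm_evaluation:
  assumes f: "f \<in> rk_carrier" and i: "i \<in> I"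
  shows "hnorm H (f i) \<le> hnorm rk_space f"
proof -
  have fi: "f i \<in> hcarrier H" using f i rk_hfuns hfunsD by blast
  have "nrm [(i, f i)] = hnorm H (f i)"
    using i fi by (simp add: nrm_def pairing_def kf_def kernel_diag hnorm_def)
  moreover have "pairing f [(i, f i)] = of_real ((hnorm H (f i))\<^sup>2)"
    using H.inner_self[OF fi] by (simp add: pairing_def)
  ultimately have "hnorm H (f i) * hnorm H (f i) \<le> hnorm rk_space f * hnorm H (f i)"
    using bndD[OF bnd_hnorm[OF f], of "[(i, f i)]"] i fi by (simp add: norm_mult power2_eq_square)
  then show ?thesis
    using H.hnorm_ge_0[OF fi] rk.hnorm_ge_0[of f] f
    by (cases "hnorm H (f i) = 0") auto
qed

text \<open>A Cauchy sequence converges pointwise because evaluations are contractions. A pairing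
  involves finitely many points, so the Cauchy estimates pass to the pointwise limit and yield
  convergence in norm.\<close>

lemma rk_hilbert: "hilbert_space rk_space"
proof (rule rk.hilbert_spaceI)
  fix f :: "nat \<Rightarrow> 'g \<Rightarrow> 'h"
  assume "\<And>n. f n \<in> hcarrier rk_space"
    and Cauchy: "\<And>e. e > 0 \<Longrightarrow> \<exists>N. \<forall>m\<ge>N. \<forall>n\<ge>N. hnorm rk_space (f m - f n) < e"
  then have f: "f n \<in> rk_carrier" for n by simp
  have diff: "f m - f n \<in> rk_carrier" for m n
    using f complex_vector.subspace_diff[OF rk_subspace] by blast
  have fi: "f n i \<in> hcarrier H" if "i \<in> I" for n i
    using f that rk_hfuns hfunsD by blast
  have "\<exists>l. l \<in> hcarrier H \<and> (\<lambda>n. hnorm H (f n i - l)) \<longlonglongrightarrow> 0" if i: "i \<in> I" for i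
  proof -
    have "\<exists>N. \<forall>m\<ge>N. \<forall>n\<ge>N. hnorm H (f m i - f n i) < e" if "e > 0" for e
      using Cauchy[OF that] hnorm_evaluation[OF diff i] by (metis minus_apply order_le_less_trans)
    with fi[OF i] have "\<exists>l\<in>hcarrier H. (\<lambda>n. hnorm H (f n i - l)) \<longlonglongrightarrow> 0"
      by (rule H.convergent_if_Cauchy)
    then show ?thesis by blast
  qed
  then obtain l0 where l0: "\<And>i. i \<in> I \<Longrightarrow> l0 i \<in> hcarrier H"
    "\<And>i. i \<in> I \<Longrightarrow> (\<lambda>n. hnorm H (f n i - l0 i)) \<longlonglongrightarrow> 0"
    by metis
  define l where "l i = (if i \<in> I then l0 i else 0)" for i
  have l: "l \<in> hfuns" using l0 by (simp add: hfuns_def l_def)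
  have pairing_lim: "(\<lambda>n. pairing (f n) zs) \<longlonglongrightarrow> pairing l zs" if "valid zs" for zs
    using that
  proof (induction zs)
    case (Cons p zs)
    then obtain i h where p: "p = (i, h)" "i \<in> I" "h \<in> hcarrier H" by (cases p) auto
    have "(\<lambda>n. hinner H (f n i) h) \<longlonglongrightarrow> hinner H (l i) h"
      using l0 fi p by (intro H.tendsto_inner_left) (auto simp: l_def)
    then show ?case
      using Cons p by (simp add: pairing_Cons tendsto_add)
  qed simp
  have bnd_lim: "\<exists>N. \<forall>m\<ge>N. bnd (f m - l) e" if e: "e > 0" for e
  proof -
    obtain N where N: "\<And>m n. m \<ge> N \<Longrightarrow> n \<ge> N \<Longrightarrow> hnorm rk_space (f m - f n) < e"
      using Cauchy[OF e] by blast
    have "bnd (f m - l) e" if m: "m \<ge> N" for m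
      unfolding bnd_def
    proof (intro allI impI)
      fix zs assume zs: "valid zs"
      have "(\<lambda>n. cmod (pairing (f m) zs - pairing (f n) zs)) \<longlonglongrightarrow> cmod (pairing (f m) zs - pairing l zs)"
        by (intro tendsto_intros pairing_lim zs)
      moreover have "\<forall>n\<ge>N. cmod (pairing (f m) zs - pairing (f n) zs) \<le> e * nrm zs"
      proof (intro allI impI)
        fix n assume "n \<ge> N"
        then have "bnd (f m - f n) e"
          using bnd_mono[OF bnd_hnorm[OF diff]] N[OF m] by (simp add: less_imp_le)
        then show "cmod (pairing (f m) zs - pairing (f n) zs) \<le> e * nrm zs"
          using bndD[OF _ zs] pairing_diff[OF rk_hfuns[OF f] rk_hfuns[OF f] zs] by metis
      qed
      ultimately have "cmod (pairing (f m) zs - pairing l zs) \<le> e * nrm zs"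
        by (intro LIMSEQ_le_const2) auto
      then show "cmod (pairing (f m - l) zs) \<le> e * nrm zs"
        using pairing_diff[OF rk_hfuns[OF f] l zs] by simp
    qed
    then show ?thesis by blast
  qed
  have l_rk: "l \<in> rk_carrier"
    unfolding rk_carrier_def
  proof (intro CollectI conjI allI impI l)
    fix e :: real assume "e > 0"
    then have half: "e / 2 > 0" by simp
    obtain m where m: "bnd (f m - l) (e / 2)" using bnd_lim[OF half] by blast
    obtain ys where ys: "valid ys" "bnd (f m - kf ys) (e / 2)"
      using f[of m] half unfolding rk_carrier_def by blast
    have "bnd (l - kf ys) (e / 2 + e / 2)"
      using bnd_minus_commute[OF rk_hfuns[OF f] l m] ys(2)
      by (rule bnd_triangle[OF l rk_hfuns[OF f] kf_mem[OF ys(1)]])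
    then show "\<exists>ys. valid ys \<and> bnd (l - kf ys) e" using ys(1) by auto
  qed
  have "(\<lambda>n. hnorm rk_space (f n - l)) \<longlonglongrightarrow> 0"
  proof (rule LIMSEQ_I)
    fix r :: real assume "r > 0"
    then have half: "r / 2 > 0" by simp
    obtain N where N: "\<And>n. n \<ge> N \<Longrightarrow> bnd (f n - l) (r / 2)" using bnd_lim[OF half] by blast
    have mem: "f n - l \<in> rk_carrier" for n
      using f l_rk complex_vector.subspace_diff[OF rk_subspace] by blast
    have "norm (hnorm rk_space (f n - l) - 0) < r" if "n \<ge> N" for n
      using hnorm_le_if_bnd[OF mem N[OF that]] half rk.hnorm_ge_0[of "f n - l"] mem by simp
    then show "\<exists>N. \<forall>n\<ge>N. norm (hnorm rk_space (f n - l) - 0) < r" by blast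
  qed
  then show "\<exists>l\<in>hcarrier rk_space. (\<lambda>n. hnorm rk_space (f n - l)) \<longlonglongrightarrow> 0"
    using l_rk by auto
qed

lemma kf_span: "valid ys \<Longrightarrow> kf ys \<in> cspan {kf [(i, h)] | i h. i \<in> I \<and> h \<in> hcarrier H}"
proof (induction ys)
  case Nil
  then show ?case by (simp add: complex_vector.span_zero)
next
  case (Cons p ys)
  then have "kf [p] \<in> cspan {kf [(i, h)] | i h. i \<in> I \<and> h \<in> hcarrier H}"
    by (intro complex_vector.span_base) (cases p; auto)
  moreover have "kf ys \<in> cspan {kf [(i, h)] | i h. i \<in> I \<and> h \<in> hcarrier H}"
    using Cons by simp
  ultimately show ?case
    unfolding kf_Cons[of p ys] by (rule complex_vector.span_add)
qed

lemma rk_total: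
  "rk_carrier = htopology rk_space closure_of cspan {kf [(i, h)] | i h. i \<in> I \<and> h \<in> hcarrier H}"
proof -
  let ?E = "{kf [(i, h)] | i h. i \<in> I \<and> h \<in> hcarrier H}"
  have sub: "cspan ?E \<subseteq> rk_carrier"
    using kf_rk by (intro complex_vector.span_minimal rk_subspace) auto
  have "\<exists>y\<in>cspan ?E. hnorm rk_space (f - y) < e" if f: "f \<in> rk_carrier" and "e > 0" for f e
  proof -
    have half: "e / 2 > 0" using \<open>e > 0\<close> by simp
    obtain ys where ys: "valid ys" "bnd (f - kf ys) (e / 2)"
      using f half unfolding rk_carrier_def by blast
    have "f - kf ys \<in> rk_carrier"
      using f kf_rk[OF ys(1)] by (rule complex_vector.subspace_diff[OF rk_subspace])
    then have "hnorm rk_space (f - kf ys) \<le> e / 2"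
      using ys(2) half by (intro hnorm_le_if_bnd) auto
    then show ?thesis
      using kf_span[OF ys(1)] \<open>e > 0\<close> by (intro bexI[of _ "kf ys"]) auto
  qed
  moreover have "cspan ?E \<subseteq> hcarrier rk_space" using sub by simp
  ultimately show ?thesis
    using rk.in_closure_iff[of "cspan ?E"] by auto
qed

end

section \<open>Existence of the minimal dilation\<close>

lemma (in contraction_family) regular_op_zero: "h \<in> hcarrier H \<Longrightarrow> regular_op H T 0 h = h"
  by (simp add: regular_op_def adjoint_op_eqI[OF H.hilbert])

lemma (in contraction_family) positive_definite_kernel:
  assumes "regular_positivity \<Omega> S H T"
  shows "positive_definite_kernel H G (\<lambda>i j. regular_op H T (i - j))"
proof
  fix i j h k assume i: "i \<in> G" and j: "j \<in> G" and h: "h \<in> hcarrier H"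
  show "regular_op H T (i - j) h \<in> hcarrier H" using i j h by simp
  assume k: "k \<in> hcarrier H"
  have "form (- (j - i)) h k = cnj (form (j - i) k h)"
    using i j h k by (intro form_commute) simp_all
  then show "ip (regular_op H T (i - j) h) k = cnj (ip (regular_op H T (j - i) k) h)"
    using i j h k by (simp add: inner_regular_op)
next
  fix i h assume "i \<in> G" "h \<in> hcarrier H"
  then show "regular_op H T (i - i) h = h" by (simp add: regular_op_zero)
next
  fix n :: nat and g x
  assume g: "\<And>m. m < n \<Longrightarrow> g m \<in> G" and x: "\<And>m. m < n \<Longrightarrow> x m \<in> hcarrier H"
  have "(\<Sum>l<n. \<Sum>m<n. form (g l - g m) (x l) (x m)) \<in> \<real>\<^sub>\<ge>\<^sub>0"
    using assms g x by (intro form_positive) auto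
  also have "(\<Sum>l<n. \<Sum>m<n. form (g l - g m) (x l) (x m)) =
      (\<Sum>l<n. \<Sum>m<n. ip (regular_op H T (g l - g m) (x l)) (x m))"
    using g x by (intro sum.cong refl) (simp add: inner_regular_op)
  finally show "0 \<le> Re (\<Sum>l<n. \<Sum>m<n. ip (regular_op H T (g l - g m) (x l)) (x m))"
    by (simp add: complex_nonneg_Reals_iff)
qed

locale positive_contraction_family = contraction_family +
  assumes positivity: "regular_positivity \<Omega> S H T"

sublocale positive_contraction_family \<subseteq>
  rk: positive_definite_kernel H "difference_group S" "\<lambda>i j. regular_op H T (i - j)"
  by (rule positive_definite_kernel[OF positivity])

section \<open>Translations on the kernel space\<close>

context positive_contraction_family
begin

text \<open>The sign is chosen so that the generator at i moves to i + s, as required by U(s) R(g) =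
  R(g + s). Translations act on the space because the kernel depends on i - j only.\<close>

definition shift :: "('a \<Rightarrow> real) \<Rightarrow> (('a \<Rightarrow> real) \<Rightarrow> 'b) \<Rightarrow> ('a \<Rightarrow> real) \<Rightarrow> 'b" where
  "shift s f = (\<lambda>j. f (j - s))"

definition shift_list :: "('a \<Rightarrow> real) \<Rightarrow> (('a \<Rightarrow> real) \<times> 'b) list \<Rightarrow> (('a \<Rightarrow> real) \<times> 'b) list" where
  "shift_list s zs = map (\<lambda>(i, h). (i + s, h)) zs"

lemma valid_shift_list: "s \<in> G \<Longrightarrow> rk.valid zs \<Longrightarrow> rk.valid (shift_list s zs)"
  by (auto simp: shift_list_def)

lemma shift_list_shift_list: "shift_list t (shift_list s zs) = shift_list (s + t) zs"
  by (simp add: shift_list_def o_def case_prod_unfold add.assoc)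

lemma shift_list_inverse: "shift_list (- s) (shift_list s zs) = zs"
  unfolding shift_list_shift_list right_minus by (simp add: shift_list_def case_prod_unfold)

lemma shift_shift: "shift s (shift t f) = shift (s + t) f"
  by (simp add: shift_def fun_eq_iff diff_diff_eq)

lemma shift_zero [simp]: "shift 0 f = f"
  by (simp add: shift_def)

lemma shift_add: "shift s (f + f') = shift s f + shift s f'"
  and shift_diff: "shift s (f - f') = shift s f - shift s f'"
  and shift_scaleC: "shift s (c *\<^sub>C f) = c *\<^sub>C shift s f"
  by (auto simp: shift_def scaleC_fun_def plus_fun_def fun_diff_def)

lemma shift_kf:
  assumes s: "s \<in> G"
  shows "shift s (rk.kf ys) = rk.kf (shift_list s ys)"
proof
  fix j
  show "shift s (rk.kf ys) j = rk.kf (shift_list s ys) j"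
    using group_diff_iff[OF s, of j]
    by (simp add: shift_def rk.kf_def shift_list_def o_def case_prod_unfold diff_diff_eq2)
qed

lemma pairing_shift: "rk.pairing (shift s f) zs = rk.pairing f (shift_list (- s) zs)"
  by (simp add: rk.pairing_def shift_def shift_list_def o_def case_prod_unfold)

lemma nrm_shift_list:
  assumes "s \<in> G"
  shows "rk.nrm (shift_list s zs) = rk.nrm zs"
  by (simp add: rk.nrm_def pairing_shift shift_list_inverse flip: shift_kf[OF assms])

lemma shift_hfuns: "s \<in> G \<Longrightarrow> f \<in> rk.hfuns \<Longrightarrow> shift s f \<in> rk.hfuns"
  by (simp add: rk.hfuns_def shift_def group_diff_iff)

lemma bnd_shift:
  assumes s: "s \<in> G" and f: "rk.bnd f c"
  shows "rk.bnd (shift s f) c"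
  unfolding rk.bnd_def
proof (intro allI impI)
  fix zs assume "rk.valid zs"
  then have "rk.valid (shift_list (- s) zs)"
    using s by (intro valid_shift_list) simp_all
  from rk.bndD[OF f this] show "cmod (rk.pairing (shift s f) zs) \<le> c * rk.nrm zs"
    using s by (simp add: pairing_shift nrm_shift_list)
qed

lemma shift_rk:
  assumes s: "s \<in> G" and f: "f \<in> rk.rk_carrier"
  shows "shift s f \<in> rk.rk_carrier"
  unfolding rk.rk_carrier_def
proof (intro CollectI conjI allI impI)
  show "shift s f \<in> rk.hfuns" using s f by (intro shift_hfuns rk.rk_hfuns)
  fix \<epsilon> :: real assume "\<epsilon> > 0"
  then obtain ys where ys: "rk.valid ys" "rk.bnd (f - rk.kf ys) \<epsilon>"
    using f unfolding rk.rk_carrier_def by blast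
  have "rk.bnd (shift s f - rk.kf (shift_list s ys)) \<epsilon>"
    using bnd_shift[OF s ys(2)] by (simp only: shift_diff shift_kf[OF s])
  then show "\<exists>ys. rk.valid ys \<and> rk.bnd (shift s f - rk.kf ys) \<epsilon>"
    using valid_shift_list[OF s ys(1)] by blast
qed

lemma shift_inner:
  assumes s: "s \<in> G" and f: "f \<in> rk.rk_carrier" and f': "f' \<in> rk.rk_carrier"
  shows "rk.rk_inner (shift s f) (shift s f') = rk.rk_inner f f'"
proof -
  obtain a where a: "0 \<le> a" "rk.bnd f a" using rk.rk_bounded[OF f] by blast
  \<comment> \<open>Shifted approximants of f' approximate the shifted function equally well, so
    both inner products are within a / (n + 1) of the same pairing.\<close>
  have "cmod (rk.rk_inner (shift s f) (shift s f') - rk.rk_inner f f') \<le> 2 * a * (1 / real (Suc n))" for n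
  proof -
    let ?ys = "rk.appr f' n" and ?\<delta> = "1 / real (Suc n)"
    note ys = rk.appr[OF f', of n]
    have "rk.bnd (shift s f' - rk.kf (shift_list s ?ys)) ?\<delta>"
      using bnd_shift[OF s ys(2)] by (simp only: shift_diff shift_kf[OF s])
    then have "cmod (rk.pairing (shift s f) (shift_list s ?ys) - rk.rk_inner (shift s f) (shift s f')) \<le> a * ?\<delta>"
      using s f f' a ys(1) by (intro rk.rk_inner_approx shift_rk bnd_shift valid_shift_list) auto
    moreover have "rk.pairing (shift s f) (shift_list s ?ys) = rk.pairing f ?ys"
      by (simp add: pairing_shift shift_list_inverse)
    moreover have "cmod (rk.pairing f ?ys - rk.rk_inner f f') \<le> a * ?\<delta>"
      using f a f' ys by (intro rk.rk_inner_approx) auto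
    ultimately show ?thesis
      using norm_triangle_ineq4[of "rk.pairing f ?ys - rk.rk_inner f f'"
          "rk.pairing f ?ys - rk.rk_inner (shift s f) (shift s f')"] by simp
  qed
  moreover have "(\<lambda>n. 2 * a * (1 / real (Suc n))) \<longlonglongrightarrow> 2 * a * 0"
    by (intro tendsto_mult_left rk.one_over_Suc_lim)
  ultimately have "cmod (rk.rk_inner (shift s f) (shift s f') - rk.rk_inner f f') \<le> 2 * a * 0"
    by (intro LIMSEQ_le_const[of "\<lambda>n. 2 * a * (1 / real (Suc n))"]) auto
  then show ?thesis by simp
qed

lemma shift_isometric: "s \<in> S \<Longrightarrow> isometric_op rk.rk_space rk.rk_space (shift s)"
  by (auto simp: isometric_op_def linear_op_def shift_rk shift_inner shift_add shift_scaleC)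

lemma shift_unitary:
  assumes s: "s \<in> S"
  shows "unitary_op rk.rk_space rk.rk_space (shift s)"
proof -
  have "f \<in> shift s ` rk.rk_carrier" if "f \<in> rk.rk_carrier" for f
  proof
    show "f = shift s (shift (- s) f)" by (simp add: shift_shift)
    show "shift (- s) f \<in> rk.rk_carrier" using s that by (intro shift_rk) simp_all
  qed
  then show ?thesis
    using s shift_isometric shift_rk by (auto simp: unitary_op_def)
qed

lemma shift_semigroup: "unitary_semigroup S rk.rk_space shift"
  unfolding unitary_semigroup_def op_semigroup_def
  by (auto simp: shift_unitary shift_shift intro: isometric_imp_bounded shift_isometric)

sublocale rk: unitary_family \<Omega> \<S> S rk.rk_space shift
  using shift_semigroup rk.rk_hilbert by unfold_locales

text \<open>H sits at the neutral element: the kernel at (0, 0) is the identity, hence the map is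
  isometric.\<close>

definition embedding :: "'b \<Rightarrow> ('a \<Rightarrow> real) \<Rightarrow> 'b" where
  "embedding h = rk.kf [(0, h)]"

lemma rk_inner_generators:
  assumes "i \<in> G" "j \<in> G" "h \<in> hcarrier H" "k \<in> hcarrier H"
  shows "rk.rk_inner (rk.kf [(i, h)]) (rk.kf [(j, k)]) = ip (regular_op H T (i - j) h) k"
proof -
  have "rk.rk_inner (rk.kf [(i, h)]) (rk.kf [(j, k)]) = rk.pairing (rk.kf [(i, h)]) [(j, k)]"
    using assms by (intro rk.rk_inner_kf rk.kf_rk) auto
  also have "\<dots> = ip (regular_op H T (i - j) h) k"
    using assms by (simp add: rk.pairing_def rk.kf_def)
  finally show ?thesis .
qed

lemma embedding_isometric: "isometric_op H rk.rk_space embedding"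
proof -
  have "embedding h \<in> rk.rk_carrier" if "h \<in> hcarrier H" for h
    unfolding embedding_def using that by (intro rk.kf_rk) simp
  moreover have "embedding (h + k) = embedding h + embedding k"
    if "h \<in> hcarrier H" "k \<in> hcarrier H" for h k
  proof
    fix j
    show "embedding (h + k) j = (embedding h + embedding k) j"
      using that rk.kernel_add[of 0 j h k] by (simp add: embedding_def rk.kf_def plus_fun_def)
  qed
  moreover have "embedding (c *\<^sub>C h) = c *\<^sub>C embedding h" if "h \<in> hcarrier H" for c h
  proof
    fix j
    show "embedding (c *\<^sub>C h) j = (c *\<^sub>C embedding h) j"
      using that rk.kernel_scaleC[of 0 j h c] by (simp add: embedding_def rk.kf_def scaleC_fun_def)
  qed
  moreover have "rk.rk_inner (embedding h) (embedding k) = ip h k"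
    if "h \<in> hcarrier H" "k \<in> hcarrier H" for h k
    using that by (simp add: embedding_def rk_inner_generators regular_op_zero)
  ultimately show ?thesis
    by (simp add: isometric_op_def linear_op_def)
qed

text \<open>The generator at g is the translate by g of the one at 0, so the vectors that have to
  span a minimal dilation are exactly the generators of the kernel space.\<close>

lemma R_embedding:
  assumes g: "g \<in> G" and h: "h \<in> hcarrier H"
  shows "rk.R g (embedding h) = rk.kf [(g, h)]"
proof -
  have shift_gen: "shift s (rk.kf [(i, h)]) = rk.kf [(i + s, h)]" if "s \<in> S" for s i
    using that shift_kf[of s "[(i, h)]"] by (simp add: shift_list_def)
  have "rk.R (pos_part g - neg_part g) (embedding h) = rk.kf [(g, h)]"
  proof (rule rk.R_eqI)
    have "g + neg_part g = pos_part g" by (simp add: neg_part_def)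
    then show "shift (neg_part g) (rk.kf [(g, h)]) = shift (pos_part g) (embedding h)"
      using g by (simp add: shift_gen embedding_def)
  qed (use g h rk.kf_rk in \<open>auto simp: embedding_def\<close>)
  then show ?thesis by (simp add: pos_part_minus_neg_part)
qed

text \<open>The compression to H of translation by g is the kernel at (g, 0), which is the required
  regular operator; minimality is the totality of the generators.\<close>

theorem minimal_dilation_exists:
  "minimal_regular_unitary_dilation S H T rk.rk_space embedding shift"
proof -
  have mem: "embedding h \<in> rk.rk_carrier" if "h \<in> hcarrier H" for h
    using embedding_isometric that by (auto simp: isometric_op_def linear_op_def)
  have "orth_proj rk.rk_space (embedding ` hcarrier H) (rk.R g (embedding h)) =
      embedding (regular_op H T g h)" if g: "g \<in> G" and h: "h \<in> hcarrier H" for g h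
  proof (rule orth_proj_range_eqI[OF rk.rk_hilbert embedding_isometric])
    show "rk.R g (embedding h) \<in> hcarrier rk.rk_space"
      using g mem[OF h] by (intro rk.R_mem) simp_all
    show "hinner rk.rk_space (rk.R g (embedding h)) (embedding k) =
        hinner rk.rk_space (embedding (regular_op H T g h)) (embedding k)"
      if k: "k \<in> hcarrier H" for k
      unfolding R_embedding[OF g h]
      using g h k by (simp add: embedding_def rk_inner_generators regular_op_zero)
  qed (use g h in simp)
  then have dilation: "regular_unitary_dilation S H T rk.rk_space embedding shift"
    using rk.rk_hilbert embedding_isometric shift_semigroup
    by (simp add: regular_unitary_dilation_def)
  have "{rk.R g (embedding h) | g h. g \<in> G \<and> h \<in> hcarrier H} =
      {rk.kf [(i, h)] | i h. i \<in> G \<and> h \<in> hcarrier H}"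
    using R_embedding by (intro Collect_cong) metis
  then show ?thesis
    unfolding minimal_regular_unitary_dilation_def using dilation rk.rk_total by simp
qed

end

lemma (in contraction_family) regular_dilationI:
  assumes dilation: "regular_unitary_dilation S H T K V U"
  shows "regular_dilation \<Omega> \<S> S H T K U V"
  using dilation by unfold_locales (auto simp: regular_unitary_dilation_def)

lemma (in contraction_family) minimal_dilationI:
  assumes "minimal_regular_unitary_dilation S H T K V U"
  shows "minimal_dilation \<Omega> \<S> S H T K U V"
proof -
  interpret regular_dilation \<Omega> \<S> S H T K U V
    using assms by (intro regular_dilationI) (simp add: minimal_regular_unitary_dilation_def)
  show ?thesis
    using assms by unfold_locales (simp add: minimal_regular_unitary_dilation_def)
qed

theorem theorem3p6:
  fixes \<Omega> :: "'i set" and \<S> :: "'i \<Rightarrow> real set"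
    and S :: "('i \<Rightarrow> real) set"
    and H :: "'h::complex_vector hilbert"
    and T :: "('i \<Rightarrow> real) \<Rightarrow> 'h \<Rightarrow> 'h"
  assumes "\<And>i. i \<in> \<Omega> \<Longrightarrow> commensurable_subsemigroup (\<S> i)"
    and "S = index_semigroup \<Omega> \<S>"
    and "hilbert_space H"
    and "contraction_semigroup S H T"
  shows
    \<comment> \<open>existence; the dilation space may be found among the \<open>H\<close>-valued functions on \<open>S - S\<close>,
        whereas in the converse direction it is arbitrary\<close>
    "((\<exists>(K :: (('i \<Rightarrow> real) \<Rightarrow> 'h) hilbert) V U. regular_unitary_dilation S H T K V U)
        \<longleftrightarrow> regular_positivity \<Omega> S H T) \<and>
     ((\<exists>(K :: 'k::complex_vector hilbert) V U. regular_unitary_dilation S H T K V U)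
        \<longrightarrow> regular_positivity \<Omega> S H T) \<and>
     \<comment> \<open>existence of a minimal dilation, and its uniqueness\<close>
     (regular_positivity \<Omega> S H T \<longrightarrow>
        (\<exists>(K :: (('i \<Rightarrow> real) \<Rightarrow> 'h) hilbert) V U. minimal_regular_unitary_dilation S H T K V U)) \<and>
     (\<forall>(K :: 'k hilbert) V U (K' :: 'l::complex_vector hilbert) V' U'.
        minimal_regular_unitary_dilation S H T K V U \<and>
        minimal_regular_unitary_dilation S H T K' V' U' \<longrightarrow>
        unitarily_equivalent_dilations S H K V U K' V' U') \<and>
     \<comment> \<open>continuity\<close>
     (\<forall>X. compatible_topology S X \<and> weakly_continuous X H T \<longrightarrow>
        (\<forall>(K :: 'k hilbert) V U. minimal_regular_unitary_dilation S H T K V U \<longrightarrow>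
           strongly_continuous X K U))"
proof -
  interpret contraction_family \<Omega> \<S> S H T
    using assms by unfold_locales
  have existence: "\<exists>(K :: (('i \<Rightarrow> real) \<Rightarrow> 'h) hilbert) V U. minimal_regular_unitary_dilation S H T K V U"
    if "regular_positivity \<Omega> S H T"
  proof -
    interpret positive_contraction_family \<Omega> \<S> S H T
      using that by unfold_locales
    show ?thesis using minimal_dilation_exists by blast
  qed
  moreover have "regular_positivity \<Omega> S H T"
    if "regular_unitary_dilation S H T K V U" for K :: "(('i \<Rightarrow> real) \<Rightarrow> 'h) hilbert" and V U
    by (rule regular_dilation.regular_positivity[OF regular_dilationI[OF that]])
  moreover have "regular_positivity \<Omega> S H T"
    if "regular_unitary_dilation S H T K V U" for K :: "'k hilbert" and V U
    by (rule regular_dilation.regular_positivity[OF regular_dilationI[OF that]])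
  moreover have "unitarily_equivalent_dilations S H K V U K' V' U'"
    if "minimal_regular_unitary_dilation S H T K V U" "minimal_regular_unitary_dilation S H T K' V' U'"
    for K :: "'k hilbert" and V U and K' :: "'l hilbert" and V' U'
    by (rule minimal_dilations_equivalent[OF minimal_dilationI[OF that(1)] minimal_dilationI[OF that(2)]])
  moreover have "strongly_continuous X K U"
    if "compatible_topology S X" "weakly_continuous X H T" "minimal_regular_unitary_dilation S H T K V U"
    for X and K :: "'k hilbert" and V U
    by (rule minimal_dilation.strongly_continuous[OF minimal_dilationI[OF that(3)] that(1,2)])
  ultimately show ?thesis
    unfolding minimal_regular_unitary_dilation_def by blast
qed

end
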